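(* Let $h:\mathbb{R}\to\mathbb{R}$ and $x^\star\in\mathbb{R}$ satisfy Assumptions (A1) and (A2) of the context, and let $r,\delta,d$ be arbitrary positive numbers such that $r-d-2\delta>0$. Let $\mathcal{A}_\delta$, $\tau$, $\chi$, $L_r$, $a_{0,\delta}$ be as in the context and let $r_0:=\chi(r-d-2\delta)$. Then there exist $\bar t=\bar t(r_0,d)$ and $\gamma^\star=\gamma^\star(L_r,\delta,d)>0$ (so that $\gamma^\star$ depends on the cost function only through its Lipschitz constant $L_r$, and not on a bound $M_r$ of $|h|$ on $[x^\star-r,x^\star+r]$) such that for any $\gamma\in(0,\gamma^\star)$ and any $(x_0,\bar y_0)\in\mathbb{R}\times\mathbb{R}$ fulfilling $|x_0-x^\star|\le r_0$ and $|\bar y_0-a_{0,\delta}(x_0)/2|\le\gamma^\star$, the trajectory of $$\dot x=-\gamma\big(h(x+\delta u(t))-\bar y\big)u(t),\quad x(0)=x_0,\qquad \dot{\bar y}=\gamma\big(h(x+\delta u(t))-\bar y\big),\quad \bar y(0)=\bar y_0,$$ with $u(t)=\sin(2\pi t)$, is bounded and $$\|(x(t),\bar y(t))\|_{\operatorname{graph}\tau|_{\mathcal{A}_\delta}}\le d\qquad\forall\,t\ge\frac{\bar t}{\gamma}.$$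
   Context: Assumption (A1): $h$ is smooth and $x^\star\in\mathbb{R}$ is such that $h(x)-h(x^\star)>0$ for all $x\in\mathbb{R}$ with $x\neq x^\star$. Assumption (A2): $h$ is locally Lipschitz and strictly quasi-convex (i.e. $h(x_1)<h(x_2)$ implies $h(\lambda x_1+(1-\lambda)x_2)<h(x_2)$ for all $\lambda\in(0,1)$), and there exists a class-$\mathcal{K}_\infty$ function $\alpha$ such that $|h(x_2)-h(x_1)|\ge\alpha(|x_2-x_1|)$ for all $x_1,x_2\in\mathbb{R}$ with $(x_1-x^\star)(x_2-x^\star)\ge 0$. Let $a_{0,\delta}(x):=2\int_0^1 h(x+\delta\sin(2\pi t))\,dt$ and $b_{1,\delta}(x):=2\int_0^1 h(x+\delta\sin(2\pi t))\sin(2\pi t)\,dt$. The average system is $$\dot x_a=-\gamma\,\tfrac{b_{1,\delta}(x_a)}{2},\qquad \dot{\bar y}_a=-\gamma\,\bar y_a+\gamma\,\tfrac{a_{0,\delta}(x_a)}{2}.$$ For each $\delta>0$, $\mathcal{A}_\delta\subseteq[x^\star-\delta,x^\star+\delta]$ denotes a compact set and $\tau:\mathbb{R}\to\mathbb{R}$ a continuous function such that $\mathcal{A}_\delta$ is globally asymptotically and locally exponentially stable for the $x_a$-subsystem, and $\operatorname{graph}\tau|_{\mathcal{A}_\delta}=\{(x_a,y_a)\in\mathcal{A}_\delta\times\mathbb{R}: y_a=\tau(x_a)\}$ is globally asymptotically and locally exponentially stable for the average system (the paper shows that these exist). For a set $S$, $|\cdot|_S$ and $\|\cdot\|_S$ denote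 distance to $S$. $\beta$ denotes a class-$\mathcal{KL}$ function such that every trajectory of the $x_a$-subsystem satisfies $|x_a(t)|_{\mathcal{A}_\delta}\le\beta(|x_a(0)|_{\mathcal{A}_\delta},\gamma t)$ for all $t\ge0$, with $\beta(\cdot,0)$ of class $\mathcal{K}_\infty$; and $\chi(s):=\beta^{-1}(s,0)$ is the class-$\mathcal{K}_\infty$ inverse of $s\mapsto\beta(s,0)$. For $r>0$, $L_r>0$ is a constant such that $|h(x_1)-h(x_2)|\le L_r|x_1-x_2|$ for all $x_1,x_2\in[x^\star-r,x^\star+r]$. Writing a constant as $c(p_1,p_2,\dots)$ indicates the quantities on which it depends. Class $\mathcal{K}_\infty$: continuous, strictly increasing, unbounded functions $[0,\infty)\to[0,\infty)$ vanishing at $0$. Class $\mathcal{KL}$: functions $\beta(s,t)$ on $[0,\infty)^2$, continuous, strictly increasing in $s$ with $\beta(0,t)=0$, and decreasing to $0$ in $t$. *)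

theory Defs
  imports "HOL-Analysis.Analysis"
begin

section \<open>Comparison functions\<close>

text \<open>Comparison functions live on \<open>[0, \<infinity>)\<close>; they are total HOL functions whose values at
  negative arguments are irrelevant.\<close>

definition class_Kinf :: "(real \<Rightarrow> real) \<Rightarrow> bool" where
  "class_Kinf a \<longleftrightarrow>
     continuous_on {0..} a \<and> strict_mono_on {0..} a \<and> a 0 = 0 \<and> (\<forall>M. \<exists>s\<ge>0. M < a s)"

text \<open>"Decreasing" in the second argument is read in the weak sense: a strict reading is
  impossible at \<open>s = 0\<close>.\<close>

definition class_KL :: "(real \<Rightarrow> real \<Rightarrow> real) \<Rightarrow> bool" where
  "class_KL \<beta> \<longleftrightarrow>
     continuous_on ({0..} \<times> {0..}) (\<lambda>(s, t). \<beta> s t) \<and>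
     (\<forall>t\<ge>0. strict_mono_on {0..} (\<lambda>s. \<beta> s t) \<and> \<beta> 0 t = 0) \<and>
     (\<forall>s\<ge>0. antimono_on {0..} (\<beta> s) \<and> (\<beta> s \<longlongrightarrow> 0) at_top)"

definition KL_inverse0 :: "(real \<Rightarrow> real \<Rightarrow> real) \<Rightarrow> real \<Rightarrow> real" where
  "KL_inverse0 \<beta> = the_inv_into {0..} (\<lambda>s. \<beta> s 0)"


section \<open>Assumptions on the cost function\<close>

definition smooth_fun :: "(real \<Rightarrow> real) \<Rightarrow> bool" where
  "smooth_fun h \<longleftrightarrow> (\<forall>n. (deriv ^^ n) h differentiable_on UNIV)"

definition strictly_quasi_convex :: "(real \<Rightarrow> real) \<Rightarrow> bool" where
  "strictly_quasi_convex h \<longleftrightarrow>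
     (\<forall>x1 x2. h x1 < h x2 \<longrightarrow> (\<forall>l\<in>{0<..<1}. h (l * x1 + (1 - l) * x2) < h x2))"

definition assumption_A1 :: "(real \<Rightarrow> real) \<Rightarrow> real \<Rightarrow> bool" where
  "assumption_A1 h xs \<longleftrightarrow> smooth_fun h \<and> (\<forall>x. x \<noteq> xs \<longrightarrow> h x - h xs > 0)"

text \<open>The library predicate \<^const>\<open>local_lipschitz\<close> is about families of functions;
  \<open>h\<close> is viewed as a constant family.\<close>

definition assumption_A2 :: "(real \<Rightarrow> real) \<Rightarrow> real \<Rightarrow> bool" where
  "assumption_A2 h xs \<longleftrightarrow>
     local_lipschitz (UNIV :: real set) UNIV (\<lambda>_. h) \<and>
     strictly_quasi_convex h \<and>
     (\<exists>\<alpha>. class_Kinf \<alpha> \<and>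
       (\<forall>x1 x2. (x1 - xs) * (x2 - xs) \<ge> 0 \<longrightarrow> \<bar>h x2 - h x1\<bar> \<ge> \<alpha> \<bar>x2 - x1\<bar>))"


section \<open>Stability of sets for autonomous differential equations\<close>

definition solution :: "('a::real_normed_vector \<Rightarrow> 'a) \<Rightarrow> (real \<Rightarrow> 'a) \<Rightarrow> bool" where
  "solution f z \<longleftrightarrow> (\<forall>t\<ge>0. (z has_vector_derivative f (z t)) (at t within {0..}))"

text \<open>Forward completeness is part of global asymptotic stability, so the quantification over
  solutions on \<open>[0, \<infinity>)\<close> is not vacuous.\<close>

definition globally_asymptotically_stable ::
    "('a::real_normed_vector \<Rightarrow> 'a) \<Rightarrow> 'a set \<Rightarrow> bool" where
  "globally_asymptotically_stable f S \<longleftrightarrow>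
     (\<forall>z0. \<exists>z. solution f z \<and> z 0 = z0) \<and>
     (\<forall>\<epsilon>>0. \<exists>\<eta>>0. \<forall>z. solution f z \<and> infdist (z 0) S < \<eta> \<longrightarrow> (\<forall>t\<ge>0. infdist (z t) S < \<epsilon>)) \<and>
     (\<forall>z. solution f z \<longrightarrow> ((\<lambda>t. infdist (z t) S) \<longlongrightarrow> 0) at_top)"

definition locally_exponentially_stable ::
    "('a::real_normed_vector \<Rightarrow> 'a) \<Rightarrow> 'a set \<Rightarrow> bool" where
  "locally_exponentially_stable f S \<longleftrightarrow>
     (\<exists>\<eta>>0. \<exists>k>0. \<exists>c>0. \<forall>z. solution f z \<and> infdist (z 0) S < \<eta> \<longrightarrow>
        (\<forall>t\<ge>0. infdist (z t) S \<le> k * exp (- c * t) * infdist (z 0) S))"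


section \<open>The average system\<close>

definition a0 :: "(real \<Rightarrow> real) \<Rightarrow> real \<Rightarrow> real \<Rightarrow> real" where
  "a0 h \<delta> x = 2 * integral {0..1} (\<lambda>t. h (x + \<delta> * sin (2 * pi * t)))"

definition b1 :: "(real \<Rightarrow> real) \<Rightarrow> real \<Rightarrow> real \<Rightarrow> real" where
  "b1 h \<delta> x = 2 * integral {0..1} (\<lambda>t. h (x + \<delta> * sin (2 * pi * t)) * sin (2 * pi * t))"

definition avg_x_field :: "(real \<Rightarrow> real) \<Rightarrow> real \<Rightarrow> real \<Rightarrow> real \<Rightarrow> real" where
  "avg_x_field h \<delta> \<gamma> x = - \<gamma> * (b1 h \<delta> x / 2)"

definition avg_field :: "(real \<Rightarrow> real) \<Rightarrow> real \<Rightarrow> real \<Rightarrow> real \<times> real \<Rightarrow> real \<times> real" where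
  "avg_field h \<delta> \<gamma> = (\<lambda>(x, y). (avg_x_field h \<delta> \<gamma> x, - \<gamma> * y + \<gamma> * (a0 h \<delta> x / 2)))"

definition graph_on :: "(real \<Rightarrow> real) \<Rightarrow> real set \<Rightarrow> (real \<times> real) set" where
  "graph_on \<tau> A = {(x, y). x \<in> A \<and> y = \<tau> x}"

text \<open>\<open>A\<close> and \<open>\<tau>\<close> do not depend on the gain, which only rescales time in the average
  system; the stability properties are therefore required for every \<open>\<gamma> > 0\<close>.
  Nonemptiness is needed because \<^const>\<open>infdist\<close> to the empty set is 0.\<close>

definition attractor_data ::
    "(real \<Rightarrow> real) \<Rightarrow> real \<Rightarrow> real \<Rightarrow> real set \<Rightarrow> (real \<Rightarrow> real) \<Rightarrow> bool" where
  "attractor_data h xs \<delta> A \<tau> \<longleftrightarrow>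
     compact A \<and> A \<noteq> {} \<and> A \<subseteq> {xs - \<delta>..xs + \<delta>} \<and> continuous_on UNIV \<tau> \<and>
     (\<forall>\<gamma>>0.
        globally_asymptotically_stable (avg_x_field h \<delta> \<gamma>) A \<and>
        locally_exponentially_stable (avg_x_field h \<delta> \<gamma>) A \<and>
        globally_asymptotically_stable (avg_field h \<delta> \<gamma>) (graph_on \<tau> A) \<and>
        locally_exponentially_stable (avg_field h \<delta> \<gamma>) (graph_on \<tau> A))"

definition KL_estimate ::
    "(real \<Rightarrow> real) \<Rightarrow> real \<Rightarrow> real set \<Rightarrow> (real \<Rightarrow> real \<Rightarrow> real) \<Rightarrow> bool" where
  "KL_estimate h \<delta> A \<beta> \<longleftrightarrow>
     class_KL \<beta> \<and> class_Kinf (\<lambda>s. \<beta> s 0) \<and>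
     (\<forall>\<gamma>>0. \<forall>x. solution (avg_x_field h \<delta> \<gamma>) x \<longrightarrow>
        (\<forall>t\<ge>0. infdist (x t) A \<le> \<beta> (infdist (x 0) A) (\<gamma> * t)))"


section \<open>The extremum seeking system\<close>

definition dither :: "real \<Rightarrow> real" where
  "dither t = sin (2 * pi * t)"

definition es_trajectory ::
    "(real \<Rightarrow> real) \<Rightarrow> real \<Rightarrow> real \<Rightarrow> real \<Rightarrow> real \<Rightarrow> (real \<Rightarrow> real) \<Rightarrow> (real \<Rightarrow> real) \<Rightarrow> bool" where
  "es_trajectory h \<delta> \<gamma> x0 y0 x y \<longleftrightarrow>
     x 0 = x0 \<and> y 0 = y0 \<and>
     (\<forall>t\<ge>0.
        (x has_real_derivative - \<gamma> * (h (x t + \<delta> * dither t) - y t) * dither t) (at t within {0..}) \<and>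
        (y has_real_derivative \<gamma> * (h (x t + \<delta> * dither t) - y t)) (at t within {0..}))"

end

theory Submission
  imports Defs
begin

text \<open>
  A finite-horizon averaging estimate would only give a gain that depends on how fast the average
  system converges, hence on much more of \<open>h\<close> than \<open>L\<close>. The proof therefore does not compare with
  trajectories of the average system: it shows that the exact drift over each dither period has the
  right sign, for every gain below a bound in \<open>L\<close>, \<open>\<delta>\<close>, \<open>d\<close>.

  Target. Let \<open>e\<close> be a zero of \<open>b1 h \<delta>\<close>. The constant \<open>(e, a0 h \<delta> e / 2)\<close> solves the average system,
  so it lies in the attracting graph (\<open>attractor_equilibrium\<close>), and it is enough to bring \<open>x\<close> and \<open>y\<close>
  within \<open>d / 2\<close> of its coordinates.

  Exact averaging. Let \<open>u\<close> be the dither and \<open>Q\<close> the periodic solution of \<open>Q' = \<gamma> Q + u\<close>. Then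
  \<open>(x - \<gamma> Q (y - c))' = - \<gamma> (h (x + \<delta> u) - c) Q'\<close> for every constant \<open>c\<close> (\<open>exact_averaging\<close>): the
  displacement over a period depends only on the values of \<open>h\<close> along the probe \<open>p = x + \<delta> u\<close>.

  Sign of the drift. Integration by parts turns the displacement into the integral of
  \<open>h'(p) p' S\<close> over an ascending and a descending half sweep of the probe, with a weight \<open>S \<ge> 0\<close>. At
  \<open>e\<close> the integral of \<open>h'\<close> against \<open>w = sqrt (1 - \<sigma>\<^sup>2)\<close> vanishes, where \<open>\<sigma> = (v - e) / \<delta>\<close>. The weight
  \<open>w\<close> is log-concave, and to the right of \<open>e\<close> the ratio \<open>S / w\<close> increases with the level: for
  \<open>\<gamma> \<rightarrow> 0\<close> the sign of its derivative is that of \<open>(\<sigma> + c) (1 - c \<sigma>)\<close>, where \<open>\<sigma> + c\<close> is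
  \<open>(x - e) / \<delta>\<close> and \<open>c\<close> the cosine of the phase. This leaves a margin for errors
  of order \<open>\<gamma>\<close> that depend only on \<open>L\<close> and \<open>\<delta>\<close> (\<open>ratio_derivative_nonneg\<close>). Quasi-convexity makes \<open>h'\<close>
  change sign only once, at \<open>xs\<close>; subtracting the right multiple of the balance at \<open>e\<close> then shows that the
  drift points towards \<open>e\<close> (\<open>sweep_comparison\<close>). Near the top of the sweep \<open>h (p)\<close> exceeds a lower
  level by a definite amount, so the speed is at least a multiple of \<open>\<gamma>\<close> (\<open>period_drift\<close>).

  Bounds. The difference \<open>y - h x\<close> shrinks over full periods, which bounds
  \<open>h (p) - y\<close> by \<open>rate_bound L \<delta>\<close> (\<open>lag_bounded\<close>). The left side of \<open>e\<close> follows by reflecting \<open>x\<close> and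
  shifting time by half a period (\<open>reflected\<close>). Once \<open>x\<close> is near \<open>e\<close>, \<open>y\<close> is a low-pass filter
  of an almost periodic input with mean close to \<open>a0 h \<delta> e / 2\<close> (\<open>filter_converges\<close>).

  All this is applied to a globally Lipschitz extension of \<open>h\<close> from \<open>[xs - r, xs + r]\<close>,
  whose trajectories exist for all time and never leave the window, so by uniqueness they are the
  trajectories for \<open>h\<close> (\<open>practical_convergence\<close>). The settling time may depend on \<open>h\<close> but not on the
  Lipschitz constant supplied; as the gain bound decreases in \<open>L\<close>, it is computed from the smallest
  one (\<open>uniform_settling_time\<close>).
\<close>

section \<open>Crossings, increments and first-order filters on the line\<close>

text \<open>The crossing time is the largest point of the compact set where \<open>f \<le> c\<close>.\<close>

lemma last_crossing:
  fixes f :: "real \<Rightarrow> real"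
  assumes "a \<le> b" and cont: "continuous_on {a..b} f" and "f a \<le> c" "c \<le> f b"
  obtains s where "a \<le> s" "s \<le> b" "f s = c" "\<And>t. s < t \<Longrightarrow> t \<le> b \<Longrightarrow> c < f t"
proof -
  define K where "K = {t \<in> {a..b}. f t \<le> c}"
  have "closed K" unfolding K_def
    using continuous_on_closed_Collect_le[OF cont continuous_on_const, of c] by simp
  moreover have bdd: "bounded K" unfolding K_def by (rule bounded_subset[of "{a..b}"]) auto
  ultimately have "compact K" by (simp add: compact_eq_bounded_closed)
  moreover have "K \<noteq> {}" using assms unfolding K_def by auto
  ultimately obtain s where s: "s \<in> K" "\<And>t. t \<in> K \<Longrightarrow> t \<le> s"
    using compact_attains_sup[of K] by blast
  have gt: "c < f t" if "s < t" "t \<le> b" for t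
    using s(2)[of t] that s(1) unfolding K_def by force
  have "f s = c"
  proof -
    have "continuous_on {s..b} f" using s(1) by (intro continuous_on_subset[OF cont]) (auto simp: K_def)
    then obtain t where "s \<le> t" "t \<le> b" "f t = c"
      using IVT'[of f s c b] s(1) assms by (auto simp: K_def)
    then show ?thesis using gt[of t] by force
  qed
  with s(1) gt show thesis by (intro that[of s]) (auto simp: K_def)
qed

lemma first_crossing:
  fixes f :: "real \<Rightarrow> real"
  assumes "a \<le> b" and cont: "continuous_on {a..b} f" and "c \<le> f a" "f b \<le> c"
  obtains s where "a \<le> s" "s \<le> b" "f s = c" "\<And>t. a \<le> t \<Longrightarrow> t < s \<Longrightarrow> c < f t"
proof -
  have "continuous_on {-b..-a} (\<lambda>t. f (- t))"
    by (intro continuous_on_compose2[OF cont]) (auto intro!: continuous_intros)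
  then obtain s where "-b \<le> s" "s \<le> -a" "f (-s) = c" "\<And>t. s < t \<Longrightarrow> t \<le> -a \<Longrightarrow> c < f (-t)"
    using last_crossing[of "-b" "-a" "\<lambda>t. f (- t)" c] assms by auto
  then show thesis
    using that[of "-s"] by (metis minus_le_iff le_minus_iff minus_less_iff minus_minus neg_le_iff_le)
qed

lemma increment_bound:
  fixes f :: "real \<Rightarrow> real"
  assumes "a \<le> b" "continuous_on {a..b} f"
    and "\<And>t. a < t \<Longrightarrow> t < b \<Longrightarrow> \<exists>D. (f has_real_derivative D) (at t) \<and> \<bar>D\<bar> \<le> M"
  shows "\<bar>f b - f a\<bar> \<le> M * (b - a)"
proof (cases "a = b")
  case False
  with assms have "a < b" by simp
  have "\<And>t. a < t \<Longrightarrow> t < b \<Longrightarrow> f differentiable (at t)"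
    using assms(3) real_differentiable_def by blast
  then obtain l z where "a < z" "z < b" "(f has_real_derivative l) (at z)" "f b - f a = (b - a) * l"
    using MVT[OF \<open>a < b\<close> assms(2)] by blast
  moreover have "\<bar>l\<bar> \<le> M" using assms(3)[of z] calculation DERIV_unique by blast
  ultimately show ?thesis using \<open>a < b\<close> by (simp add: abs_mult mult.commute mult_right_mono)
qed simp

lemma linear_filter_bound_upper:
  fixes Y :: "real \<Rightarrow> real"
  assumes "a \<le> b" "continuous_on {a..b} Y" "0 < k"
    and "\<And>t. a < t \<Longrightarrow> t < b \<Longrightarrow> (Y has_real_derivative k * (w t - Y t)) (at t)"
    and "\<And>t. a < t \<Longrightarrow> t < b \<Longrightarrow> w t \<le> W"
  shows "Y b \<le> W + exp (- k * (b - a)) * (Y a - W)"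
proof -
  define g where "g t = exp (k * (t - a)) * (W - Y t)" for t
  have "g a \<le> g b"
  proof (rule DERIV_nonneg_imp_increasing_open[OF \<open>a \<le> b\<close>])
    fix t assume t: "a < t" "t < b"
    have D: "(g has_real_derivative exp (k * (t - a)) * k * (W - Y t) + exp (k * (t - a)) * (0 - k * (w t - Y t))) (at t)"
      unfolding g_def by (rule derivative_eq_intros assms(4)[OF t] refl | simp)+
    have "0 \<le> exp (k * (t - a)) * k * (W - w t)" using assms(3) assms(5)[OF t] by simp
    also have "\<dots> = exp (k * (t - a)) * k * (W - Y t) + exp (k * (t - a)) * (0 - k * (w t - Y t))"
      by (simp add: algebra_simps)
    finally show "\<exists>y. (g has_real_derivative y) (at t) \<and> 0 \<le> y" using D by blast
  next
    show "continuous_on {a..b} g" unfolding g_def by (intro continuous_intros assms)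
  qed
  then have "exp (- k * (b - a)) * (W - Y a) \<le> exp (- k * (b - a)) * (exp (k * (b - a)) * (W - Y b))"
    unfolding g_def by simp
  also have "\<dots> = W - Y b" by (simp add: mult.assoc[symmetric] exp_add[symmetric])
  finally show ?thesis by (simp add: algebra_simps)
qed

text \<open>The bound \<open>W\<close> is subtracted from the initial error on the right: a plain
  \<open>W + exp (- k (b - a)) \<bar>Y a\<bar>\<close> would exceed \<open>\<bar>Y a\<bar>\<close> already for small \<open>b - a\<close>, whereas this form
  decreases whenever \<open>\<bar>Y a\<bar> > W\<close>, which \<open>lag_step\<close> needs over a single short period.\<close>

lemma linear_filter_bound:
  fixes Y :: "real \<Rightarrow> real"
  assumes "a \<le> b" and cont: "continuous_on {a..b} Y" and "0 < k"
    and Y: "\<And>t. a < t \<Longrightarrow> t < b \<Longrightarrow> (Y has_real_derivative k * (w t - Y t)) (at t)"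
    and w: "\<And>t. a < t \<Longrightarrow> t < b \<Longrightarrow> \<bar>w t\<bar> \<le> W"
  shows "\<bar>Y b\<bar> \<le> W + exp (- k * (b - a)) * (\<bar>Y a\<bar> - W)"
proof -
  have "Y b \<le> W + exp (- k * (b - a)) * (Y a - W)"
    using w by (intro linear_filter_bound_upper[OF assms(1,2,3) Y]) (auto simp: abs_le_iff)
  moreover have "- Y b \<le> W + exp (- k * (b - a)) * (- Y a - W)"
  proof (rule linear_filter_bound_upper[OF assms(1) _ assms(3), of "\<lambda>t. - Y t" "\<lambda>t. - w t"])
    show "continuous_on {a..b} (\<lambda>t. - Y t)" by (intro continuous_intros cont)
    fix t assume t: "a < t" "t < b"
    show "((\<lambda>t. - Y t) has_real_derivative k * (- w t - - Y t)) (at t)"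
      using DERIV_minus[OF Y[OF t]] by (simp add: algebra_simps)
    show "- w t \<le> W" using w[OF t] by simp
  qed
  moreover have "exp (- k * (b - a)) * (Y a - W) \<le> exp (- k * (b - a)) * (\<bar>Y a\<bar> - W)"
     "exp (- k * (b - a)) * (- Y a - W) \<le> exp (- k * (b - a)) * (\<bar>Y a\<bar> - W)" by auto
  ultimately show ?thesis by linarith
qed

text \<open>A vanishing mean makes the primitive periodic, so its size is controlled by one period. Adding a
  multiple of it to the filter state removes the ripple of a periodic input.\<close>

lemma periodic_primitive:
  fixes f :: "real \<Rightarrow> real"
  assumes cont: "continuous_on UNIV f" and per: "\<And>t. f (t + 1) = f t"
    and mean: "integral {0..1} f = 0" and K: "\<And>t. \<bar>f t\<bar> \<le> K"
  obtains F where "\<And>t. 0 < t \<Longrightarrow> (F has_real_derivative f t) (at t)" "\<And>t. 0 \<le> t \<Longrightarrow> \<bar>F t\<bar> \<le> K"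
    "continuous_on {0..} F"
proof -
  define F where "F t = integral {0..t} f" for t
  have F_deriv: "(F has_real_derivative f t) (at t)" if "0 < t" for t
  proof -
    have "(F has_real_derivative f t) (at t within {0..t + 1})"
      unfolding F_def[abs_def] using that
      by (intro integral_has_real_derivative continuous_on_subset[OF cont]) auto
    then show ?thesis using that by (simp add: at_within_Icc_at)
  qed
  have F_cont: "continuous_on {0..T} F" for T
    unfolding F_def[abs_def]
    by (intro indefinite_integral_continuous_1 integrable_continuous_interval continuous_on_subset[OF cont]) auto
  have F_cont': "continuous_on {0..} F"
  proof (rule continuous_on_eq_continuous_within[THEN iffD2], rule)
    fix t :: real assume t: "t \<in> {0..}"
    then have "continuous (at t within {0..t + 1}) F"
      using F_cont[of "t + 1"] by (simp add: continuous_on_eq_continuous_within)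
    moreover have "at t within {0..t + 1} = at t within {0..}"
      using t by (intro at_within_nhd[of _ "{t - 1<..<t + 1}"]) auto
    ultimately show "continuous (at t within {0..}) F" by simp
  qed
  have F01: "F 0 = 0" "F 1 = 0" unfolding F_def using mean by auto
  have F_per: "F (t + 1) = F t" if "0 \<le> t" for t
  proof -
    have "\<bar>(F (t + 1) - F t) - (F (0 + 1) - F 0)\<bar> \<le> 0 * (t - 0)"
    proof (rule increment_bound[OF that, where f = "\<lambda>t. F (t + 1) - F t"])
      show "continuous_on {0..t} (\<lambda>t. F (t + 1) - F t)"
        by (intro continuous_intros continuous_on_compose2[OF F_cont'] F_cont) auto
      fix s assume s: "0 < s" "s < t"
      have "((\<lambda>t. F (t + 1)) has_real_derivative f (s + 1)) (at s)"
        using F_deriv[of "s + 1"] s DERIV_shift by force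
      then have "((\<lambda>t. F (t + 1) - F t) has_real_derivative f (s + 1) - f s) (at s)"
        using F_deriv[of s] s by (intro DERIV_diff) auto
      then show "\<exists>D. ((\<lambda>t. F (t + 1) - F t) has_real_derivative D) (at s) \<and> \<bar>D\<bar> \<le> 0"
        using per[of s] by auto
    qed
    then show ?thesis using F01 by simp
  qed
  have "\<bar>F t\<bar> \<le> K" if "real n \<le> t" "t \<le> real n + 1" for n t
    using that
  proof (induction n arbitrary: t)
    case 0
    have "\<bar>F t - F 0\<bar> \<le> K * (t - 0)"
      using 0 K F_deriv F_cont by (intro increment_bound) auto
    also have "\<dots> \<le> K * 1" using 0 K[of 0] by (intro mult_left_mono) auto
    finally show ?case using F01 by simp
  next
    case (Suc n)
    then show ?case using Suc.IH[of "t - 1"] F_per[of "t - 1"] by simp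
  qed
  from this[of "nat \<lfloor>t\<rfloor>" t for t] have "\<bar>F t\<bar> \<le> K" if "0 \<le> t" for t
    using that by (simp add: of_nat_nat)
  with F_deriv F_cont' show thesis by (intro that[of F]) auto
qed

lemma integral_pos:
  fixes f :: "real \<Rightarrow> real"
  assumes cont: "continuous_on {a..b} f" and "a < b" and nn: "\<And>t. a \<le> t \<Longrightarrow> t \<le> b \<Longrightarrow> 0 \<le> f t"
    and c: "a \<le> c" "c \<le> b" "f c \<noteq> 0"
  shows "0 < integral {a..b} f"
proof -
  have "integral {a..b} f \<noteq> 0"
  proof
    assume "integral {a..b} f = 0"
    then have "\<forall>t\<in>{a..b}. f t = 0" using integral_eq_0_iff[OF cont \<open>a < b\<close>] nn by simp
    then show False using c by simp
  qed
  moreover have "0 \<le> integral {a..b} f"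
    using nn by (intro integral_nonneg integrable_continuous_interval cont) auto
  ultimately show ?thesis by simp
qed

lemma probe_le: "\<bar>\<delta> * sin \<theta>\<bar> \<le> \<delta>" if "0 < \<delta>" for \<delta> \<theta> :: real
proof -
  have "\<bar>\<delta> * sin \<theta>\<bar> \<le> \<delta> * 1" unfolding abs_mult using that by (intro mult_mono) auto
  then show ?thesis by simp
qed

section \<open>Unimodal costs\<close>

text \<open>The monotonicity is weak on purpose: the linear extension of a cost beyond an endpoint has the slope
  of the endpoint, which may be zero. Strict increase enters separately, as a rate, where it is needed.\<close>

locale unimodal_cost =
  fixes h dh :: "real \<Rightarrow> real" and xs L :: real
  assumes deriv: "\<And>v. (h has_real_derivative dh v) (at v)"
    and dh_cont: "continuous_on UNIV dh"
    and dh_bound: "\<And>v. \<bar>dh v\<bar> \<le> L"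
    and dh_left: "\<And>v. v \<le> xs \<Longrightarrow> dh v \<le> 0"
    and dh_right: "\<And>v. xs \<le> v \<Longrightarrow> 0 \<le> dh v"

context unimodal_cost
begin

lemma h_cont: "continuous_on S h"
  using deriv by (meson DERIV_isCont continuous_at_imp_continuous_on)

lemma L_nonneg: "0 \<le> L"
  using dh_bound[of 0] by linarith

lemma lip: "\<bar>h a - h b\<bar> \<le> L * \<bar>a - b\<bar>"
proof -
  have "\<bar>h v - h w\<bar> \<le> L * (v - w)" if "w \<le> v" for v w
    using that deriv dh_bound by (intro increment_bound h_cont) blast+
  from this[of a b] this[of b a] show ?thesis by (cases "a \<le> b") (auto simp: abs_minus_commute)
qed

lemma h_mono: "xs \<le> a \<Longrightarrow> a \<le> b \<Longrightarrow> h a \<le> h b"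
  by (rule DERIV_nonneg_imp_nondecreasing) (auto intro!: exI deriv dh_right)

lemma h_antimono: "a \<le> b \<Longrightarrow> b \<le> xs \<Longrightarrow> h b \<le> h a"
  by (rule DERIV_nonpos_imp_nonincreasing) (auto intro!: exI deriv dh_left)

lemma h_cont_dither: "continuous_on S (\<lambda>t. h (v + \<delta> * sin (2 * pi * t)))"
  by (intro continuous_on_compose2[OF h_cont[of UNIV]] continuous_intros) auto

lemma dither_near:
  assumes "0 < \<delta>"
  shows "\<bar>h (v + \<delta> * sin \<theta>) - h v\<bar> \<le> L * \<delta>"
proof -
  have "L * \<bar>\<delta> * sin \<theta>\<bar> \<le> L * \<delta>" using probe_le[OF assms] L_nonneg by (rule mult_left_mono)
  then show ?thesis using lip[of "v + \<delta> * sin \<theta>" v] by simp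
qed

text \<open>The mean of \<open>h\<close> along the probe is within \<open>L \<delta>\<close> of the centre value, so the initial
  condition on \<open>y\<close> relative to \<open>a0 h \<delta> x0 / 2\<close> is one relative to \<open>h x0\<close>.\<close>

lemma mean_near:
  assumes \<delta>: "0 < \<delta>"
  shows "\<bar>a0 h \<delta> v / 2 - h v\<bar> \<le> L * \<delta>"
proof -
  let ?f = "\<lambda>t. h (v + \<delta> * sin (2 * pi * t))"
  have "integral {0..1} (\<lambda>t. ?f t - h v) = integral {0..1} ?f - integral {0..1} (\<lambda>_::real. h v)"
    by (intro integral_diff integrable_continuous_interval continuous_intros h_cont_dither)
  then have "integral {0..1} (\<lambda>t. ?f t - h v) = a0 h \<delta> v / 2 - h v" unfolding a0_def by simp
  moreover have "norm (integral {0..1} (\<lambda>t. ?f t - h v)) \<le> L * \<delta> * (1 - 0)"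
    using dither_near[OF \<delta>] by (intro integral_bound continuous_intros h_cont_dither) auto
  ultimately show ?thesis by simp
qed

end

text \<open>At \<open>b\<close> the difference quotients from both sides tend to \<open>dh b\<close>; elsewhere the extension coincides
  locally with one of the two branches.\<close>

lemma linear_extension_right:
  fixes h dh :: "real \<Rightarrow> real"
  assumes deriv: "\<And>v. (h has_real_derivative dh v) (at v)"
  shows "((\<lambda>v. if v \<le> b then h v else h b + dh b * (v - b)) has_real_derivative dh (min b v)) (at v)"
    (is "(?E has_real_derivative _) _")
proof -
  consider "v < b" | "v = b" | "b < v" by linarith
  then show ?thesis
  proof cases
    case 1
    have "(?E has_real_derivative dh v) (at v)"
      by (rule has_field_derivative_transform_within_open[OF deriv, of "{..<b}"]) (use 1 in auto)
    then show ?thesis using 1 by simp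
  next
    case 2
    have "((\<lambda>y. (?E y - ?E b) / (y - b)) \<longlongrightarrow> dh b) (at b)"
    proof (rule filterlim_split_at)
      have "((\<lambda>y. (h y - h b) / (y - b)) \<longlongrightarrow> dh b) (at b)"
        using deriv[of b] by (simp add: has_field_derivative_iff)
      then have "((\<lambda>y. (h y - h b) / (y - b)) \<longlongrightarrow> dh b) (at_left b)"
        using filterlim_at_split by blast
      then show "((\<lambda>y. (?E y - ?E b) / (y - b)) \<longlongrightarrow> dh b) (at_left b)"
        by (rule Lim_transform_eventually) (auto simp: eventually_at_filter)
      have "((\<lambda>y. dh b) \<longlongrightarrow> dh b) (at_right b)" by simp
      then show "((\<lambda>y. (?E y - ?E b) / (y - b)) \<longlongrightarrow> dh b) (at_right b)"
        by (rule Lim_transform_eventually) (auto simp: eventually_at_filter)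
    qed
    then show ?thesis using 2 by (simp add: has_field_derivative_iff)
  next
    case 3
    have "((\<lambda>v. h b + dh b * (v - b)) has_real_derivative dh b) (at v)"
      by (auto intro!: derivative_eq_intros)
    then have "(?E has_real_derivative dh b) (at v)"
      by (rule has_field_derivative_transform_within_open[of _ _ _ "{b<..}"]) (use 3 in auto)
    then show ?thesis using 3 by simp
  qed
qed

lemma linear_extension:
  fixes h dh :: "real \<Rightarrow> real"
  assumes deriv: "\<And>v. (h has_real_derivative dh v) (at v)" and ab: "a \<le> b"
  obtains g where "\<And>v. (g has_real_derivative dh (max a (min b v))) (at v)"
    "\<And>v. a \<le> v \<Longrightarrow> v \<le> b \<Longrightarrow> g v = h v"
proof -
  have neg: "(uminus has_real_derivative - 1) (at v)" for v :: real by (auto intro!: derivative_eq_intros)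
  define h1 where "h1 = (\<lambda>v. if v \<le> b then h v else h b + dh b * (v - b))"
  define d1 where "d1 v = - dh (min b (- v))" for v
  have "((\<lambda>v. h1 (- v)) has_real_derivative d1 v) (at v)" for v
    using DERIV_chain2[OF linear_extension_right[where h = h and dh = dh and b = b, OF deriv] neg] unfolding h1_def d1_def by simp
  from linear_extension_right[where h = "\<lambda>v. h1 (- v)" and dh = d1 and b = "- a", OF this]
  have E: "((\<lambda>v. if v \<le> - a then h1 (- v) else h1 (- (- a)) + d1 (- a) * (v - - a)) has_real_derivative d1 (min (- a) v)) (at v)" for v .
  show thesis
  proof (rule that[of "\<lambda>v. if - v \<le> - a then h1 (- (- v)) else h1 (- (- a)) + d1 (- a) * (- v - - a)"])
    fix v
    have "- d1 (min (- a) (- v)) = dh (max a (min b v))"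
      unfolding d1_def using ab by (simp add: min_def max_def)
    then show "((\<lambda>v. if - v \<le> - a then h1 (- (- v)) else h1 (- (- a)) + d1 (- a) * (- v - - a))
        has_real_derivative dh (max a (min b v))) (at v)"
      using DERIV_chain2[OF E neg, of v] by simp
    show "(if - v \<le> - a then h1 (- (- v)) else h1 (- (- a)) + d1 (- a) * (- v - - a)) = h v" if "a \<le> v" "v \<le> b"
      using that unfolding h1_def by simp
  qed
qed

text \<open>Continuing the cost linearly outside the window that the probe can reach makes \<open>L\<close> a global Lipschitz constant, so bounds on trajectories need not presuppose that
  these stay in the window.\<close>

lemma unimodal_extension:
  fixes h dh :: "real \<Rightarrow> real"
  assumes deriv: "\<And>v. (h has_real_derivative dh v) (at v)" and dh_cont: "continuous_on UNIV dh"
    and left: "\<And>v. v \<le> xs \<Longrightarrow> dh v \<le> 0" and right: "\<And>v. xs \<le> v \<Longrightarrow> 0 \<le> dh v"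
    and r: "0 < r" and bound: "\<And>v. \<bar>v - xs\<bar> \<le> r \<Longrightarrow> \<bar>dh v\<bar> \<le> L"
  obtains g dg where "unimodal_cost g dg xs L" "\<And>v. xs - r \<le> v \<Longrightarrow> v \<le> xs + r \<Longrightarrow> g v = h v"
proof -
  define clamp where "clamp v = max (xs - r) (min (xs + r) v)" for v
  obtain g where g: "\<And>v. (g has_real_derivative dh (max (xs - r) (min (xs + r) v))) (at v)"
    and gh: "\<And>v. xs - r \<le> v \<Longrightarrow> v \<le> xs + r \<Longrightarrow> g v = h v"
  proof (rule linear_extension[where h = h and dh = dh and a = "xs - r" and b = "xs + r", OF deriv])
    show "xs - r \<le> xs + r" using r by simp
  qed blast
  have "unimodal_cost g (\<lambda>v. dh (clamp v)) xs L"
  proof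
    show "continuous_on UNIV (\<lambda>v. dh (clamp v))"
      unfolding clamp_def by (intro continuous_on_compose2[OF dh_cont] continuous_intros) auto
    show "\<bar>dh (clamp v)\<bar> \<le> L" for v using r by (intro bound) (auto simp: clamp_def abs_le_iff)
    show "dh (clamp v) \<le> 0" if "v \<le> xs" for v using that r by (intro left) (auto simp: clamp_def)
    show "0 \<le> dh (clamp v)" if "xs \<le> v" for v using that r by (intro right) (auto simp: clamp_def)
    show "(g has_real_derivative dh (clamp v)) (at v)" for v unfolding clamp_def by (rule g)
  qed
  then show thesis using gh by (rule that)
qed

section \<open>The balance point of the averaged drift\<close>

text \<open>The primitive \<open>\<Phi>\<close> encodes the averaged drift at \<open>e\<close> as an integral over levels: integration by
  parts and the substitution \<open>v = e + \<delta> sin \<theta>\<close> give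
  \<open>b1 h \<delta> e = (2 / pi) (\<Phi> (e + \<delta>) - \<Phi> (e - \<delta>))\<close>, so the last condition says that \<open>e\<close> is a zero of it.\<close>

locale balanced_cost = unimodal_cost +
  fixes \<delta> e :: real and \<Phi> :: "real \<Rightarrow> real"
  assumes \<delta>_pos: "0 < \<delta>"
    and xs_greater: "e - \<delta> < xs" and xs_less: "xs < e + \<delta>"
    and \<Phi>_cont: "continuous_on {e - \<delta>..e + \<delta>} \<Phi>"
    and \<Phi>_deriv: "\<And>v. e - \<delta> < v \<Longrightarrow> v < e + \<delta> \<Longrightarrow>
          (\<Phi> has_real_derivative dh v * sqrt (1 - ((v - e) / \<delta>)\<^sup>2)) (at v)"
    and \<Phi>_balance: "\<Phi> (e - \<delta>) = \<Phi> (e + \<delta>)"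

context balanced_cost
begin

lemma weight_pos: 
  assumes "e - \<delta> < v" "v < e + \<delta>" shows "0 < 1 - ((v - e) / \<delta>)\<^sup>2"
proof -
  have "\<bar>(v - e) / \<delta>\<bar> < 1" using assms \<delta>_pos by (auto simp: abs_less_iff field_simps)
  then have "((v - e) / \<delta>)\<^sup>2 < 1" by (simp add: abs_square_less_1)
  then show ?thesis by simp
qed

text \<open>Left of \<open>xs\<close> the cost decreases, hence so does \<open>\<Phi>\<close>, starting from its common end value.\<close>

lemma \<Phi>_le: assumes "e - \<delta> < v" "v \<le> xs" shows "\<Phi> v \<le> \<Phi> (e + \<delta>)"
proof -
  have "- \<Phi> (e - \<delta>) \<le> - \<Phi> v"
  proof (rule DERIV_nonneg_imp_increasing_open[where f = "\<lambda>v. - \<Phi> v"])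
    fix t assume t: "e - \<delta> < t" "t < v"
    then have "((\<lambda>v. - \<Phi> v) has_real_derivative - (dh t * sqrt (1 - ((t - e) / \<delta>)\<^sup>2))) (at t)"
      using xs_less assms by (intro DERIV_minus \<Phi>_deriv) auto
    moreover have "0 \<le> - (dh t * sqrt (1 - ((t - e) / \<delta>)\<^sup>2))"
      using dh_left[of t] weight_pos[of t] t assms xs_less by (simp add: mult_nonpos_nonneg)
    ultimately show "\<exists>y. ((\<lambda>v. - \<Phi> v) has_real_derivative y) (at t) \<and> 0 \<le> y" by blast
  next
    show "continuous_on {e - \<delta>..v} (\<lambda>v. - \<Phi> v)"
      using xs_less assms by (intro continuous_intros continuous_on_subset[OF \<Phi>_cont]) auto
  qed (use assms in auto)
  then show ?thesis using \<Phi>_balance by simp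
qed

end

context unimodal_cost
begin

text \<open>An antiderivative of \<open>h (e + \<delta> sin) sin\<close> is \<open>\<Theta> s\<close>: up to the factor \<open>1 / (2 pi)\<close>, the boundary term of
  the integration by parts plus \<open>s \<Phi>\<close> along the probe, where \<open>s\<close> is the sign of the cosine. It is glued from three pieces because
  that sign changes at \<open>1/4\<close> and \<open>3/4\<close>.\<close>

lemma balanced_cost_exists:
  assumes \<delta>: "0 < \<delta>" and b1: "b1 h \<delta> e = 0"
    and xs: "e - \<delta> < xs" "xs < e + \<delta>"
  obtains \<Phi> where "balanced_cost h dh xs L \<delta> e \<Phi>"
proof -
  define w where "w v = dh v * sqrt (1 - ((v - e) / \<delta>)\<^sup>2)" for v
  define \<Phi> where "\<Phi> v = integral {e - \<delta>..v} w" for v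
  have w_cont: "continuous_on S w" for S
    unfolding w_def using \<delta> by (intro continuous_intros continuous_on_subset[OF dh_cont]) auto
  have \<Phi>_cont: "continuous_on {e - \<delta>..e + \<delta>} \<Phi>"
    unfolding \<Phi>_def[abs_def] by (intro indefinite_integral_continuous_1 integrable_continuous_interval w_cont)
  have \<Phi>_deriv: "(\<Phi> has_real_derivative w v) (at v)" if "e - \<delta> < v" "v < e + \<delta>" for v
  proof -
    have "(\<Phi> has_real_derivative w v) (at v within {e - \<delta>..e + \<delta>})"
      unfolding \<Phi>_def[abs_def] using that by (intro integral_has_real_derivative w_cont) auto
    then show ?thesis using that by (simp add: at_within_Icc_at)
  qed
  define f where "f t = h (e + \<delta> * sin (2 * pi * t)) * sin (2 * pi * t)" for t
  define \<Theta> where "\<Theta> s t = - h (e + \<delta> * sin (2 * pi * t)) * cos (2 * pi * t) / (2 * pi)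
      + s * \<Phi> (e + \<delta> * sin (2 * pi * t)) / (2 * pi)" for s t
  have in_window: "e + \<delta> * sin \<theta> \<in> {e - \<delta>..e + \<delta>}" for \<theta>
    using \<delta> mult_left_mono[OF sin_le_one[of \<theta>], of \<delta>] mult_left_mono[OF sin_ge_minus_one[of \<theta>], of \<delta>] by auto
  have \<Theta>_cont: "continuous_on S (\<Theta> s)" for S s
  proof -
    have "continuous_on S (\<lambda>t. \<Phi> (e + \<delta> * sin (2 * pi * t)))"
      using in_window by (intro continuous_on_compose2[OF \<Phi>_cont] continuous_intros) auto
    then show ?thesis
      unfolding \<Theta>_def by (intro continuous_intros h_cont_dither) auto
  qed
  have \<Theta>_deriv: "(\<Theta> s has_real_derivative f t) (at t)"
    if c: "\<bar>cos (2 * pi * t)\<bar> = s * cos (2 * pi * t)" "cos (2 * pi * t) \<noteq> 0" for s t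
  proof -
    let ?s = "sin (2 * pi * t)" and ?c = "cos (2 * pi * t)"
    let ?p = "e + \<delta> * ?s"
    have "?s\<^sup>2 < 1" using c(2) sin_cos_squared_add[of "2 * pi * t"] zero_less_power2[of ?c] by linarith
    then have s1: "\<bar>?s\<bar> < 1" by (simp add: abs_square_less_1)
    then have "- \<delta> < \<delta> * ?s" "\<delta> * ?s < \<delta>"
      using \<delta> mult_strict_left_mono[of ?s 1 \<delta>] mult_strict_left_mono[of "-1" ?s \<delta>] by auto
    then have P: "(\<Phi> has_real_derivative w ?p) (at ?p)" by (intro \<Phi>_deriv) auto
    have w: "w ?p = dh ?p * (s * ?c)"
    proof -
      have "1 - ((?p - e) / \<delta>)\<^sup>2 = ?c\<^sup>2" using \<delta> by (simp add: cos_squared_eq)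
      then show ?thesis unfolding w_def using c(1) by simp
    qed
    have s2: "s * s = 1"
    proof -
      have "\<bar>s\<bar> * \<bar>?c\<bar> = 1 * \<bar>?c\<bar>" using c by (metis abs_abs abs_mult mult_1)
      then have "\<bar>s\<bar> = 1" using c(2) by simp
      then show ?thesis by (metis abs_mult_self_eq mult_1)
    qed
    have p': "((\<lambda>t. e + \<delta> * sin (2 * pi * t)) has_real_derivative \<delta> * (?c * (2 * pi))) (at t)"
      by (rule derivative_eq_intros refl | simp)+
    have c': "((\<lambda>t. cos (2 * pi * t)) has_real_derivative - ?s * (2 * pi)) (at t)"
      by (rule derivative_eq_intros refl | simp)+
    have "(\<Theta> s has_real_derivative (- (dh ?p * (\<delta> * (?c * (2 * pi)))) * ?c + (- ?s * (2 * pi)) * - h ?p) / (2 * pi)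
        + s * (w ?p * (\<delta> * (?c * (2 * pi)))) / (2 * pi)) (at t)"
      unfolding \<Theta>_def[abs_def]
      by (intro DERIV_add DERIV_cdivide DERIV_mult DERIV_minus DERIV_cmult DERIV_chain2[OF deriv p'] DERIV_chain2[OF P p'] c')
    moreover have "(- (dh ?p * (\<delta> * (?c * (2 * pi)))) * ?c + (- ?s * (2 * pi)) * - h ?p)
        + s * (w ?p * (\<delta> * (?c * (2 * pi)))) = f t * (2 * pi)"
      unfolding w f_def using s2 by algebra
    then have "(- (dh ?p * (\<delta> * (?c * (2 * pi)))) * ?c + (- ?s * (2 * pi)) * - h ?p) / (2 * pi)
        + s * (w ?p * (\<delta> * (?c * (2 * pi)))) / (2 * pi) = f t"
      unfolding add_divide_distrib[symmetric] by simp
    ultimately show ?thesis by simp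
  qed
  have piece: "(f has_integral \<Theta> s b - \<Theta> s a) {a..b}"
    if "a \<le> b" "\<And>t. a < t \<Longrightarrow> t < b \<Longrightarrow> \<bar>cos (2 * pi * t)\<bar> = s * cos (2 * pi * t) \<and> cos (2 * pi * t) \<noteq> 0" for a b s
    using that \<Theta>_deriv
    by (intro fundamental_theorem_of_calculus_interior_strong[where S = "{}"] \<Theta>_cont)
       (auto simp: has_real_derivative_iff_has_vector_derivative[symmetric])
  have cos_pos: "0 < cos (2 * pi * t)" if "\<bar>t\<bar> < 1/4" for t
  proof -
    have "(2 * pi) * \<bar>t\<bar> < (2 * pi) * (1/4)" using that pi_gt_zero by (intro mult_strict_left_mono) auto
    then have "\<bar>2 * pi * t\<bar> < pi / 2" by (simp add: abs_mult)
    then have "- (pi / 2) < 2 * pi * t" "2 * pi * t < pi / 2" by linarith+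
    then show ?thesis by (rule cos_gt_zero_pi)
  qed
  have cos_shift: "cos (2 * pi * t) = cos (2 * pi * (t - 1))" "cos (2 * pi * t) = - cos (2 * pi * (t - 1/2))" for t
    by (simp_all add: right_diff_distrib cos_diff)
  have I1: "(f has_integral \<Theta> 1 (1/4) - \<Theta> 1 0) {0..1/4}"
  proof (rule piece)
    fix t :: real assume "0 < t" "t < 1/4"
    then have "0 < cos (2 * pi * t)" by (intro cos_pos) auto
    then show "\<bar>cos (2 * pi * t)\<bar> = 1 * cos (2 * pi * t) \<and> cos (2 * pi * t) \<noteq> 0" by simp
  qed simp
  have I2: "(f has_integral \<Theta> (- 1) (3/4) - \<Theta> (- 1) (1/4)) {1/4..3/4}"
  proof (rule piece)
    fix t :: real assume "1/4 < t" "t < 3/4"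
    then have "0 < cos (2 * pi * (t - 1/2))" by (intro cos_pos) linarith
    then show "\<bar>cos (2 * pi * t)\<bar> = - 1 * cos (2 * pi * t) \<and> cos (2 * pi * t) \<noteq> 0"
      using cos_shift(2)[of t] by simp
  qed simp
  have I3: "(f has_integral \<Theta> 1 1 - \<Theta> 1 (3/4)) {3/4..1}"
  proof (rule piece)
    fix t :: real assume "3/4 < t" "t < 1"
    then have "0 < cos (2 * pi * (t - 1))" by (intro cos_pos) linarith
    then show "\<bar>cos (2 * pi * t)\<bar> = 1 * cos (2 * pi * t) \<and> cos (2 * pi * t) \<noteq> 0"
      using cos_shift(1)[of t] by simp
  qed simp
  have I: "(f has_integral (\<Theta> 1 (1/4) - \<Theta> 1 0) + (\<Theta> (- 1) (3/4) - \<Theta> (- 1) (1/4)) + (\<Theta> 1 1 - \<Theta> 1 (3/4))) {0..1}"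
    using has_integral_combine[OF _ _ has_integral_combine[OF _ _ I1 I2] I3] by simp
  have q: "2 * pi * (1/4) = pi/2" "2 * pi * (3/4) = 3/2 * pi" "2 * pi * 0 = 0" "2 * pi * 1 = 2 * pi" by auto
  have "integral {0..1} f = (\<Phi> (e + \<delta>) - \<Phi> (e - \<delta>)) / pi"
    unfolding integral_unique[OF I] \<Theta>_def q sin_3over2_pi cos_3over2_pi by (simp add: field_simps)
  moreover have "integral {0..1} f = 0" using b1 unfolding b1_def f_def by simp
  ultimately have "\<Phi> (e - \<delta>) = \<Phi> (e + \<delta>)" by simp
  then show thesis
    using \<delta> xs \<Phi>_cont \<Phi>_deriv unfolding w_def
    by (intro that[of \<Phi>]) (unfold_locales; simp)
qed

text \<open>At \<open>xs - \<delta>\<close> and \<open>xs + \<delta>\<close> the whole probe lies on one side of the minimiser, so the integrand with the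
  centre value subtracted has a constant sign. Strictness at the two ends puts \<open>xs\<close> strictly inside the
  window around \<open>e\<close>, where the weight of \<open>balanced_cost\<close> is positive.\<close>

lemma balance_point_exists:
  assumes \<delta>: "0 < \<delta>" and strict: "h xs < h (xs - \<delta>)" "h xs < h (xs + \<delta>)"
  obtains e where "b1 h \<delta> e = 0" "e - \<delta> < xs" "xs < e + \<delta>"
proof -
  have int_sin: "integral {0..1} (\<lambda>t. sin (2 * pi * t)) = 0"
  proof -
    have "((\<lambda>t. sin (2 * pi * t)) has_integral (- cos (2 * pi * 1) / (2 * pi) - - cos (2 * pi * 0) / (2 * pi))) {0..1}"
      by (intro fundamental_theorem_of_calculus)
         (auto intro!: derivative_eq_intros simp: has_real_derivative_iff_has_vector_derivative[symmetric])
    then show ?thesis by (simp add: integral_unique)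
  qed
  have cont: "continuous_on {0..1} (\<lambda>t. (h (v + \<delta> * sin (2 * pi * t)) - c) * sin (2 * pi * t))" for v c
    by (intro continuous_intros h_cont_dither)
  have b1_eq: "b1 h \<delta> v = 2 * integral {0..1} (\<lambda>t. (h (v + \<delta> * sin (2 * pi * t)) - c) * sin (2 * pi * t))" for v c
  proof -
    have "integral {0..1} (\<lambda>t. (h (v + \<delta> * sin (2 * pi * t)) - c) * sin (2 * pi * t))
      = integral {0..1} (\<lambda>t. h (v + \<delta> * sin (2 * pi * t)) * sin (2 * pi * t) - c * sin (2 * pi * t))"
      by (simp add: algebra_simps)
    also have "\<dots> = integral {0..1} (\<lambda>t. h (v + \<delta> * sin (2 * pi * t)) * sin (2 * pi * t)) - integral {0..1} (\<lambda>t. c * sin (2 * pi * t))"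
      by (intro integral_diff integrable_continuous_interval continuous_intros h_cont_dither)
    finally show ?thesis using int_sin by (simp add: b1_def)
  qed
  have q: "2 * pi * (1/4) = pi/2" "2 * pi * (3/4) = 3/2 * pi" by auto
  have probe: "\<delta> * sin \<theta> \<le> \<delta>" "- \<delta> \<le> \<delta> * sin \<theta>" for \<theta>
    using \<delta> mult_left_mono[OF sin_le_one[of \<theta>], of \<delta>] mult_left_mono[OF sin_ge_minus_one[of \<theta>], of \<delta>] by auto
  have pos: "0 < b1 h \<delta> (xs + \<delta>)"
  proof -
    let ?f = "\<lambda>t. (h (xs + \<delta> + \<delta> * sin (2 * pi * t)) - h (xs + \<delta>)) * sin (2 * pi * t)"
    have nn: "0 \<le> ?f t" for t
    proof (cases "0 \<le> sin (2 * pi * t)")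
      case True
      then have "h (xs + \<delta>) \<le> h (xs + \<delta> + \<delta> * sin (2 * pi * t))" using \<delta> by (intro h_mono) auto
      then show ?thesis using True by simp
    next
      case False
      then have "\<delta> * sin (2 * pi * t) \<le> 0" using \<delta> by (simp add: mult_nonneg_nonpos)
      then have "h (xs + \<delta> + \<delta> * sin (2 * pi * t)) \<le> h (xs + \<delta>)"
        using probe(2)[of "2 * pi * t"] by (intro h_mono) auto
      then show ?thesis using False by (simp add: mult_nonpos_nonpos)
    qed
    have "?f (3/4) \<noteq> 0" unfolding q sin_3over2_pi using strict by simp
    then have "0 < integral {0..1} ?f" using nn by (intro integral_pos[where c = "3/4"] cont) auto
    then show ?thesis using b1_eq[of "xs + \<delta>" "h (xs + \<delta>)"] by simp
  qed
  have neg: "b1 h \<delta> (xs - \<delta>) < 0"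
  proof -
    let ?f = "\<lambda>t. (h (xs - \<delta> + \<delta> * sin (2 * pi * t)) - h (xs - \<delta>)) * sin (2 * pi * t)"
    have np: "?f t \<le> 0" for t
    proof (cases "0 \<le> sin (2 * pi * t)")
      case True
      then have "0 \<le> \<delta> * sin (2 * pi * t)" using \<delta> by simp
      then have "h (xs - \<delta> + \<delta> * sin (2 * pi * t)) \<le> h (xs - \<delta>)" using probe(1)[of "2 * pi * t"] by (intro h_antimono) auto
      then show ?thesis using True by (simp add: mult_nonpos_nonneg)
    next
      case False
      then have "\<delta> * sin (2 * pi * t) \<le> 0" using \<delta> by (simp add: mult_nonneg_nonpos)
      then have "h (xs - \<delta>) \<le> h (xs - \<delta> + \<delta> * sin (2 * pi * t))" using \<delta> by (intro h_antimono) auto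
      then show ?thesis using False by (simp add: mult_nonneg_nonpos)
    qed
    have "?f (1/4) \<noteq> 0" unfolding q using strict by simp
    have c: "continuous_on {0..1} (\<lambda>t. - ?f t)" by (intro continuous_on_minus cont)
    have "0 < integral {0..1} (\<lambda>t. - ?f t)"
      using np \<open>?f (1/4) \<noteq> 0\<close> by (intro integral_pos[where c = "1/4"] c) auto
    then show ?thesis using b1_eq[of "xs - \<delta>" "h (xs - \<delta>)"] by simp
  qed
  have "\<bar>b1 h \<delta> v - b1 h \<delta> w\<bar> \<le> 2 * L * \<bar>v - w\<bar>" for v w
  proof -
    let ?g = "\<lambda>v t. h (v + \<delta> * sin (2 * pi * t)) * sin (2 * pi * t)"
    have c: "continuous_on {0..1} (?g v)" for v by (intro continuous_intros h_cont_dither)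
    have "norm (?g v t - ?g w t) \<le> L * \<bar>v - w\<bar>" for t
    proof -
      have "?g v t - ?g w t = (h (v + \<delta> * sin (2 * pi * t)) - h (w + \<delta> * sin (2 * pi * t))) * sin (2 * pi * t)"
        by (simp add: algebra_simps)
      moreover have "\<bar>h (v + \<delta> * sin (2 * pi * t)) - h (w + \<delta> * sin (2 * pi * t))\<bar> * \<bar>sin (2 * pi * t)\<bar> \<le> (L * \<bar>v - w\<bar>) * 1"
        using lip[of "v + \<delta> * sin (2 * pi * t)" "w + \<delta> * sin (2 * pi * t)"] L_nonneg by (intro mult_mono) auto
      ultimately show ?thesis by (simp add: abs_mult)
    qed
    then have "norm (integral {0..1} (\<lambda>t. ?g v t - ?g w t)) \<le> L * \<bar>v - w\<bar> * (1 - 0)"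
      by (intro integral_bound continuous_on_diff c) auto
    moreover have "integral {0..1} (\<lambda>t. ?g v t - ?g w t) = integral {0..1} (?g v) - integral {0..1} (?g w)"
      by (intro integral_diff integrable_continuous_interval c)
    ultimately have "\<bar>integral {0..1} (?g v) - integral {0..1} (?g w)\<bar> \<le> L * \<bar>v - w\<bar>" by simp
    moreover have "b1 h \<delta> v - b1 h \<delta> w = 2 * (integral {0..1} (?g v) - integral {0..1} (?g w))"
      unfolding b1_def by simp
    ultimately show ?thesis by (simp only: abs_mult) simp
  qed
  then have "(2 * L)-lipschitz_on {xs - \<delta>..xs + \<delta>} (b1 h \<delta>)"
    using L_nonneg by (intro lipschitz_onI) (auto simp: dist_real_def)
  then have "continuous_on {xs - \<delta>..xs + \<delta>} (b1 h \<delta>)" by (rule lipschitz_on_continuous_on)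
  then obtain e where e: "xs - \<delta> \<le> e" "e \<le> xs + \<delta>" "b1 h \<delta> e = 0"
    using IVT'[of "b1 h \<delta>" "xs - \<delta>" 0 "xs + \<delta>"] pos neg \<delta> by auto
  then have "e \<noteq> xs - \<delta>" "e \<noteq> xs + \<delta>" using pos neg by auto
  with e show thesis by (intro that[of e]) auto
qed

end

text \<open>The extension to a globally Lipschitz cost on the window of radius \<open>2 \<delta>\<close> leaves \<open>b1\<close> unchanged on
  the interval where the zero lies.\<close>

lemma balance_point:
  fixes h dh :: "real \<Rightarrow> real"
  assumes deriv: "\<And>v. (h has_real_derivative dh v) (at v)" and dh_cont: "continuous_on UNIV dh"
    and left: "\<And>v. v \<le> xs \<Longrightarrow> dh v \<le> 0" and right: "\<And>v. xs \<le> v \<Longrightarrow> 0 \<le> dh v"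
    and \<delta>: "0 < \<delta>" and strict: "h xs < h (xs - \<delta>)" "h xs < h (xs + \<delta>)"
  obtains e where "b1 h \<delta> e = 0" "e - \<delta> < xs" "xs < e + \<delta>"
proof -
  have "bounded (dh ` {xs - 2 * \<delta>..xs + 2 * \<delta>})"
    by (intro compact_imp_bounded compact_continuous_image continuous_on_subset[OF dh_cont]) auto
  then obtain L where L: "\<And>v. v \<in> {xs - 2 * \<delta>..xs + 2 * \<delta>} \<Longrightarrow> \<bar>dh v\<bar> \<le> L"
    unfolding bounded_real by blast
  obtain g dg where "unimodal_cost g dg xs L"
    and gh: "\<And>v. xs - 2 * \<delta> \<le> v \<Longrightarrow> v \<le> xs + 2 * \<delta> \<Longrightarrow> g v = h v"
  proof (rule unimodal_extension[OF deriv dh_cont left right, of xs "2 * \<delta>" L])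
    show "\<bar>dh v\<bar> \<le> L" if "\<bar>v - xs\<bar> \<le> 2 * \<delta>" for v using L[of v] that by (auto simp: abs_le_iff)
  qed (use \<delta> in auto)
  then interpret G: unimodal_cost g dg xs L by blast
  have "g xs < g (xs - \<delta>)" "g xs < g (xs + \<delta>)" using strict \<delta> gh by auto
  then obtain e where e: "b1 g \<delta> e = 0" "e - \<delta> < xs" "xs < e + \<delta>"
    using G.balance_point_exists[OF \<delta>] by blast
  have "g (e + \<delta> * sin \<theta>) = h (e + \<delta> * sin \<theta>)" for \<theta>
  proof (rule gh)
    show "xs - 2 * \<delta> \<le> e + \<delta> * sin \<theta>" "e + \<delta> * sin \<theta> \<le> xs + 2 * \<delta>"
      using e probe_le[OF \<delta>, of \<theta>] by linarith+
  qed
  then have "b1 h \<delta> e = 0" using e(1) unfolding b1_def by simp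
  then show thesis using e by (intro that)
qed

section \<open>The periodic compensator\<close>

text \<open>The periodic solution of \<open>Q' = g Q - cos (2 pi s)\<close>. The clock \<open>s\<close> vanishes when the dither
  \<open>- cos (2 pi s)\<close> is at its minimum, so that reversing the sweep is \<open>s \<mapsto> - s\<close>; with
  \<open>s = t - 3/4\<close> this is the dither \<open>sin (2 pi t)\<close>. The slope \<open>Q'\<close> is a slightly damped and shifted dither.\<close>

definition compensator :: "real \<Rightarrow> real \<Rightarrow> real" where
  "compensator g s = (g * cos (2 * pi * s) - 2 * pi * sin (2 * pi * s)) / (4 * pi\<^sup>2 + g\<^sup>2)"

definition compensator_slope :: "real \<Rightarrow> real \<Rightarrow> real" where
  "compensator_slope g s = (- 4 * pi\<^sup>2 * cos (2 * pi * s) - 2 * pi * g * sin (2 * pi * s)) / (4 * pi\<^sup>2 + g\<^sup>2)"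

lemma compensator_denominator: "36 \<le> 4 * pi\<^sup>2 + g\<^sup>2" "0 < 4 * pi\<^sup>2 + g\<^sup>2"
proof -
  have "3\<^sup>2 \<le> pi\<^sup>2" using pi_gt3 by (intro power_mono) auto
  then show "36 \<le> 4 * pi\<^sup>2 + g\<^sup>2" by (simp add: add_increasing2)
  then show "0 < 4 * pi\<^sup>2 + g\<^sup>2" by linarith
qed

lemma compensator_deriv: "(compensator g has_real_derivative compensator_slope g s) (at s)"
proof -
  have "((\<lambda>s. g * cos (2 * pi * s) - 2 * pi * sin (2 * pi * s)) has_real_derivative
      - 4 * pi\<^sup>2 * cos (2 * pi * s) - 2 * pi * g * sin (2 * pi * s)) (at s)"
    by (rule derivative_eq_intros refl | simp add: power2_eq_square)+
  then show ?thesis unfolding compensator_def[abs_def] compensator_slope_def by (rule DERIV_cdivide)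
qed

lemma compensator_slope_eq: "compensator_slope g s = - cos (2 * pi * s) + g * compensator g s"
  unfolding compensator_slope_def compensator_def using compensator_denominator[of g] by (simp add: field_simps power2_eq_square)

text \<open>Time reversal exchanges \<open>g\<close> and \<open>- g\<close>. This is why the estimates of this part admit both signs: a
  descending half sweep is an ascending one run backwards.\<close>

lemma compensator_minus: "compensator g (- s) = - compensator (- g) s"
  unfolding compensator_def by (simp add: minus_divide_left)

lemma compensator_periodic: "compensator g (t + 1) = compensator g t"
  unfolding compensator_def by (simp add: distrib_left)

lemma compensator_near: assumes "\<bar>g\<bar> \<le> 1" shows "\<bar>compensator g s + sin (2 * pi * s) / (2 * pi)\<bar> \<le> \<bar>g\<bar> / 4"
proof -
  let ?c = "cos (2 * pi * s)" and ?s = "sin (2 * pi * s)"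
  have eq: "compensator g s + ?s / (2 * pi) = (g * ?c + g * (g * ?s / (2 * pi))) / (4 * pi\<^sup>2 + g\<^sup>2)"
    unfolding compensator_def using compensator_denominator[of g] pi_gt_zero by (simp add: field_simps power2_eq_square)
  have "\<bar>g * ?c\<bar> \<le> \<bar>g\<bar> * 1" unfolding abs_mult by (intro mult_mono) auto
  moreover have "\<bar>g * (g * ?s / (2 * pi))\<bar> \<le> \<bar>g\<bar> * 1"
  proof -
    have "\<bar>g * ?s\<bar> \<le> 1 * 1" unfolding abs_mult using assms by (intro mult_mono) auto
    then have "\<bar>g * ?s / (2 * pi)\<bar> \<le> 1 / 1"
      unfolding abs_divide using pi_gt3 by (intro frac_le) auto
    then show ?thesis unfolding abs_mult[of g] by (intro mult_mono) auto
  qed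
  ultimately have "\<bar>g * ?c + g * (g * ?s / (2 * pi))\<bar> \<le> 2 * \<bar>g\<bar>" by linarith
  then have "\<bar>compensator g s + ?s / (2 * pi)\<bar> \<le> 2 * \<bar>g\<bar> / 36"
    unfolding eq abs_divide using compensator_denominator[of g] by (intro frac_le) auto
  then show ?thesis by linarith
qed

lemma compensator_le: assumes "\<bar>g\<bar> \<le> 1" shows "\<bar>compensator g s\<bar> \<le> 1/2"
proof -
  have "\<bar>sin (2 * pi * s) / (2 * pi)\<bar> \<le> 1 / (2 * 3)"
    unfolding abs_divide using pi_gt3 by (intro frac_le) auto
  then show ?thesis using compensator_near[OF assms, of s] assms by linarith
qed

lemma compensator_slope_near: assumes "\<bar>g\<bar> \<le> 1" shows "\<bar>compensator_slope g s + cos (2 * pi * s)\<bar> \<le> \<bar>g\<bar>"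
proof -
  have "\<bar>g * compensator g s\<bar> \<le> \<bar>g\<bar> * 1" unfolding abs_mult using compensator_le[OF assms, of s] by (intro mult_mono) auto
  then show ?thesis unfolding compensator_slope_eq by simp
qed

lemma compensator_slope_le: assumes "\<bar>g\<bar> \<le> 1" shows "\<bar>compensator_slope g s\<bar> \<le> 2"
proof -
  have "\<bar>cos (2 * pi * s)\<bar> \<le> 1" by simp
  then show ?thesis using compensator_slope_near[OF assms, of s] assms by linarith
qed

lemma shifted_dither: "- cos (2 * pi * (t - 3/4)) = sin (2 * pi * t)"
proof -
  have "2 * pi * (t - 3/4) = (2 * pi * t - pi) - pi / 2" by (simp add: algebra_simps)
  then have "cos (2 * pi * (t - 3/4)) = sin (2 * pi * t - pi)"
    using sin_cos_eq[of "2 * pi * t - pi"] cos_minus[of "2 * pi * t - pi - pi / 2"] by simp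
  then show ?thesis by (simp add: sin_diff)
qed

section \<open>The drift over one dither period\<close>

lemma cos_ge_parabola: "1 - x\<^sup>2 / 2 \<le> cos x" for x :: real
proof -
  have "\<bar>sin (x / 2)\<bar>\<^sup>2 \<le> \<bar>x / 2\<bar>\<^sup>2" by (intro power_mono abs_sin_x_le_abs_x) auto
  then show ?thesis using cos_double_sin[of "x / 2"] by (simp add: power_divide)
qed

lemma cos_ge_half: assumes "\<bar>s\<bar> \<le> 1/6" shows "1/2 \<le> cos (2 * pi * s)"
proof -
  have "cos (pi / 3) \<le> cos (2 * pi * \<bar>s\<bar>)"
    using assms pi_gt_zero by (intro cos_monotone_0_pi_le) auto
  then show ?thesis by (cases "s \<ge> 0") (auto simp: cos_60)
qed

lemma cos_le_half: assumes "1/6 \<le> s" "s \<le> 1/2" shows "cos (2 * pi * s) \<le> 1/2"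
proof -
  have "cos (2 * pi * s) \<le> cos (pi / 3)"
    using assms pi_gt_zero by (intro cos_monotone_0_pi_le) auto
  then show ?thesis by (simp add: cos_60)
qed

lemma sin_nonneg_half: assumes "0 \<le> s" "s \<le> 1/2" shows "0 \<le> sin (2 * pi * s)"
  using assms pi_gt_zero by (intro sin_ge_zero) auto

text \<open>A definite distance from the top of the sweep keeps the sine away from zero. The loss of the square root
  in \<open>\<nu>\<close> is affordable and avoids roots in the later constants.\<close>

lemma sin_lower:
  assumes "1/6 \<le> s" "s \<le> 1/2" "- 1 + \<nu>/2 \<le> cos (2 * pi * s)" "0 < \<nu>" "\<nu> \<le> 1"
  shows "\<nu>/2 \<le> sin (2 * pi * s)"
proof -
  let ?c = "cos (2 * pi * s)"
  have "(\<nu>/2)\<^sup>2 \<le> (1/2) * (\<nu>/2)" unfolding power2_eq_square using assms(4,5) by (intro mult_right_mono) auto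
  also have "\<dots> \<le> (1 - ?c) * (1 + ?c)"
  proof (rule mult_mono)
    show "1/2 \<le> 1 - ?c" using cos_le_half[OF assms(1,2)] by linarith
    then show "0 \<le> 1 - ?c" by linarith
    show "\<nu>/2 \<le> 1 + ?c" using assms(3) by linarith
    show "0 \<le> \<nu>/2" using assms(4) by linarith
  qed
  also have "\<dots> = (sin (2 * pi * s))\<^sup>2"
    unfolding sin_squared_eq by algebra
  finally show ?thesis
    by (rule power2_le_imp_le) (rule sin_nonneg_half, (use assms in linarith)+)
qed

lemma window_product_le:
  fixes c s :: real
  assumes "c + s \<le> 8/5" "\<bar>c\<bar> \<le> 1" "\<bar>s\<bar> \<le> 1" "0 \<le> c + s"
  shows "9/25 \<le> 1 - c * s"
proof -
  have "4 * (c * s) = (c + s)\<^sup>2 - (c - s)\<^sup>2" by (simp add: power2_eq_square algebra_simps)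
  also have "\<dots> \<le> (c + s)\<^sup>2" by simp
  also have "\<dots> \<le> (8/5)\<^sup>2" using assms by (intro power_mono) auto
  finally show ?thesis by (simp add: power2_eq_square)
qed

text \<open>Up to a positive factor the right-hand side is the derivative of \<open>S\<^sup>2 / (1 - \<sigma>\<^sup>2)\<close> along an ascending
  sweep. For \<open>\<epsilon> = 0\<close> the substitutions \<open>\<sigma> = D - c\<close>, \<open>\<sigma>' = 2 pi sn\<close>, \<open>S = sn / (2 pi)\<close>, \<open>V = - c\<close> turn it
  into \<open>(\<sigma> + c) (1 - c \<sigma>) = D (1 - c \<sigma>)\<close>. While \<open>D \<le> 3/2\<close>, \<open>c \<sigma>\<close> stays away from \<open>1\<close> because
  \<open>c + \<sigma>\<close> is close to \<open>D < 2\<close>, and the main term exceeds the total error \<open>10 \<epsilon>\<close>. For larger \<open>D\<close> this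
  margin degenerates at \<open>D = 2\<close>, but then \<open>\<sigma> < 1\<close> forces \<open>c > 0\<close> and both terms have the right sign.\<close>

lemma ratio_derivative_nonneg:
  fixes c sn \<sigma> \<sigma>' S V D \<epsilon> :: real
  assumes cs: "sn\<^sup>2 + c\<^sup>2 = 1"
    and e1: "\<bar>\<sigma> - (D - c)\<bar> \<le> \<epsilon>" and e2: "\<bar>\<sigma>' - 2 * pi * sn\<bar> \<le> \<epsilon>"
    and e3: "\<bar>S - sn / (2 * pi)\<bar> \<le> \<epsilon>" and e4: "\<bar>V + c\<bar> \<le> \<epsilon>"
    and D: "40 * \<epsilon> \<le> D" and eps: "\<epsilon> \<le> 1/320"
    and \<sigma>: "\<bar>\<sigma>\<bar> < 1" and S: "0 \<le> S" and \<sigma>': "0 \<le> \<sigma>'"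
  shows "0 \<le> S * \<sigma> * \<sigma>' - V * (1 - \<sigma>\<^sup>2)"
proof (cases "D \<le> 3/2")
  case False
  have eps0: "0 \<le> \<epsilon>" using e1 by linarith
  have c1: "\<bar>c\<bar> \<le> 1" using cs zero_le_power2[of sn] unfolding abs_square_le_1[symmetric] by linarith
  then have "0 \<le> \<sigma>" using e1 False eps by linarith
  moreover have "V \<le> 0" using e1 e4 \<sigma> False eps by linarith
  moreover have "\<sigma>\<^sup>2 \<le> 1" using \<sigma> by (simp add: abs_square_le_1)
  ultimately have "V * (1 - \<sigma>\<^sup>2) \<le> 0" "0 \<le> S * \<sigma> * \<sigma>'"
    using S \<sigma>' by (auto intro: mult_nonpos_nonneg)
  then show ?thesis by linarith
next
  case True
  have eps0: "0 \<le> \<epsilon>" using e1 by linarith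
  have c1: "\<bar>c\<bar> \<le> 1" using cs zero_le_power2[of sn] unfolding abs_square_le_1[symmetric] by linarith
  have sn1: "\<bar>sn\<bar> \<le> 1" using cs zero_le_power2[of c] unfolding abs_square_le_1[symmetric] by linarith
  have e1': "\<sigma> + c \<le> D + \<epsilon>" "D - \<epsilon> \<le> \<sigma> + c" using e1 by (auto simp: abs_le_iff)
  have "39 * \<epsilon> \<le> \<sigma> + c" using e1' D by linarith
  moreover have "9/25 \<le> 1 - c * \<sigma>"
  proof (rule window_product_le)
    show "c + \<sigma> \<le> 8/5" using e1' True eps by linarith
    show "0 \<le> c + \<sigma>" using e1' D eps0 by linarith
  qed (use c1 \<sigma> in auto)
  ultimately have main: "(39 * \<epsilon>) * (9/25) \<le> (\<sigma> + c) * (1 - c * \<sigma>)"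
    using eps0 by (intro mult_mono) auto
  have id1: "(\<sigma> + c) * (1 - c * \<sigma>) = sn\<^sup>2 * \<sigma> + c * (1 - \<sigma>\<^sup>2)"
  proof -
    have "sn\<^sup>2 = 1 - c\<^sup>2" using cs by simp
    then show ?thesis by algebra
  qed
  \<comment> \<open>Each of the three error terms is linear in one of the deviations.\<close>
  have "2 * pi * sn * (sn / (2 * pi)) = sn\<^sup>2" by (simp add: power2_eq_square)
  then have id2: "S * \<sigma> * \<sigma>' - V * (1 - \<sigma>\<^sup>2) - (sn\<^sup>2 * \<sigma> + c * (1 - \<sigma>\<^sup>2))
      = \<sigma> * (S * (\<sigma>' - 2 * pi * sn)) + \<sigma> * ((2 * pi * sn) * (S - sn / (2 * pi))) - (V + c) * (1 - \<sigma>\<^sup>2)"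
    by algebra
  have "\<bar>S\<bar> \<le> 1"
  proof -
    have "\<bar>sn / (2 * pi)\<bar> \<le> 1 / (2 * 3)"
      unfolding abs_divide using sn1 pi_gt3 by (intro frac_le) auto
    then show ?thesis using e3 eps by linarith
  qed
  then have "\<bar>S * (\<sigma>' - 2 * pi * sn)\<bar> \<le> 1 * \<epsilon>" unfolding abs_mult using e2 by (intro mult_mono) auto
  then have b1: "\<bar>\<sigma> * (S * (\<sigma>' - 2 * pi * sn))\<bar> \<le> 1 * (1 * \<epsilon>)"
    unfolding abs_mult[of \<sigma>] using \<sigma> by (intro mult_mono) auto
  have "\<bar>2 * pi * sn\<bar> \<le> 8 * 1" unfolding abs_mult using sn1 pi_less_4 by (intro mult_mono) auto
  then have "\<bar>(2 * pi * sn) * (S - sn / (2 * pi))\<bar> \<le> 8 * \<epsilon>"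
    unfolding abs_mult[of "2 * pi * sn"] using e3 by (intro mult_mono) auto
  then have b2: "\<bar>\<sigma> * ((2 * pi * sn) * (S - sn / (2 * pi)))\<bar> \<le> 1 * (8 * \<epsilon>)"
    unfolding abs_mult[of \<sigma>] using \<sigma> by (intro mult_mono) auto
  have "\<sigma>\<^sup>2 \<le> 1" using \<sigma> by (simp add: abs_square_le_1)
  then have b3: "\<bar>(V + c) * (1 - \<sigma>\<^sup>2)\<bar> \<le> \<epsilon> * 1"
    unfolding abs_mult using e4 by (intro mult_mono) auto
  show ?thesis
    using main id1 id2 eps0 b1[THEN abs_le_D2] b2[THEN abs_le_D2] b3[THEN abs_le_D1] by linarith
qed

context balanced_cost
begin

text \<open>An ascending half sweep of the probe \<open>P\<close>, with \<open>F\<close> a primitive of \<open>h'(P) P' S\<close>. By \<open>N\<close> the ratio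
  \<open>S / w\<close> increases, \<open>w\<close> being the weight of the balance at \<open>e\<close>. With \<open>\<rho>\<close> its value when the probe passes
  \<open>xs\<close>, the difference \<open>S - \<rho> w\<close> changes sign together with \<open>h'\<close>, so \<open>F - \<rho> \<Phi> (P)\<close> increases up to the
  level \<open>e + \<delta>\<close>; the balance makes \<open>\<rho> \<Phi> (P)\<close> end no lower than it starts. Above that level, and
  everywhere if the sweep starts right of \<open>xs\<close>, \<open>h'\<close> is nonnegative.\<close>

lemma sweep_comparison:
  fixes P dP S V F :: "real \<Rightarrow> real"
  assumes ab: "a \<le> b"
    and P: "\<And>t. a \<le> t \<Longrightarrow> t \<le> b \<Longrightarrow> (P has_real_derivative dP t) (at t)"
    and S: "\<And>t. a \<le> t \<Longrightarrow> t \<le> b \<Longrightarrow> (S has_real_derivative - V t) (at t)"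
    and F: "\<And>t. a \<le> t \<Longrightarrow> t \<le> b \<Longrightarrow> (F has_real_derivative dh (P t) * dP t * S t) (at t)"
    and dP: "\<And>t. a \<le> t \<Longrightarrow> t \<le> b \<Longrightarrow> 0 \<le> dP t"
    and S_nn: "\<And>t. a \<le> t \<Longrightarrow> t \<le> b \<Longrightarrow> 0 \<le> S t"
    and N: "\<And>t. a \<le> t \<Longrightarrow> t \<le> b \<Longrightarrow> \<bar>(P t - e) / \<delta>\<bar> < 1 \<Longrightarrow>
      0 \<le> S t * ((P t - e) / \<delta>) * (dP t / \<delta>) - V t * (1 - ((P t - e) / \<delta>)\<^sup>2)"
    and Pa: "e - \<delta> < P a" and Pb: "e + \<delta> \<le> P b"
  shows "F a \<le> F b"
proof -
  have P_mono: "P s \<le> P t" if "a \<le> s" "s \<le> t" "t \<le> b" for s t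
    using that by (intro DERIV_nonneg_imp_nondecreasing[of s t P]) (auto intro!: exI P dP)
  have P_cont: "continuous_on {a..b} P"
    by (meson P DERIV_isCont atLeastAtMost_iff continuous_at_imp_continuous_on)
  have F_mono: "F s \<le> F b" if "a \<le> s" "s \<le> b" "xs \<le> P s" for s
  proof (rule DERIV_nonneg_imp_nondecreasing[OF \<open>s \<le> b\<close>])
    fix t assume t: "s \<le> t" "t \<le> b"
    have "xs \<le> P t" using P_mono[of s t] that t by simp
    then have "0 \<le> dh (P t) * dP t * S t"
      using dh_right dP[of t] S_nn[of t] t that by auto
    then show "\<exists>y. (F has_real_derivative y) (at t) \<and> 0 \<le> y" using F[of t] t that by auto
  qed
  show ?thesis
  proof (cases "xs \<le> P a")
    case True then show ?thesis using F_mono[of a] ab by simp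
  next
    case False
    then have Pa_xs: "P a < xs" by simp
    have "continuous_on {a..b} (\<lambda>t. - P t)" by (intro continuous_intros P_cont)
    moreover have "- (e + \<delta>) \<le> - P a" using Pa_xs xs_less by simp
    ultimately obtain te where te': "a \<le> te" "te \<le> b" "- P te = - (e + \<delta>)"
        "\<And>t. a \<le> t \<Longrightarrow> t < te \<Longrightarrow> - (e + \<delta>) < - P t"
      using first_crossing[of a b "\<lambda>t. - P t" "- (e + \<delta>)"] ab Pb neg_le_iff_le by blast
    have te: "a \<le> te" "te \<le> b" "P te = e + \<delta>"
      and te_less: "\<And>t. a \<le> t \<Longrightarrow> t < te \<Longrightarrow> P t < e + \<delta>"
      using te' by force+
    have "continuous_on {a..te} P" using te by (intro continuous_on_subset[OF P_cont]) auto
    then obtain tx where tx: "a \<le> tx" "tx \<le> te" "P tx = xs"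
      using IVT'[of P a xs te] Pa_xs xs_less te by auto
    have tx_te: "tx < te" using tx te xs_less by (cases "tx = te") auto
    define \<sigma> where "\<sigma> t = (P t - e) / \<delta>" for t
    define w where "w v = sqrt (1 - ((v - e) / \<delta>)\<^sup>2)" for v
    have P_gt: "e - \<delta> < P t" if "a \<le> t" "t \<le> b" for t using P_mono[of a t] that Pa by simp
    have pos: "0 < 1 - (\<sigma> t)\<^sup>2" if "a \<le> t" "t < te" for t
      unfolding \<sigma>_def using weight_pos[of "P t"] P_gt[of t] te_less[of t] that te(2) by auto
    \<comment> \<open>The ratio is squared to avoid differentiating the square root.\<close>
    have R: "(S s)\<^sup>2 / (1 - (\<sigma> s)\<^sup>2) \<le> (S t)\<^sup>2 / (1 - (\<sigma> t)\<^sup>2)" if "a \<le> s" "s \<le> t" "t < te" for s t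
    proof (rule DERIV_nonneg_imp_nondecreasing[OF \<open>s \<le> t\<close>])
      fix r assume r: "s \<le> r" "r \<le> t"
      then have rr: "a \<le> r" "r \<le> b" "r < te" using that te by auto
      let ?D = "(2 * S r * (- V r) * (1 - (\<sigma> r)\<^sup>2) - (S r)\<^sup>2 * (- (2 * \<sigma> r * (dP r / \<delta>)))) / (1 - (\<sigma> r)\<^sup>2)\<^sup>2"
      have s': "(\<sigma> has_real_derivative dP r / \<delta>) (at r)"
        unfolding \<sigma>_def using \<delta>_pos
        by (auto intro!: derivative_eq_intros P[OF rr(1,2)])
      have p: "0 < 1 - (\<sigma> r)\<^sup>2" using pos[of r] rr by simp
      have D: "((\<lambda>t. (S t)\<^sup>2 / (1 - (\<sigma> t)\<^sup>2)) has_real_derivative ?D) (at r)"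
        using p by (auto intro!: derivative_eq_intros s' S[OF rr(1,2)] simp: power2_eq_square)
      have "\<bar>\<sigma> r\<bar> < 1" using p abs_square_less_1[of "\<sigma> r"] by simp
      then have "0 \<le> S r * \<sigma> r * (dP r / \<delta>) - V r * (1 - (\<sigma> r)\<^sup>2)"
        using N[OF rr(1,2)] unfolding \<sigma>_def by simp
      then have "0 \<le> 2 * S r * (S r * \<sigma> r * (dP r / \<delta>) - V r * (1 - (\<sigma> r)\<^sup>2))"
        using S_nn[OF rr(1,2)] by (intro mult_nonneg_nonneg) auto
      also have "\<dots> = 2 * S r * (- V r) * (1 - (\<sigma> r)\<^sup>2) - (S r)\<^sup>2 * (- (2 * \<sigma> r * (dP r / \<delta>)))"
        by (simp add: algebra_simps power2_eq_square)
      finally have "0 \<le> ?D" by (intro divide_nonneg_nonneg) auto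
      with D show "\<exists>y. ((\<lambda>t. (S t)\<^sup>2 / (1 - (\<sigma> t)\<^sup>2)) has_real_derivative y) (at r) \<and> 0 \<le> y" by blast
    qed
    have R': "S s / w (P s) \<le> S t / w (P t)" if "a \<le> s" "s \<le> t" "t < te" for s t
    proof -
      have "sqrt ((S s)\<^sup>2 / (1 - (\<sigma> s)\<^sup>2)) \<le> sqrt ((S t)\<^sup>2 / (1 - (\<sigma> t)\<^sup>2))"
        using R[OF that] by simp
      then show ?thesis using S_nn[of s] S_nn[of t] that te(2)
        by (simp add: real_sqrt_divide w_def \<sigma>_def)
    qed
    have w_pos: "0 < w (P t)" if "a \<le> t" "t < te" for t
      using pos[OF that] by (simp add: w_def \<sigma>_def)
    define \<rho> where "\<rho> = S tx / w xs"
    have \<rho>_nn: "0 \<le> \<rho>" unfolding \<rho>_def using S_nn[of tx] w_pos[of tx] tx te tx_te by simp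
    have sgn: "0 \<le> dh (P t) * (S t - \<rho> * w (P t))" if "a \<le> t" "t < te" for t
    proof (cases "t \<le> tx")
      case True
      then have "S t / w (P t) \<le> \<rho>" using R'[of t tx] tx tx_te that by (simp add: \<rho>_def)
      then have "S t - \<rho> * w (P t) \<le> 0" using w_pos[OF that] by (simp add: field_simps)
      moreover have "dh (P t) \<le> 0" using P_mono[of t tx] tx te True that by (intro dh_left) simp
      ultimately show ?thesis by (simp add: mult_nonpos_nonpos)
    next
      case False
      then have "\<rho> \<le> S t / w (P t)" using R'[of tx t] tx tx_te that by (simp add: \<rho>_def)
      then have "0 \<le> S t - \<rho> * w (P t)" using w_pos[OF that] by (simp add: field_simps)
      moreover have "0 \<le> dh (P t)" using P_mono[of tx t] tx te False that by (intro dh_right) simp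
      ultimately show ?thesis by simp
    qed
    have "F a - \<rho> * \<Phi> (P a) \<le> F te - \<rho> * \<Phi> (P te)"
    proof (rule DERIV_nonneg_imp_increasing_open[OF te(1)])
      fix t assume t: "a < t" "t < te"
      have D: "((\<lambda>t. F t - \<rho> * \<Phi> (P t)) has_real_derivative
          dh (P t) * dP t * S t - \<rho> * (dh (P t) * w (P t) * dP t)) (at t)"
        unfolding w_def using t te P_gt[of t] te_less[of t]
        by (intro DERIV_diff F DERIV_cmult DERIV_chain2[OF \<Phi>_deriv P]) auto
      have "0 \<le> dP t * (dh (P t) * (S t - \<rho> * w (P t)))" using dP[of t] sgn[of t] t te(2) by simp
      also have "\<dots> = dh (P t) * dP t * S t - \<rho> * (dh (P t) * w (P t) * dP t)"
        by (simp add: algebra_simps)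
      finally show "\<exists>y. ((\<lambda>t. F t - \<rho> * \<Phi> (P t)) has_real_derivative y) (at t) \<and> 0 \<le> y"
        using D by blast
    next
      have "continuous_on {a..te} F"
        using te by (intro continuous_at_imp_continuous_on ballI DERIV_isCont[OF F]) auto
      moreover have "P t \<in> {e - \<delta>..e + \<delta>}" if "t \<in> {a..te}" for t
        using that P_gt[of t] P_mono[of t te] te by simp
      then have "continuous_on {a..te} (\<lambda>t. \<Phi> (P t))"
        by (intro continuous_on_compose2[OF \<Phi>_cont \<open>continuous_on {a..te} P\<close>]) blast
      ultimately show "continuous_on {a..te} (\<lambda>t. F t - \<rho> * \<Phi> (P t))"
        by (intro continuous_intros)
    qed
    moreover have "\<rho> * \<Phi> (P a) \<le> \<rho> * \<Phi> (P te)"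
      using \<Phi>_le[of "P a"] Pa Pa_xs \<rho>_nn te by (intro mult_left_mono) auto
    moreover have "F te \<le> F b" using F_mono[of te] te xs_less by simp
    ultimately show ?thesis by linarith
  qed
qed

text \<open>Signals within \<open>\<epsilon>\<close> of an ideal sweep from its lowest point \<open>m\<close> satisfy the hypotheses of
  \<open>sweep_comparison\<close>. The sweep is cut at \<open>b\<close>, a relative distance \<open>\<nu>\<close> below the top: there \<open>P'\<close> and
  \<open>S\<close> both become small and their signs would be lost in the error.\<close>

lemma half_period_comparison:
  fixes P dP F :: "real \<Rightarrow> real"
  assumes b: "1/6 \<le> b" "b \<le> 1/2" and m: "\<bar>m\<bar> \<le> 1/6"
    and \<nu>: "0 < \<nu>" "\<nu> \<le> 1/8" and \<epsilon>: "0 < \<epsilon>" "\<epsilon> \<le> \<nu>/40" and D: "\<nu> \<le> D"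
    and g: "\<bar>g\<bar> \<le> \<epsilon>" and sin_m: "\<bar>sin (2 * pi * m) / (2 * pi)\<bar> + \<bar>g\<bar> / 2 \<le> \<epsilon>"
    and P: "\<And>s. \<bar>s\<bar> \<le> 1/2 \<Longrightarrow> (P has_real_derivative dP s) (at s)"
    and P_near: "\<And>s. \<bar>s\<bar> \<le> 1/2 \<Longrightarrow> \<bar>(P s - e) / \<delta> - (D - cos (2 * pi * s))\<bar> \<le> \<epsilon>"
    and dP_near: "\<And>s. \<bar>s\<bar> \<le> 1/2 \<Longrightarrow> \<bar>dP s / \<delta> - 2 * pi * sin (2 * pi * s)\<bar> \<le> \<epsilon>"
    and dP_m: "\<And>s. m \<le> s \<Longrightarrow> s \<le> 1/6 \<Longrightarrow> 0 \<le> dP s"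
    and Pb: "(P b - e) / \<delta> = D + 1 - \<nu>"
    and F: "\<And>s. \<bar>s\<bar> \<le> 1/2 \<Longrightarrow>
      (F has_real_derivative dh (P s) * dP s * (compensator g m - compensator g s)) (at s)"
  shows "F m \<le> F b"
proof (rule sweep_comparison[where a = m and b = b and F = F and P = P and dP = dP and S = "\<lambda>s. compensator g m - compensator g s" and V = "compensator_slope g"])
  have \<epsilon>': "\<epsilon> \<le> 1/320" using \<epsilon> \<nu> by linarith
  have g1: "\<bar>g\<bar> \<le> 1" using g \<epsilon>' by linarith
  have pi3: "3 \<le> pi" "pi \<le> 4" using pi_gt3 pi_less_4 by auto
  have in_window: "\<bar>s\<bar> \<le> 1/2" if "m \<le> s" "s \<le> b" for s using that m b by linarith
  show "m \<le> b" using m b by linarith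
  show "(P has_real_derivative dP s) (at s)" if "m \<le> s" "s \<le> b" for s
    using P in_window that by blast
  show "(F has_real_derivative dh (P s) * dP s * (compensator g m - compensator g s)) (at s)" if "m \<le> s" "s \<le> b" for s
    using F in_window that by blast
  show S': "((\<lambda>s. compensator g m - compensator g s) has_real_derivative - compensator_slope g s) (at s)" for s
    by (rule derivative_eq_intros compensator_deriv refl | simp)+
  have sin_ge: "\<nu>/2 \<le> sin (2 * pi * s)" if "1/6 \<le> s" "s \<le> b" for s
  proof (rule sin_lower)
    have "cos (2 * pi * b) \<le> cos (2 * pi * s)"
      using that b pi3 by (intro cos_monotone_0_pi_le) auto
    moreover have "- 1 + \<nu>/2 \<le> cos (2 * pi * b)"
      using P_near[of b] Pb b \<epsilon> by (auto simp: abs_le_iff)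
    ultimately show "- 1 + \<nu>/2 \<le> cos (2 * pi * s)" by linarith
  qed (use that b \<nu> in auto)
  show dP_nn: "0 \<le> dP s" if s: "m \<le> s" "s \<le> b" for s
  proof (cases "s \<le> 1/6")
    case False
    then have "6 * (\<nu>/2) \<le> (2 * pi) * sin (2 * pi * s)"
      using sin_ge[of s] s pi3 \<nu> by (intro mult_mono) auto
    then have "0 \<le> dP s / \<delta>" using dP_near[OF in_window[OF s]] \<epsilon> \<nu> by (auto simp: abs_le_iff)
    then show ?thesis using \<delta>_pos by (simp add: zero_le_divide_iff)
  qed (use dP_m s in auto)
  have S_near: "\<bar>compensator g m - compensator g s - sin (2 * pi * s) / (2 * pi)\<bar> \<le> \<epsilon>" for s
  proof -
    have "\<bar>compensator g m - compensator g s - sin (2 * pi * s) / (2 * pi)\<bar>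
      \<le> \<bar>compensator g m + sin (2 * pi * m) / (2 * pi)\<bar> + \<bar>sin (2 * pi * m) / (2 * pi)\<bar>
        + \<bar>compensator g s + sin (2 * pi * s) / (2 * pi)\<bar>" by linarith
    also have "\<dots> \<le> \<bar>g\<bar>/4 + \<bar>sin (2 * pi * m) / (2 * pi)\<bar> + \<bar>g\<bar>/4"
      using compensator_near[OF g1] by (intro add_mono) auto
    finally show ?thesis using sin_m by linarith
  qed
  show S_nn: "0 \<le> compensator g m - compensator g s" if s: "m \<le> s" "s \<le> b" for s
  proof (cases "s \<le> 1/6")
    case True
    have "(\<lambda>s. compensator g m - compensator g s) m \<le> (\<lambda>s. compensator g m - compensator g s) s"
    proof (rule DERIV_nonneg_imp_nondecreasing[OF s(1)])
      fix r assume "m \<le> r" "r \<le> s"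
      then have "1/2 \<le> cos (2 * pi * r)" using True m by (intro cos_ge_half) auto
      then have "0 \<le> - compensator_slope g r" using compensator_slope_near[OF g1, of r] g \<epsilon>' by (auto simp: abs_le_iff)
      then show "\<exists>y. ((\<lambda>s. compensator g m - compensator g s) has_real_derivative y) (at r) \<and> 0 \<le> y"
        using S' by blast
    qed
    then show ?thesis by simp
  next
    case False
    then have "(\<nu>/2) / 8 \<le> sin (2 * pi * s) / (2 * pi)"
      using sin_ge[of s] s pi3 \<nu> by (intro frac_le) auto
    then show ?thesis using S_near[of s] \<epsilon> \<nu> by (auto simp: abs_le_iff)
  qed
  show "0 \<le> (compensator g m - compensator g s) * ((P s - e) / \<delta>) * (dP s / \<delta>) - compensator_slope g s * (1 - ((P s - e) / \<delta>)\<^sup>2)"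
    if s: "m \<le> s" "s \<le> b" and "\<bar>(P s - e) / \<delta>\<bar> < 1" for s
  proof (rule ratio_derivative_nonneg[where c = "cos (2 * pi * s)" and sn = "sin (2 * pi * s)"
        and D = D and \<epsilon> = \<epsilon>])
    show "\<bar>compensator_slope g s + cos (2 * pi * s)\<bar> \<le> \<epsilon>" using compensator_slope_near[OF g1, of s] g by linarith
    show "0 \<le> dP s / \<delta>" using dP_nn[OF s] \<delta>_pos by simp
    show "40 * \<epsilon> \<le> D" using \<epsilon> D by linarith
  qed (use S_near S_nn[OF s] P_near[OF in_window[OF s]] dP_near[OF in_window[OF s]] \<epsilon>' that in auto)
  have "-1 < (P m - e) / \<delta>"
    using P_near[of m] m D \<epsilon> \<nu> cos_le_one[of "2 * pi * m"] unfolding abs_le_iff by linarith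
  then show "e - \<delta> < P m" using \<delta>_pos by (simp add: field_simps)
  have "1 \<le> (P b - e) / \<delta>" using Pb D by linarith
  then show "e + \<delta> \<le> P b" using \<delta>_pos by (simp add: field_simps)
qed

text \<open>The window runs from one top of the sweep to the next. It is split where the probe first and last
  crosses the level \<open>v\<^sub>1\<close> slightly below the top. Above \<open>v\<^sub>1\<close> the integrand \<open>(h (P) - h v\<^sub>1) Q'\<close> is
  nonnegative, and bounded below near the start, which gives the strict decrease. Between the crossings the
  integration by parts has no boundary terms, because \<open>h (P) = h v\<^sub>1\<close> at both, and the two half sweeps are
  covered by \<open>half_period_comparison\<close>.\<close>

lemma period_drift:
  fixes x y :: "real \<Rightarrow> real" and \<gamma> C \<nu> :: real
  defines "P \<equiv> \<lambda>s. x s - \<delta> * cos (2 * pi * s)"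
  defines "v\<^sub>1 \<equiv> x (- (1/2)) + \<delta> - \<nu> * \<delta>"
  assumes \<gamma>: "0 < \<gamma>" and C: "0 \<le> C" and \<nu>: "0 < \<nu>" "\<nu> \<le> 1/8"
    and small: "\<gamma> * (1 + C / \<delta>) \<le> \<nu> / 40" "\<gamma> * L \<le> 1/10"
    and dx: "\<And>s. \<bar>s\<bar> \<le> 1/2 \<Longrightarrow>
      (x has_real_derivative \<gamma> * (h (P s) - y s) * cos (2 * pi * s)) (at s)"
    and dy: "\<And>s. \<bar>s\<bar> \<le> 1/2 \<Longrightarrow> (y has_real_derivative \<gamma> * (h (P s) - y s)) (at s)"
    and C_bound: "\<And>s. \<bar>s\<bar> \<le> 1/2 \<Longrightarrow> \<bar>h (P s) - y s\<bar> \<le> C"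
    and start: "e + \<nu> * \<delta> \<le> x (- (1/2))"
  shows "x (1/2) - \<gamma> * compensator \<gamma> (1/2) * y (1/2) \<le> x (- (1/2)) - \<gamma> * compensator \<gamma> (- (1/2)) * y (- (1/2))
           - \<gamma> * (\<nu> / 40 * (h (v\<^sub>1 + \<nu> * \<delta> / 2) - h v\<^sub>1))"
proof -
  define \<epsilon> where "\<epsilon> = \<gamma> * (1 + C / \<delta>)"
  define q where "q s = h (P s) - y s" for s
  define dP where "dP s = \<gamma> * q s * cos (2 * pi * s) + 2 * pi * \<delta> * sin (2 * pi * s)" for s
  define D where "D = (x (- (1/2)) - e) / \<delta>"
  have \<gamma>\<epsilon>: "\<gamma> \<le> \<epsilon>" and C\<epsilon>: "\<gamma> * C / \<delta> \<le> \<epsilon>" and \<epsilon>_sum: "\<epsilon> = \<gamma> + \<gamma> * C / \<delta>"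
    unfolding \<epsilon>_def using \<gamma> C \<delta>_pos by (auto simp: algebra_simps)
  have \<epsilon>: "0 < \<epsilon>" "\<epsilon> \<le> \<nu> / 40" "\<epsilon> \<le> 1/320" using small \<gamma> \<gamma>\<epsilon> \<nu> unfolding \<epsilon>_def[symmetric] by auto
  have \<gamma>1: "\<bar>\<gamma>\<bar> \<le> 1" "\<bar>- \<gamma>\<bar> \<le> 1" using \<gamma> \<gamma>\<epsilon> \<epsilon> by auto
  have D: "\<nu> \<le> D" unfolding D_def using start \<delta>_pos by (simp add: field_simps)
  have \<gamma>C: "\<gamma> * C \<le> \<epsilon> * \<delta>" using C\<epsilon> \<delta>_pos by (simp add: field_simps)
  have q: "\<bar>q s\<bar> \<le> C" if "\<bar>s\<bar> \<le> 1/2" for s using C_bound[OF that] unfolding q_def .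
  have qc: "\<bar>\<gamma> * q s * cos (2 * pi * s)\<bar> \<le> \<gamma> * C" if "\<bar>s\<bar> \<le> 1/2" for s
  proof -
    have "\<bar>\<gamma> * q s * cos (2 * pi * s)\<bar> \<le> (\<gamma> * C) * 1"
      unfolding abs_mult using q[OF that] \<gamma> C by (intro mult_mono) auto
    then show ?thesis by simp
  qed
  have P_deriv: "(P has_real_derivative dP s) (at s)" if "\<bar>s\<bar> \<le> 1/2" for s
    unfolding P_def dP_def q_def
    by (rule derivative_eq_intros dx[OF that, unfolded P_def] refl | simp)+
  have P_cont: "continuous_on {a..b} P" if "-(1/2) \<le> a" "b \<le> 1/2" for a b
    using that by (intro continuous_at_imp_continuous_on ballI DERIV_isCont[OF P_deriv]) (auto simp: abs_if)
  have x_near: "\<bar>x s - x (- (1/2))\<bar> \<le> \<gamma> * C" if "\<bar>s\<bar> \<le> 1/2" for s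
  proof -
    have s: "- (1/2) \<le> s" "s \<le> 1/2" using that by auto
    have "\<bar>x s - x (- (1/2))\<bar> \<le> \<gamma> * C * (s - - (1/2))"
    proof (rule increment_bound[OF s(1)])
      show "continuous_on {- (1/2)..s} x"
        using s by (intro continuous_at_imp_continuous_on ballI DERIV_isCont[OF dx]) (auto simp: abs_if)
      fix t assume "- (1/2) < t" "t < s"
      then have t: "\<bar>t\<bar> \<le> 1/2" using s by auto
      show "\<exists>D. (x has_real_derivative D) (at t) \<and> \<bar>D\<bar> \<le> \<gamma> * C"
        using dx[OF t] qc[OF t] unfolding q_def by blast
    qed
    also have "\<dots> \<le> \<gamma> * C * 1" using s \<gamma> C by (intro mult_left_mono) auto
    finally show ?thesis by simp
  qed
  have x_near': "x (- (1/2)) - \<epsilon> * \<delta> \<le> x s" "x s \<le> x (- (1/2)) + \<epsilon> * \<delta>" if "\<bar>s\<bar> \<le> 1/2" for s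
    using x_near[OF that] \<gamma>C by (auto simp: abs_le_iff)
  have \<sigma>_near: "\<bar>(P s - e) / \<delta> - (D - cos (2 * pi * s))\<bar> \<le> \<epsilon>" if "\<bar>s\<bar> \<le> 1/2" for s
  proof -
    have "(P s - e) / \<delta> - (D - cos (2 * pi * s)) = (x s - x (- (1/2))) / \<delta>"
      unfolding P_def D_def using \<delta>_pos by (simp add: field_simps)
    moreover have "\<bar>x s - x (- (1/2))\<bar> / \<delta> \<le> \<gamma> * C / \<delta>"
      using x_near[OF that] \<delta>_pos by (intro divide_right_mono) auto
    ultimately show ?thesis using C\<epsilon> \<delta>_pos by simp
  qed
  have \<sigma>'_near: "\<bar>dP s / \<delta> - 2 * pi * sin (2 * pi * s)\<bar> \<le> \<epsilon>" if "\<bar>s\<bar> \<le> 1/2" for s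
  proof -
    have "dP s / \<delta> - 2 * pi * sin (2 * pi * s) = (\<gamma> * q s * cos (2 * pi * s)) / \<delta>"
      unfolding dP_def using \<delta>_pos by (simp add: field_simps)
    moreover have "\<bar>\<gamma> * q s * cos (2 * pi * s)\<bar> / \<delta> \<le> \<gamma> * C / \<delta>"
      using qc[OF that] \<delta>_pos by (intro divide_right_mono) auto
    ultimately show ?thesis using C\<epsilon> \<delta>_pos by simp
  qed
  have dP_ge: "\<delta> * (2 * pi * sin (2 * pi * s) - \<epsilon>) \<le> dP s" "dP s \<le> \<delta> * (2 * pi * sin (2 * pi * s) + \<epsilon>)"
    if "\<bar>s\<bar> \<le> 1/2" for s
    using \<sigma>'_near[OF that] \<delta>_pos by (auto simp: abs_le_iff field_simps)
  have pi3: "3 \<le> pi" "pi \<le> 4" using pi_gt3 pi_less_4 by auto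
  have dP_pos: "0 < dP s" if "sin (2 * pi * s) \<ge> \<epsilon>" "\<bar>s\<bar> \<le> 1/2" for s
  proof -
    have "6 * \<epsilon> \<le> (2 * pi) * sin (2 * pi * s)" using that(1) \<epsilon> pi3 by (intro mult_mono) auto
    then have "0 < 2 * pi * sin (2 * pi * s) - \<epsilon>" using \<epsilon> by linarith
    then have "0 < \<delta> * (2 * pi * sin (2 * pi * s) - \<epsilon>)" using \<delta>_pos by simp
    then show ?thesis using dP_ge(1)[OF that(2)] by linarith
  qed
  have dP_neg: "dP s < 0" if "sin (2 * pi * s) \<le> - \<epsilon>" "\<bar>s\<bar> \<le> 1/2" for s
  proof -
    have "6 * \<epsilon> \<le> (2 * pi) * (- sin (2 * pi * s))" using that(1) \<epsilon> pi3 by (intro mult_mono) auto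
    then have "2 * pi * sin (2 * pi * s) + \<epsilon> < 0" using \<epsilon> by linarith
    then have "\<delta> * (2 * pi * sin (2 * pi * s) + \<epsilon>) < 0" using \<delta>_pos by (simp add: mult_pos_neg)
    then show ?thesis using dP_ge(2)[OF that(2)] by linarith
  qed
  define ddP where "ddP s = \<gamma> * (dh (P s) * dP s - \<gamma> * q s) * cos (2 * pi * s)
      - \<gamma> * q s * (2 * pi * sin (2 * pi * s)) + 4 * pi\<^sup>2 * \<delta> * cos (2 * pi * s)" for s
  have dP_deriv: "(dP has_real_derivative ddP s) (at s)" if "\<bar>s\<bar> \<le> 1/2" for s
  proof -
    have q': "(q has_real_derivative dh (P s) * dP s - \<gamma> * q s) (at s)"
      unfolding q_def[abs_def] using DERIV_diff[OF DERIV_chain2[OF deriv P_deriv[OF that]] dy[OF that]] .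
    have "((\<lambda>s. \<gamma> * q s * cos (2 * pi * s) + 2 * pi * \<delta> * sin (2 * pi * s)) has_real_derivative ddP s) (at s)"
      unfolding ddP_def by (rule derivative_eq_intros q' refl | simp add: power2_eq_square algebra_simps)+
    then show ?thesis by (simp only: dP_def[abs_def])
  qed
  \<comment> \<open>Around the bottom the probe is strictly convex, so it has a single lowest point there.\<close>
  have ddP_pos: "0 < ddP s" if "\<bar>s\<bar> \<le> 1/6" for s
  proof -
    have s: "\<bar>s\<bar> \<le> 1/2" using that by simp
    have "3 * 3 \<le> pi * pi" using pi3 by (intro mult_mono) auto
    then have "36 * \<delta> \<le> 4 * pi\<^sup>2 * \<delta>" using \<delta>_pos by (simp add: power2_eq_square)
    then have m: "36 * \<delta> * (1/2) \<le> 4 * pi\<^sup>2 * \<delta> * cos (2 * pi * s)"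
      using cos_ge_half[OF that] \<delta>_pos by (intro mult_mono) auto
    have "\<bar>dP s\<bar> \<le> \<gamma> * C + 8 * \<delta>"
    proof -
      have "\<bar>2 * pi * \<delta> * sin (2 * pi * s)\<bar> \<le> (8 * \<delta>) * 1"
        unfolding abs_mult using pi3 \<delta>_pos by (intro mult_mono) auto
      then show ?thesis unfolding dP_def using qc[OF s] by (simp add: abs_le_iff)
    qed
    then have dP9: "\<bar>dP s\<bar> \<le> 9 * \<delta>" using \<gamma>C \<epsilon> mult_right_mono[of \<epsilon> 1 \<delta>] \<delta>_pos by linarith
    have "\<bar>\<gamma> * dh (P s)\<bar> \<le> 1/10"
    proof -
      have "\<bar>\<gamma> * dh (P s)\<bar> \<le> \<gamma> * L" unfolding abs_mult using dh_bound[of "P s"] \<gamma> by simp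
      then show ?thesis using small(2) by linarith
    qed
    then have "\<bar>(\<gamma> * dh (P s)) * dP s\<bar> \<le> (1/10) * (9 * \<delta>)"
      unfolding abs_mult[of "\<gamma> * dh (P s)"] using dP9 by (intro mult_mono) auto
    moreover have "\<bar>\<gamma> * q s\<bar> \<le> \<epsilon> * \<delta>"
    proof -
      have "\<bar>\<gamma> * q s\<bar> \<le> \<gamma> * C" unfolding abs_mult using q[OF s] \<gamma> by (intro mult_mono) auto
      then show ?thesis using \<gamma>C by linarith
    qed
    moreover have gq2: "\<bar>\<gamma> * (\<gamma> * q s)\<bar> \<le> 1 * (\<epsilon> * \<delta>)"
      unfolding abs_mult[of \<gamma> "\<gamma> * q s"] using calculation \<gamma>1 by (intro mult_mono) auto
    moreover have "\<epsilon> * \<delta> \<le> (1/320) * \<delta>" using \<epsilon> \<delta>_pos by (intro mult_right_mono) auto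
    moreover have "\<gamma> * (dh (P s) * dP s - \<gamma> * q s) = (\<gamma> * dh (P s)) * dP s - \<gamma> * (\<gamma> * q s)"
      by (simp add: algebra_simps)
    ultimately have "\<bar>\<gamma> * (dh (P s) * dP s - \<gamma> * q s)\<bar> \<le> \<delta>"
      using \<delta>_pos by linarith
    then have a: "\<bar>\<gamma> * (dh (P s) * dP s - \<gamma> * q s) * cos (2 * pi * s)\<bar> \<le> \<delta> * 1"
      unfolding abs_mult[of _ "cos (2 * pi * s)"] using \<delta>_pos by (intro mult_mono) auto
    have "\<bar>2 * pi * sin (2 * pi * s)\<bar> \<le> 8 * 1" unfolding abs_mult using pi3 by (intro mult_mono) auto
    then have b: "\<bar>\<gamma> * q s * (2 * pi * sin (2 * pi * s))\<bar> \<le> (\<epsilon> * \<delta>) * 8"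
      unfolding abs_mult[of "\<gamma> * q s"] using \<open>\<bar>\<gamma> * q s\<bar> \<le> \<epsilon> * \<delta>\<close> \<epsilon> \<delta>_pos by (intro mult_mono) auto
    have "\<epsilon> * \<delta> \<le> (1/320) * \<delta>" using \<epsilon> \<delta>_pos by (intro mult_right_mono) auto
    then show ?thesis unfolding ddP_def using m a[THEN abs_le_D2] b[THEN abs_le_D1] \<delta>_pos by linarith
  qed
  have sin6: "sin (2 * pi * (1/6)) \<ge> \<epsilon>" "sin (2 * pi * (-(1/6))) \<le> - \<epsilon>"
  proof -
    have "sin (2 * pi * (1/6)) = sqrt 3 / 2" using sin_60 by (simp add: field_simps)
    moreover have "1 \<le> sqrt 3" by simp
    ultimately show "sin (2 * pi * (1/6)) \<ge> \<epsilon>" using \<epsilon> by linarith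
    then show "sin (2 * pi * (-(1/6))) \<le> - \<epsilon>" by simp
  qed
  obtain m where m: "\<bar>m\<bar> \<le> 1/6" "dP m = 0"
  proof -
    have "continuous_on {-(1/6)..1/6} dP"
      by (intro continuous_at_imp_continuous_on ballI DERIV_isCont[OF dP_deriv]) (auto simp: abs_if)
    then obtain m where "-(1/6) \<le> m" "m \<le> 1/6" "dP m = 0"
      using IVT'[of dP "-(1/6)" 0 "1/6"] dP_pos[OF sin6(1)] dP_neg[OF sin6(2)] by auto
    then show thesis by (intro that[of m]) auto
  qed
  have dP_mono: "dP s \<le> dP t" if "-(1/6) \<le> s" "s \<le> t" "t \<le> 1/6" for s t
  proof (rule DERIV_nonneg_imp_nondecreasing[OF that(2)])
    fix r assume "s \<le> r" "r \<le> t"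
    then have "\<bar>r\<bar> \<le> 1/6" "\<bar>r\<bar> \<le> 1/2" using that by auto
    then show "\<exists>y. (dP has_real_derivative y) (at r) \<and> 0 \<le> y"
      using dP_deriv ddP_pos less_imp_le by blast
  qed
  have sin_m: "\<bar>sin (2 * pi * m) / (2 * pi)\<bar> \<le> \<gamma> * C / \<delta> / 2"
  proof -
    have "\<bar>2 * pi * sin (2 * pi * m)\<bar> \<le> \<gamma> * C / \<delta>"
    proof -
      have "2 * pi * sin (2 * pi * m) = - (\<gamma> * q m * cos (2 * pi * m)) / \<delta>"
        using m(2) \<delta>_pos unfolding dP_def by (simp add: field_simps)
      moreover have "\<bar>\<gamma> * q m * cos (2 * pi * m)\<bar> / \<delta> \<le> \<gamma> * C / \<delta>"
        using qc[of m] m(1) \<delta>_pos by (intro divide_right_mono) auto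
      ultimately show ?thesis using \<delta>_pos by simp
    qed
    then have "(2 * pi) * \<bar>sin (2 * pi * m)\<bar> \<le> \<gamma> * C / \<delta>" by (simp add: abs_mult)
    moreover have "6 * \<bar>sin (2 * pi * m)\<bar> \<le> (2 * pi) * \<bar>sin (2 * pi * m)\<bar>"
      using pi3 by (intro mult_right_mono) auto
    ultimately have "6 * \<bar>sin (2 * pi * m)\<bar> \<le> \<gamma> * C / \<delta>" by (rule order_trans[rotated])
    moreover have "\<bar>sin (2 * pi * m) / (2 * pi)\<bar> \<le> \<bar>sin (2 * pi * m)\<bar> / 1"
      unfolding abs_divide using pi3 by (intro divide_left_mono) auto
    moreover have "u \<le> A / 2" if "6 * z \<le> A" "u \<le> z / 1" "0 \<le> z" for u z A :: real
      using that by linarith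
    ultimately show ?thesis using abs_ge_zero by blast
  qed
  have sin_m': "\<bar>sin (2 * pi * m) / (2 * pi)\<bar> + \<gamma> / 2 \<le> \<epsilon>"
  proof -
    have "0 \<le> \<gamma> * C / \<delta>" using \<gamma> C \<delta>_pos by simp
    moreover have "u + \<gamma> / 2 \<le> \<epsilon>" if "u \<le> w / 2" "\<epsilon> = \<gamma> + w" "0 \<le> w" for u w :: real
      using that \<gamma> by linarith
    ultimately show ?thesis using sin_m \<epsilon>_sum by blast
  qed
  have pi_half: "2 * pi * (1/2) = pi" "2 * pi * (- (1/2)) = - pi" by auto
  \<comment> \<open>The negated antiderivative of the compensator slope, normalised to vanish at the lowest point.\<close>
  define S where "S s = compensator \<gamma> m - compensator \<gamma> s" for s
  define c where "c = h v\<^sub>1"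
  \<comment> \<open>The exactly averaged variable, divided by \<open>- \<gamma>\<close>; \<open>F\<close> is its integration by parts.\<close>
  define E where "E s = - (x s - \<gamma> * compensator \<gamma> s * (y s - c)) / \<gamma>" for s
  define F where "F s = (h (P s) - c) * S s + E s" for s
  have E_deriv: "(E has_real_derivative (h (P s) - c) * compensator_slope \<gamma> s) (at s)" if "\<bar>s\<bar> \<le> 1/2" for s
  proof -
    have "((\<lambda>s. - (x s - \<gamma> * compensator \<gamma> s * (y s - c))) has_real_derivative - (\<gamma> * (h (P s) - y s) * cos (2 * pi * s)
        - (\<gamma> * compensator_slope \<gamma> s * (y s - c) + \<gamma> * compensator \<gamma> s * (\<gamma> * (h (P s) - y s))))) (at s)"
      by (rule derivative_eq_intros dx[OF that] dy[OF that] compensator_deriv refl | simp)+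
    moreover have "- (\<gamma> * (h (P s) - y s) * cos (2 * pi * s)
        - (\<gamma> * compensator_slope \<gamma> s * (y s - c) + \<gamma> * compensator \<gamma> s * (\<gamma> * (h (P s) - y s))))
        = \<gamma> * ((h (P s) - c) * compensator_slope \<gamma> s)"
      using compensator_slope_eq[of \<gamma> s] by algebra
    ultimately have "((\<lambda>s. - (x s - \<gamma> * compensator \<gamma> s * (y s - c)) / \<gamma>) has_real_derivative
        \<gamma> * ((h (P s) - c) * compensator_slope \<gamma> s) / \<gamma>) (at s)"
      by (metis DERIV_cdivide)
    then show ?thesis using \<gamma> by (simp add: E_def[abs_def])
  qed
  have F_deriv: "(F has_real_derivative dh (P s) * dP s * S s) (at s)" if "\<bar>s\<bar> \<le> 1/2" for s
  proof -
    have "(F has_real_derivative dh (P s) * dP s * S s + (0 - compensator_slope \<gamma> s) * (h (P s) - c)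
        + (h (P s) - c) * compensator_slope \<gamma> s) (at s)"
      unfolding F_def[abs_def] S_def[abs_def]
      by (intro DERIV_add DERIV_mult DERIV_diff[OF DERIV_const compensator_deriv] E_deriv[OF that])
         (auto intro!: derivative_eq_intros DERIV_chain2[OF deriv P_deriv[OF that]])
    then show ?thesis by (simp add: algebra_simps)
  qed
  have \<nu>\<delta>: "\<nu> * \<delta> \<le> \<delta> / 8" "0 < \<nu> * \<delta>" "\<epsilon> * \<delta> \<le> \<nu> * \<delta> / 40"
    using \<nu> \<epsilon> \<delta>_pos mult_right_mono[of \<nu> "1/8" \<delta>] mult_right_mono[of \<epsilon> "\<nu>/40" \<delta>] by auto
  have P_low: "P (1/6) \<le> v\<^sub>1" "P (-(1/6)) \<le> v\<^sub>1"
  proof -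
    have "2 * pi * (1/6) = pi / 3" "2 * pi * (-(1/6)) = - (pi / 3)" by auto
    then have c6: "cos (2 * pi * (1/6)) = 1/2" "cos (2 * pi * (-(1/6))) = 1/2"
      using cos_60 by (simp_all only: cos_minus)
    have a6: "\<bar>1/6 :: real\<bar> \<le> 1/2" "\<bar>-(1/6) :: real\<bar> \<le> 1/2" by auto
    show "P (1/6) \<le> v\<^sub>1"
      unfolding P_def v\<^sub>1_def c6 using x_near'(2)[OF a6(1)] \<nu>\<delta> by linarith
    show "P (-(1/6)) \<le> v\<^sub>1"
      unfolding P_def v\<^sub>1_def c6 using x_near'(2)[OF a6(2)] \<nu>\<delta> by linarith
  qed
  have P_high: "v\<^sub>1 \<le> P (1/2)" "v\<^sub>1 \<le> P (-(1/2))"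
  proof -
    have a2: "\<bar>1/2 :: real\<bar> \<le> 1/2" by simp
    show "v\<^sub>1 \<le> P (1/2)"
      unfolding P_def v\<^sub>1_def pi_half cos_pi using x_near'(1)[OF a2] \<nu>\<delta> by linarith
    show "v\<^sub>1 \<le> P (-(1/2))"
      unfolding P_def v\<^sub>1_def pi_half cos_minus cos_pi using \<nu>\<delta> by linarith
  qed
  obtain s1 where s1: "1/6 \<le> s1" "s1 \<le> 1/2" "P s1 = v\<^sub>1" "\<And>t. s1 < t \<Longrightarrow> t \<le> 1/2 \<Longrightarrow> v\<^sub>1 < P t"
    using last_crossing[OF _ P_cont P_low(1) P_high(1)] by auto
  obtain s2 where s2: "-(1/2) \<le> s2" "s2 \<le> -(1/6)" "P s2 = v\<^sub>1" "\<And>t. -(1/2) \<le> t \<Longrightarrow> t < s2 \<Longrightarrow> v\<^sub>1 < P t"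
    using first_crossing[OF _ P_cont P_high(2) P_low(2)] by auto
  have v1_eq: "(v\<^sub>1 - e) / \<delta> = D + 1 - \<nu>"
    unfolding v\<^sub>1_def D_def using \<delta>_pos by (simp add: field_simps)
  have "F m \<le> F s1"
  proof (rule half_period_comparison[OF s1(1,2) m(1) \<nu> \<epsilon>(1,2) D _ _ P_deriv \<sigma>_near \<sigma>'_near])
    show "\<bar>\<gamma>\<bar> \<le> \<epsilon>" using \<gamma> \<gamma>\<epsilon> by simp
    show "\<bar>sin (2 * pi * m) / (2 * pi)\<bar> + \<bar>\<gamma>\<bar> / 2 \<le> \<epsilon>" using sin_m' \<gamma> by simp
    show "0 \<le> dP s" if "m \<le> s" "s \<le> 1/6" for s using dP_mono[of m s] m that by auto
  qed (use s1 v1_eq F_deriv in \<open>auto simp: S_def\<close>)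
  \<comment> \<open>The descending half, run backwards.\<close>
  moreover have "(\<lambda>s. - F (- s)) (- m) \<le> (\<lambda>s. - F (- s)) (- s2)"
  proof (rule half_period_comparison[where F = "\<lambda>s. - F (- s)" and m = "- m" and b = "- s2" and P = "\<lambda>s. P (- s)" and dP = "\<lambda>s. - dP (- s)" and \<epsilon> = \<epsilon> and \<nu> = \<nu> and D = D
        and g = "- \<gamma>"])
    fix s :: real assume s: "\<bar>s\<bar> \<le> 1/2"
    then have s': "\<bar>- s\<bar> \<le> 1/2" by simp
    have neg: "(uminus has_real_derivative - 1) (at s)" by (auto intro!: derivative_eq_intros)
    show "((\<lambda>s. P (- s)) has_real_derivative - dP (- s)) (at s)"
      using DERIV_chain2[OF P_deriv[OF s'] neg] by simp
    show "\<bar>(P (- s) - e) / \<delta> - (D - cos (2 * pi * s))\<bar> \<le> \<epsilon>" using \<sigma>_near[OF s'] by simp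
    show "\<bar>- dP (- s) / \<delta> - 2 * pi * sin (2 * pi * s)\<bar> \<le> \<epsilon>" using \<sigma>'_near[OF s'] by (simp add: abs_minus_commute abs_le_iff)
    show "((\<lambda>s. - F (- s)) has_real_derivative
        dh (P (- s)) * - dP (- s) * (compensator (- \<gamma>) (- m) - compensator (- \<gamma>) s)) (at s)"
      using DERIV_minus[OF DERIV_chain2[OF F_deriv[OF s'] neg]]
      by (simp add: S_def compensator_minus algebra_simps)
  next
    show "0 \<le> - dP (- s)" if "- m \<le> s" "s \<le> 1/6" for s using dP_mono[of "- s" m] m that by auto
    show "\<bar>sin (2 * pi * - m) / (2 * pi)\<bar> + \<bar>- \<gamma>\<bar> / 2 \<le> \<epsilon>" using sin_m' \<gamma> by simp
  qed (use s2 m \<nu> \<epsilon> D \<gamma> \<gamma>\<epsilon> v1_eq in auto)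
  moreover have "F s1 = E s1" "F s2 = E s2" unfolding F_def c_def using s1 s2 by auto
  ultimately have mid: "E s2 \<le> E s1" by simp
  have top: "1/2 \<le> compensator_slope \<gamma> s" if "\<bar>s\<bar> \<le> 1/2" "v\<^sub>1 \<le> P s" for s
  proof -
    have "(v\<^sub>1 - e) / \<delta> \<le> (P s - e) / \<delta>" using that \<delta>_pos by (intro divide_right_mono) auto
    then have "cos (2 * pi * s) \<le> - 1 + \<nu> + \<epsilon>" using \<sigma>_near[OF that(1)] v1_eq unfolding abs_le_iff by linarith
    then show ?thesis using compensator_slope_near[OF \<gamma>1(1), of s] \<epsilon> \<nu> \<gamma>\<epsilon> \<gamma> unfolding abs_le_iff by linarith
  qed
  have v1_xs: "xs \<le> v\<^sub>1" unfolding v\<^sub>1_def using start xs_less by linarith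
  have E_mono: "E s \<le> E t" if "-(1/2) \<le> s" "s \<le> t" "t \<le> 1/2" "\<And>r. s < r \<Longrightarrow> r < t \<Longrightarrow> v\<^sub>1 < P r" for s t
  proof (rule DERIV_nonneg_imp_increasing_open[OF that(2)])
    fix r assume r: "s < r" "r < t"
    then have "\<bar>r\<bar> \<le> 1/2" using that by auto
    moreover have "0 \<le> (h (P r) - c) * compensator_slope \<gamma> r"
      using top[OF \<open>\<bar>r\<bar> \<le> 1/2\<close>] h_mono[OF v1_xs, of "P r"] that(4)[OF r] unfolding c_def by auto
    ultimately show "\<exists>y. (E has_real_derivative y) (at r) \<and> 0 \<le> y" using E_deriv by blast
  next
    show "continuous_on {s..t} E"
      using that by (intro continuous_at_imp_continuous_on ballI DERIV_isCont[OF E_deriv]) (auto simp: abs_if)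
  qed
  \<comment> \<open>On the initial piece of relative length \<open>\<nu> / 20\<close> the probe stays above \<open>v\<^sub>1\<close> by half of the cut.\<close>
  define l where "l = -(1/2) + \<nu>/20"
  have P_top: "v\<^sub>1 + \<nu> * \<delta> / 2 \<le> P s" if "-(1/2) \<le> s" "s \<le> l" for s
  proof -
    have s: "\<bar>s\<bar> \<le> 1/2" using that \<nu> unfolding l_def by auto
    have "cos (2 * pi * s) = - cos (2 * pi * (s + 1/2))" by (simp add: distrib_left)
    moreover have "1 - \<nu>/4 \<le> cos (2 * pi * (s + 1/2))"
    proof -
      have "\<bar>2 * pi * (s + 1/2)\<bar> \<le> 8 * (\<nu>/20)"
        unfolding abs_mult using that pi3 \<nu> by (intro mult_mono) (auto simp: l_def)
      then have "\<bar>2 * pi * (s + 1/2)\<bar>\<^sup>2 \<le> (8 * (\<nu>/20))\<^sup>2" by (intro power_mono) auto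
      also have "\<dots> = (4/25 * \<nu>) * \<nu>" by (simp add: power2_eq_square)
      also have "\<dots> \<le> (4/25 * (1/8)) * \<nu>" using \<nu> by (intro mult_right_mono) auto
      also have "\<dots> \<le> \<nu>/2" using \<nu> by simp
      finally show ?thesis using cos_ge_parabola[of "2 * pi * (s + 1/2)"] by simp
    qed
    ultimately have "\<delta> * cos (2 * pi * s) \<le> \<delta> * (- 1 + \<nu>/4)" using \<delta>_pos by (intro mult_left_mono) auto
    then have "\<delta> * cos (2 * pi * s) \<le> - \<delta> + \<nu> * \<delta> / 4" by (simp add: algebra_simps)
    then show ?thesis unfolding v\<^sub>1_def P_def using x_near'(1)[OF s] \<nu>\<delta> by linarith
  qed
  have l_s2: "l \<le> s2"
  proof (rule ccontr)
    assume "\<not> l \<le> s2"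
    then have "v\<^sub>1 + \<nu> * \<delta> / 2 \<le> P s2" using s2 by (intro P_top) auto
    then show False using s2(3) \<nu>\<delta> by linarith
  qed
  let ?gain = "h (v\<^sub>1 + \<nu> * \<delta> / 2) - h v\<^sub>1"
  have "E (-(1/2)) - (?gain / 2) * (-(1/2)) \<le> E l - (?gain / 2) * l"
  proof (rule DERIV_nonneg_imp_nondecreasing[where f = "\<lambda>s. E s - (?gain / 2) * s"])
    show "-(1/2) \<le> l" unfolding l_def using \<nu> by simp
    fix s assume s: "-(1/2) \<le> s" "s \<le> l"
    then have s': "\<bar>s\<bar> \<le> 1/2" using \<nu> unfolding l_def by auto
    have "?gain \<le> h (P s) - c" unfolding c_def using P_top[OF s] v1_xs \<nu>\<delta> h_mono by auto
    moreover have "0 \<le> ?gain" using h_mono[OF v1_xs] \<nu>\<delta> by auto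
    moreover have "1/2 \<le> compensator_slope \<gamma> s" using top[OF s'] P_top[OF s] \<nu>\<delta> by linarith
    ultimately have "?gain * (1/2) \<le> (h (P s) - c) * compensator_slope \<gamma> s" by (intro mult_mono) auto
    moreover have "((\<lambda>s. E s - (?gain / 2) * s) has_real_derivative (h (P s) - c) * compensator_slope \<gamma> s - ?gain / 2) (at s)"
      by (rule derivative_eq_intros E_deriv[OF s'] refl | simp)+
    ultimately show "\<exists>y. ((\<lambda>s. E s - (?gain / 2) * s) has_real_derivative y) (at s) \<and> 0 \<le> y"
      by (intro exI conjI) auto
  qed
  moreover have "a + \<nu> / 40 * g \<le> b" if "a - (g / 2) * (-(1/2)) \<le> b - (g / 2) * l" for a b g
    using that unfolding l_def by (simp add: field_simps)
  ultimately have "E (-(1/2)) + \<nu> / 40 * ?gain \<le> E l" by blast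
  also have "E l \<le> E s2" using l_s2 s2 \<nu> by (intro E_mono) (auto simp: l_def)
  also have "E s2 \<le> E s1" by (rule mid)
  also have "E s1 \<le> E (1/2)" using s1 by (intro E_mono) auto
  finally have "E (-(1/2)) + \<nu> / 40 * ?gain \<le> E (1/2)" .
  then have "\<gamma> * (E (-(1/2)) + \<nu> / 40 * ?gain) \<le> \<gamma> * E (1/2)" using \<gamma> by (intro mult_left_mono) auto
  moreover have "\<gamma> * E s = - x s + \<gamma> * compensator \<gamma> s * (y s - c)" for s unfolding E_def using \<gamma> by simp
  moreover have "compensator \<gamma> (-(1/2)) = compensator \<gamma> (1/2)" unfolding compensator_def pi_half by simp
  ultimately show ?thesis by (simp add: algebra_simps)
qed

end

section \<open>Bounds that depend on the Lipschitz constant only\<close>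

text \<open>A bound for \<open>\<bar>y - h x\<bar>\<close>. Twice the sum of it and the oscillation \<open>L \<delta>\<close> of \<open>h\<close> along the probe
  then bounds \<open>\<bar>h (x + \<delta> u) - y\<bar>\<close>, which is the speed of \<open>x\<close> and \<open>y\<close> per unit gain.\<close>

definition lag_bound :: "real \<Rightarrow> real \<Rightarrow> real" where
  "lag_bound L \<delta> = 2 + 5 * (L * \<delta>) + 8 * L * (L * \<delta>)"

definition rate_bound :: "real \<Rightarrow> real \<Rightarrow> real" where
  "rate_bound L \<delta> = 2 * (L * \<delta> + lag_bound L \<delta>)"

text \<open>The radius \<open>\<rho>\<close> is half the accuracy to which \<open>x\<close> is to be steered. The condition \<open>gain\<close> makes the motion of
  \<open>x\<close> and of \<open>h x\<close> during one dither period a small fraction of it.\<close>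

locale es_system = unimodal_cost +
  fixes \<delta> \<gamma> \<rho> :: real and x y :: "real \<Rightarrow> real"
  assumes \<delta>: "0 < \<delta>" and \<gamma>: "0 < \<gamma>" and \<rho>: "0 < \<rho>" "\<rho> \<le> 1/8" "\<rho> \<le> \<delta> / 8"
    and gain: "\<gamma> * (1 + L) * (\<delta> + rate_bound L \<delta>) \<le> \<rho> / 40"
    and x_cont: "continuous_on {0..} x" and y_cont: "continuous_on {0..} y"
    and dx: "\<And>t. 0 < t \<Longrightarrow> (x has_real_derivative
      - \<gamma> * (h (x t + \<delta> * sin (2 * pi * t)) - y t) * sin (2 * pi * t)) (at t)"
    and dy: "\<And>t. 0 < t \<Longrightarrow> (y has_real_derivative \<gamma> * (h (x t + \<delta> * sin (2 * pi * t)) - y t)) (at t)"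

context es_system
begin

abbreviation "lag \<equiv> lag_bound L \<delta>"

abbreviation "rate \<equiv> rate_bound L \<delta>"

definition "q t = h (x t + \<delta> * sin (2 * pi * t)) - y t"

lemma bounds_nonneg: "0 \<le> L * \<delta>" "0 \<le> L * (L * \<delta>)" "2 \<le> lag" "4 \<le> rate"
  using L_nonneg \<delta> unfolding lag_bound_def rate_bound_def by auto

lemma gain_expanded: 
  "\<gamma> * \<delta> + \<gamma> * rate + \<gamma> * L * \<delta> + \<gamma> * L * rate \<le> \<rho> / 40"
  "0 \<le> \<gamma> * \<delta>" "0 \<le> \<gamma> * rate" "0 \<le> \<gamma> * L * \<delta>" "0 \<le> \<gamma> * L * rate"
  using gain bounds_nonneg \<gamma> \<delta> L_nonneg by (auto simp: algebra_simps)

lemma small_gain: "\<gamma> * rate \<le> \<rho> / 40" "\<gamma> * L * rate \<le> \<rho> / 40" "\<gamma> * \<delta> \<le> \<rho> / 40" "\<gamma> * rate \<le> \<delta>"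
   "4 * \<gamma> \<le> \<rho> / 40" "4 * (\<gamma> * L) \<le> \<rho> / 40" "\<gamma> \<le> 1" "\<gamma> * (1 + L) \<le> 1/2" "0 \<le> \<gamma> * L"
proof -
  show a: "\<gamma> * rate \<le> \<rho> / 40" "\<gamma> * L * rate \<le> \<rho> / 40" "\<gamma> * \<delta> \<le> \<rho> / 40" using gain_expanded by linarith+
  show g: "0 \<le> \<gamma> * L" using \<gamma> L_nonneg by simp
  show "4 * \<gamma> \<le> \<rho> / 40" using mult_left_mono[OF bounds_nonneg(4), of \<gamma>] \<gamma> a(1) by linarith
  then show "\<gamma> \<le> 1" using \<rho> \<gamma> by linarith
  show "4 * (\<gamma> * L) \<le> \<rho> / 40" using mult_left_mono[OF bounds_nonneg(4) g] a(2) by linarith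
  then show "\<gamma> * (1 + L) \<le> 1/2" using \<rho> \<open>4 * \<gamma> \<le> \<rho> / 40\<close> by (simp add: distrib_left)
  show "\<gamma> * rate \<le> \<delta>" using a(1) \<rho> \<delta> by linarith
qed

lemma cont_on: assumes "0 \<le> a" shows "continuous_on {a..b} x" "continuous_on {a..b} y" "continuous_on {a..b} q"
proof -
  show x: "continuous_on {a..b} x" and y: "continuous_on {a..b} y"
    using assms by (auto intro: continuous_on_subset[OF x_cont] continuous_on_subset[OF y_cont])
  show "continuous_on {a..b} q"
    unfolding q_def by (intro continuous_intros x y continuous_on_compose2[OF h_cont[of UNIV]]) auto
qed

lemma displacement:
  assumes "0 \<le> a" "a \<le> b" and M: "\<And>t. a < t \<Longrightarrow> t < b \<Longrightarrow> \<bar>q t\<bar> \<le> M"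
  shows "\<bar>x b - x a\<bar> \<le> \<gamma> * M * (b - a)" "\<bar>y b - y a\<bar> \<le> \<gamma> * M * (b - a)"
proof -
  show "\<bar>x b - x a\<bar> \<le> \<gamma> * M * (b - a)"
  proof (rule increment_bound[OF assms(2) cont_on(1)[OF assms(1)]])
    fix t assume t: "a < t" "t < b"
    have "\<bar>q t * sin (2 * pi * t)\<bar> \<le> M * 1" unfolding abs_mult using M[OF t] by (intro mult_mono) auto
    then have "\<bar>- \<gamma> * q t * sin (2 * pi * t)\<bar> \<le> \<gamma> * M" using \<gamma> by (simp add: abs_mult)
    then show "\<exists>D. (x has_real_derivative D) (at t) \<and> \<bar>D\<bar> \<le> \<gamma> * M"
      using dx[of t] assms t unfolding q_def by force
  qed
  show "\<bar>y b - y a\<bar> \<le> \<gamma> * M * (b - a)"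
  proof (rule increment_bound[OF assms(2) cont_on(2)[OF assms(1)]])
    fix t assume t: "a < t" "t < b"
    have "\<bar>\<gamma> * q t\<bar> \<le> \<gamma> * M" using \<gamma> M[OF t] by (simp add: abs_mult)
    then show "\<exists>D. (y has_real_derivative D) (at t) \<and> \<bar>D\<bar> \<le> \<gamma> * M"
      using dy[of t] assms t unfolding q_def by force
  qed
qed

lemma probe_near: "\<bar>h (x t + \<delta> * sin (2 * pi * t)) - h v\<bar> \<le> L * (\<bar>x t - v\<bar> + \<delta>)"
proof -
  have "\<bar>x t + \<delta> * sin (2 * pi * t) - v\<bar> \<le> \<bar>x t - v\<bar> + \<delta>"
    using probe_le[OF \<delta>, of "2 * pi * t"] by linarith
  then have "L * \<bar>x t + \<delta> * sin (2 * pi * t) - v\<bar> \<le> L * (\<bar>x t - v\<bar> + \<delta>)"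
    using L_nonneg by (rule mult_left_mono)
  then show ?thesis using lip[of "x t + \<delta> * sin (2 * pi * t)" v] by linarith
qed

text \<open>During one period \<open>x\<close> and \<open>y\<close> move by at most \<open>\<gamma>\<close> times the maximum of \<open>\<bar>q\<bar>\<close>. This feeds back into
  \<open>q\<close> with the factor \<open>\<gamma> (1 + L) \<le> 1/2\<close> and is absorbed.\<close>

lemma q_period:
  assumes a: "0 \<le> a" and t: "a \<le> t" "t \<le> a + 1"
  shows "\<bar>q t\<bar> \<le> 2 * (L * \<delta> + \<bar>y a - h (x a)\<bar>)"
proof -
  have "continuous_on {a..a + 1} (\<lambda>t. \<bar>q t\<bar>)" by (intro continuous_intros cont_on a)
  then obtain s where s: "a \<le> s" "s \<le> a + 1" "\<And>r. a \<le> r \<Longrightarrow> r \<le> a + 1 \<Longrightarrow> \<bar>q r\<bar> \<le> \<bar>q s\<bar>"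
    using continuous_attains_sup[of "{a..a + 1}" "\<lambda>t. \<bar>q t\<bar>"] by auto
  let ?M = "\<bar>q s\<bar>"
  have "\<bar>x s - x a\<bar> \<le> \<gamma> * ?M * (s - a)" "\<bar>y s - y a\<bar> \<le> \<gamma> * ?M * (s - a)"
    using s by (intro displacement a; auto)+
  moreover have "\<gamma> * ?M * (s - a) \<le> \<gamma> * ?M * 1" using s \<gamma> by (intro mult_left_mono) auto
  ultimately have m: "\<bar>x s - x a\<bar> \<le> \<gamma> * ?M" "\<bar>y s - y a\<bar> \<le> \<gamma> * ?M" by auto
  have "\<bar>q s\<bar> \<le> \<bar>h (x s + \<delta> * sin (2 * pi * s)) - h (x a)\<bar> + \<bar>y a - h (x a)\<bar> + \<bar>y s - y a\<bar>"
    unfolding q_def by linarith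
  also have "\<dots> \<le> L * (\<gamma> * ?M + \<delta>) + \<bar>y a - h (x a)\<bar> + \<gamma> * ?M"
  proof -
    have "L * (\<bar>x s - x a\<bar> + \<delta>) \<le> L * (\<gamma> * ?M + \<delta>)" using m L_nonneg by (intro mult_left_mono) auto
    then show ?thesis using probe_near[of s "x a"] m by linarith
  qed
  also have "\<dots> = L * \<delta> + \<bar>y a - h (x a)\<bar> + (\<gamma> * (1 + L)) * ?M" by (simp add: algebra_simps)
  also have "\<dots> \<le> L * \<delta> + \<bar>y a - h (x a)\<bar> + (1/2) * ?M"
    using small_gain(8) by (intro add_left_mono mult_right_mono) auto
  finally have "?M \<le> 2 * (L * \<delta> + \<bar>y a - h (x a)\<bar>)" by (simp add: field_simps)
  with s(3)[OF t] show ?thesis by (rule order_trans)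
qed

text \<open>The choice \<open>Q' = \<gamma> Q + u\<close> is what cancels \<open>y\<close>; there is no remainder. The constant \<open>c\<close> is free
  because \<open>Q'\<close> has mean zero.\<close>

lemma exact_averaging:
  assumes "0 < t"
  shows "((\<lambda>t. x t - \<gamma> * compensator \<gamma> (t - 3/4) * (y t - c)) has_real_derivative
    - \<gamma> * (h (x t + \<delta> * sin (2 * pi * t)) - c) * compensator_slope \<gamma> (t - 3/4)) (at t)"
proof -
  have Q: "((\<lambda>t. compensator \<gamma> (t - 3/4)) has_real_derivative compensator_slope \<gamma> (t - 3/4)) (at t)"
  proof -
    have "((\<lambda>t. t - 3/4) has_real_derivative 1) (at t)" by (auto intro!: derivative_eq_intros)
    from DERIV_chain2[OF compensator_deriv this] show ?thesis by simp
  qed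
  let ?q = "h (x t + \<delta> * sin (2 * pi * t)) - y t"
  have "((\<lambda>t. x t - \<gamma> * compensator \<gamma> (t - 3/4) * (y t - c)) has_real_derivative
      - \<gamma> * ?q * sin (2 * pi * t) - (\<gamma> * compensator_slope \<gamma> (t - 3/4) * (y t - c) + \<gamma> * compensator \<gamma> (t - 3/4) * (\<gamma> * ?q))) (at t)"
    by (rule derivative_eq_intros Q dx[OF assms] dy[OF assms] refl | simp)+
  moreover have "compensator_slope \<gamma> (t - 3/4) = sin (2 * pi * t) + \<gamma> * compensator \<gamma> (t - 3/4)"
    using compensator_slope_eq[of \<gamma> "t - 3/4"] shifted_dither by simp
  then have "- \<gamma> * ?q * sin (2 * pi * t) - (\<gamma> * compensator_slope \<gamma> (t - 3/4) * (y t - c) + \<gamma> * compensator \<gamma> (t - 3/4) * (\<gamma> * ?q))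
      = - \<gamma> * (h (x t + \<delta> * sin (2 * pi * t)) - c) * compensator_slope \<gamma> (t - 3/4)" by algebra
  ultimately show ?thesis by simp
qed

text \<open>The derivative of \<open>y - h x\<close> contains the damping \<open>\<gamma> (1 + h' u)\<close>, which is negative at times if
  \<open>L > 1\<close>, so the bound can only be propagated over full periods. The filter recovers at least a fraction
  \<open>\<gamma> / 2\<close> of the excess over \<open>2 L \<delta>\<close>, while by \<open>exact_averaging\<close> with \<open>c = h (x a)\<close> the net motion of
  \<open>x\<close> is of order \<open>\<gamma> L \<delta>\<close>; \<open>lag_bound\<close> is chosen so that the first outweighs the second.\<close>

lemma lag_step:
  assumes a: "0 \<le> a" and lag: "\<bar>y a - h (x a)\<bar> \<le> lag"
  shows "\<bar>y (a + 1) - h (x (a + 1))\<bar> \<le> lag"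
proof -
  have q: "\<bar>q t\<bar> \<le> rate" if "a \<le> t" "t \<le> a + 1" for t
  proof -
    have "2 * (L * \<delta> + \<bar>y a - h (x a)\<bar>) \<le> rate" unfolding rate_bound_def using lag by simp
    with q_period[OF a that] show ?thesis by (rule order_trans)
  qed
  have near: "\<bar>h (x t + \<delta> * sin (2 * pi * t)) - h (x a)\<bar> \<le> 2 * (L * \<delta>)" if t: "a \<le> t" "t \<le> a + 1" for t
  proof -
    have "\<bar>x t - x a\<bar> \<le> \<gamma> * rate * (t - a)" using t q by (intro displacement a) auto
    also have "\<dots> \<le> \<gamma> * rate * 1" using t gain_expanded by (intro mult_left_mono) auto
    finally have "L * (\<bar>x t - x a\<bar> + \<delta>) \<le> L * (2 * \<delta>)"
      using small_gain(4) L_nonneg by (intro mult_left_mono) auto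
    then show ?thesis using probe_near[of t "x a"] by simp
  qed
  have dy1: "\<bar>y (a + 1) - y a\<bar> \<le> \<gamma> * rate" using displacement(2)[OF a, of "a + 1" rate] q by auto
  define c where "c = h (x a)"
  define X where "X t = x t - \<gamma> * compensator \<gamma> (t - 3/4) * (y t - c)" for t
  have "\<bar>X (a + 1) - X a\<bar> \<le> \<gamma> * (4 * (L * \<delta>)) * (a + 1 - a)"
  proof (rule increment_bound)
    have "continuous_on {a..a + 1} (\<lambda>t. compensator \<gamma> (t - 3/4))"
      unfolding compensator_def using compensator_denominator[of \<gamma>] by (intro continuous_intros) auto
    then show "continuous_on {a..a + 1} X"
      unfolding X_def by (intro continuous_intros cont_on a)
    fix t assume t: "a < t" "t < a + 1"
    have "\<bar>h (x t + \<delta> * sin (2 * pi * t)) - c\<bar> * \<bar>compensator_slope \<gamma> (t - 3/4)\<bar> \<le> (2 * (L * \<delta>)) * 2"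
      unfolding c_def using near[of t] compensator_slope_le[of \<gamma>] small_gain(7) \<gamma> t bounds_nonneg by (intro mult_mono) auto
    then have "\<gamma> * (\<bar>h (x t + \<delta> * sin (2 * pi * t)) - c\<bar> * \<bar>compensator_slope \<gamma> (t - 3/4)\<bar>) \<le> \<gamma> * (4 * (L * \<delta>))"
      using \<gamma> by (intro mult_left_mono) auto
    then have "\<bar>- \<gamma> * (h (x t + \<delta> * sin (2 * pi * t)) - c) * compensator_slope \<gamma> (t - 3/4)\<bar> \<le> \<gamma> * (4 * (L * \<delta>))"
      using \<gamma> by (simp add: abs_mult mult.assoc)
    then show "\<exists>D. (X has_real_derivative D) (at t) \<and> \<bar>D\<bar> \<le> \<gamma> * (4 * (L * \<delta>))"
      using exact_averaging[of t c] a t unfolding X_def[abs_def] by (meson le_less_trans)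
  qed simp
  moreover have "x (a + 1) - x a = X (a + 1) - X a + \<gamma> * compensator \<gamma> (a - 3/4) * (y (a + 1) - y a)"
    using compensator_periodic[of \<gamma> "a - 3/4"] unfolding X_def by (simp add: algebra_simps)
  moreover have "\<bar>\<gamma> * compensator \<gamma> (a - 3/4) * (y (a + 1) - y a)\<bar> \<le> \<gamma> * (1/2) * \<delta>"
    unfolding abs_mult using compensator_le[of \<gamma> "a - 3/4"] \<gamma> small_gain(4,7) dy1 by (intro mult_mono) auto
  ultimately have "\<bar>x (a + 1) - x a\<bar> \<le> \<gamma> * (4 * (L * \<delta>)) + \<gamma> * (1/2) * \<delta>" by simp
  then have "L * \<bar>x (a + 1) - x a\<bar> \<le> L * (\<gamma> * (4 * (L * \<delta>)) + \<gamma> * (1/2) * \<delta>)"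
    using L_nonneg by (rule mult_left_mono)
  then have hx: "\<bar>h (x (a + 1)) - h (x a)\<bar> \<le> \<gamma> * (4 * (L * (L * \<delta>)) + L * \<delta> / 2)"
    using lip[of "x (a + 1)" "x a"] by (simp add: algebra_simps)
  have "\<bar>y (a + 1) - h (x a)\<bar> \<le> 2 * (L * \<delta>) + exp (- \<gamma> * (a + 1 - a)) * (\<bar>y a - h (x a)\<bar> - 2 * (L * \<delta>))"
  proof (rule linear_filter_bound[where Y = "\<lambda>t. y t - h (x a)"
        and w = "\<lambda>t. h (x t + \<delta> * sin (2 * pi * t)) - h (x a)"])
    show "continuous_on {a..a + 1} (\<lambda>t. y t - h (x a))" by (intro continuous_intros cont_on a)
    fix t assume t: "a < t" "t < a + 1"
    then show "((\<lambda>t. y t - h (x a)) has_real_derivative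
        \<gamma> * (h (x t + \<delta> * sin (2 * pi * t)) - h (x a) - (y t - h (x a)))) (at t)"
      using dy[of t] a by (auto intro!: derivative_eq_intros)
    show "\<bar>h (x t + \<delta> * sin (2 * pi * t)) - h (x a)\<bar> \<le> 2 * (L * \<delta>)" using near t by simp
  qed (use \<gamma> in auto)
  also have "\<dots> \<le> 2 * (L * \<delta>) + exp (- \<gamma>) * (lag - 2 * (L * \<delta>))" using lag by simp
  also have "\<dots> \<le> 2 * (L * \<delta>) + (1 - \<gamma>/2) * (lag - 2 * (L * \<delta>))"
  proof -
    have "exp (- \<gamma>) \<le> 1 - \<gamma>/2"
    proof -
      have "1 \<le> (1 + \<gamma>) * (1 - \<gamma>/2)" using \<gamma> small_gain(7) mult_left_le[of \<gamma> \<gamma>] by (simp add: algebra_simps)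
      also have "\<dots> \<le> exp \<gamma> * (1 - \<gamma>/2)" using small_gain(7) by (intro mult_right_mono exp_ge_add_one_self) auto
      finally show ?thesis by (simp add: exp_minus field_simps)
    qed
    moreover have "0 \<le> lag - 2 * (L * \<delta>)" unfolding lag_bound_def using bounds_nonneg by auto
    ultimately show ?thesis by (intro add_left_mono mult_right_mono) auto
  qed
  also have "\<dots> = lag - \<gamma> * ((lag - 2 * (L * \<delta>)) / 2)" by (simp add: field_simps)
  finally have "\<bar>y (a + 1) - h (x a)\<bar> \<le> lag - \<gamma> * ((lag - 2 * (L * \<delta>)) / 2)" .
  moreover have "\<gamma> * (4 * (L * (L * \<delta>)) + L * \<delta> / 2) \<le> \<gamma> * ((lag - 2 * (L * \<delta>)) / 2)"
    using \<gamma> bounds_nonneg unfolding lag_bound_def by (intro mult_left_mono) auto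
  ultimately show ?thesis using hx by linarith
qed

lemma lag_bounded:
  assumes init: "\<bar>y 0 - h (x 0)\<bar> \<le> 1 + L * \<delta>" and "0 \<le> t"
  shows "\<bar>y t - h (x t)\<bar> \<le> lag"
proof -
  \<comment> \<open>Before a full period has passed, the small motion from the initial state is enough.\<close>
  have first: "\<bar>y t - h (x t)\<bar> \<le> lag" if t: "0 \<le> t" "t \<le> 1" for t
  proof -
    let ?M = "2 + 4 * (L * \<delta>)"
    have q: "\<bar>q s\<bar> \<le> ?M" if "0 \<le> s" "s \<le> 1" for s
      using q_period[of 0 s] that init by simp
    have M: "?M \<le> rate" unfolding rate_bound_def lag_bound_def using bounds_nonneg by auto
    have "\<bar>x t - x 0\<bar> \<le> \<gamma> * ?M * (t - 0)" "\<bar>y t - y 0\<bar> \<le> \<gamma> * ?M * (t - 0)"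
      using t q by (intro displacement; auto)+
    moreover have "\<gamma> * ?M * (t - 0) \<le> \<gamma> * rate * 1"
      using t M \<gamma> gain_expanded bounds_nonneg by (intro mult_mono) auto
    ultimately have m: "\<bar>x t - x 0\<bar> \<le> \<gamma> * rate" "\<bar>y t - y 0\<bar> \<le> \<gamma> * rate" by auto
    have "L * \<bar>x t - x 0\<bar> \<le> L * (\<gamma> * rate)" using m L_nonneg by (intro mult_left_mono) auto
    then have "\<bar>h (x t) - h (x 0)\<bar> \<le> \<gamma> * L * rate" using lip[of "x t" "x 0"] by (simp add: mult_ac)
    then have "\<bar>y t - h (x t)\<bar> \<le> 2 + L * \<delta>"
      using m init small_gain(1,2) \<rho> by linarith
    then show ?thesis unfolding lag_bound_def using bounds_nonneg by linarith
  qed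
  have "\<bar>y t - h (x t)\<bar> \<le> lag" if "real n \<le> t" "t \<le> real n + 1" for t n
    using that
  proof (induction n arbitrary: t)
    case 0 then show ?case using first by simp
  next
    case (Suc n)
    have "\<bar>y (t - 1) - h (x (t - 1))\<bar> \<le> lag" using Suc by simp
    then show ?case using lag_step[of "t - 1"] Suc.prems by simp
  qed
  from this[of "nat \<lfloor>t\<rfloor>" t] show ?thesis using \<open>0 \<le> t\<close> by (simp add: of_nat_nat)
qed

end

text \<open>The bound on \<open>y - h x\<close> is assumed for all times, instead of being derived from an initial
  condition, because only this form is invariant under the time shift in \<open>reflected\<close>.\<close>

locale settled_system = es_system +
  assumes lag_le: "\<And>t. 0 \<le> t \<Longrightarrow> \<bar>y t - h (x t)\<bar> \<le> lag"

context settled_system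
begin

lemma q_le: assumes "0 \<le> t" shows "\<bar>q t\<bar> \<le> rate"
proof -
  have "2 * (L * \<delta> + \<bar>y t - h (x t)\<bar>) \<le> rate" unfolding rate_bound_def using lag_le[OF assms] by simp
  moreover have "\<bar>q t\<bar> \<le> 2 * (L * \<delta> + \<bar>y t - h (x t)\<bar>)" using q_period[OF assms, of t] by simp
  ultimately show ?thesis by (rule order_trans[rotated])
qed

lemma x_step: assumes "0 \<le> a" "a \<le> t" "t \<le> a + 1" shows "\<bar>x t - x a\<bar> \<le> \<gamma> * rate"
proof -
  have "\<bar>x t - x a\<bar> \<le> \<gamma> * rate * (t - a)" using assms q_le by (intro displacement) auto
  also have "\<dots> \<le> \<gamma> * rate * 1" using assms gain_expanded by (intro mult_left_mono) auto
  finally show ?thesis by simp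
qed

end

section \<open>Confinement and convergence of the search variable\<close>

locale balanced_system = settled_system h dh xs L \<delta> \<gamma> \<rho> x y + balanced_cost h dh xs L \<delta> e \<Phi>
  for h dh xs L \<delta> \<gamma> \<rho> x y e \<Phi>

context balanced_system
begin

definition "sample n = x (real n + 1/4)"

definition "coupling = - \<gamma> * compensator \<gamma> (1/2)"

text \<open>At the times \<open>n + 1/4\<close> the probe is at the top of its sweep and the compensator takes a fixed
  negative value. The variable of \<open>exact_averaging\<close> is therefore \<open>x\<close> plus a small nonnegative multiple of \<open>y\<close>.\<close>

definition "slow n = sample n + coupling * y (real n + 1/4)"

lemma coupling_bounds: "0 \<le> coupling" "coupling \<le> \<gamma> / 36"
proof -
  have eq: "coupling = \<gamma>\<^sup>2 / (4 * pi\<^sup>2 + \<gamma>\<^sup>2)" unfolding coupling_def compensator_def by (simp add: power2_eq_square)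
  show "0 \<le> coupling" unfolding eq using compensator_denominator[of \<gamma>] by simp
  have "\<gamma>\<^sup>2 \<le> \<gamma>" using \<gamma> small_gain(7) by (simp add: power2_eq_square mult_left_le)
  then show "coupling \<le> \<gamma> / 36" unfolding eq using compensator_denominator[of \<gamma>] \<gamma> by (intro frac_le) auto
qed

lemma slow_drift:
  assumes start: "e + \<rho> \<le> sample n"
  defines "v \<equiv> sample n + \<delta> - \<rho>"
  shows "slow (Suc n) \<le> slow n - \<gamma> * (\<rho> / \<delta> / 40 * (h (v + \<rho> / 2) - h v))" "0 \<le> h (v + \<rho> / 2) - h v"
proof -
  define \<nu> where "\<nu> = \<rho> / \<delta>"
  define k where "k = real n + 3/4"
  have \<nu>: "0 < \<nu>" "\<nu> \<le> 1/8" "\<nu> * \<delta> = \<rho>" unfolding \<nu>_def using \<rho> \<delta> by (auto simp: field_simps)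
  have k: "0 < s + k" if "\<bar>s\<bar> \<le> 1/2" for s
    using that abs_le_D2[OF that] unfolding k_def by linarith
  have dither: "sin (2 * pi * (s + k)) = - cos (2 * pi * s)" for s
  proof -
    have "2 * pi * (s + k) = 2 * pi * (s + 3/4) + 2 * real n * pi" unfolding k_def by (simp add: algebra_simps)
    then have "sin (2 * pi * (s + k)) = sin (2 * pi * (s + 3/4))"
      by (simp only: sin_add[of _ "2 * real n * pi"] sin_2npi cos_2npi mult_zero_right mult_1_right add_0_right)
    then show ?thesis using shifted_dither[of "s + 3/4", symmetric] by simp
  qed
  have shift: "((\<lambda>s. f (s + k)) has_real_derivative D) (at s)" if "(f has_real_derivative D) (at (s + k))" for f D s
    using that DERIV_shift by blast
  have ends: "1/2 + k = real (Suc n) + 1/4" "- (1/2) + k = real n + 1/4" unfolding k_def by auto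
  have main: "x (1/2 + k) - \<gamma> * compensator \<gamma> (1/2) * y (1/2 + k)
      \<le> x (- (1/2) + k) - \<gamma> * compensator \<gamma> (- (1/2)) * y (- (1/2) + k)
         - \<gamma> * (\<nu> / 40 * (h (x (- (1/2) + k) + \<delta> - \<nu> * \<delta> + \<nu> * \<delta> / 2) - h (x (- (1/2) + k) + \<delta> - \<nu> * \<delta>)))"
  proof (rule period_drift[where C = rate and x = "\<lambda>s. x (s + k)" and y = "\<lambda>s. y (s + k)"])
    show "0 < \<gamma>" "0 < \<nu>" "\<nu> \<le> 1/8" "0 \<le> rate" using \<gamma> \<nu> bounds_nonneg by auto
    have "\<gamma> * \<delta> + \<gamma> * rate \<le> \<rho> / 40" using gain_expanded by linarith
    then have "(\<gamma> * \<delta> + \<gamma> * rate) / \<delta> \<le> \<rho> / 40 / \<delta>" using \<delta> by (intro divide_right_mono) auto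
    moreover have "(\<gamma> * \<delta> + \<gamma> * rate) / \<delta> = \<gamma> * (1 + rate / \<delta>)" using \<delta> by (simp add: field_simps)
    ultimately show "\<gamma> * (1 + rate / \<delta>) \<le> \<nu> / 40" unfolding \<nu>_def by simp
    show "\<gamma> * L \<le> 1/10" using small_gain(6) \<rho> by linarith
    show "e + \<nu> * \<delta> \<le> x (- (1/2) + k)" unfolding ends \<nu>(3) using start unfolding sample_def .
    fix s :: real assume s: "\<bar>s\<bar> \<le> 1/2"
    show "((\<lambda>s. x (s + k)) has_real_derivative
        \<gamma> * (h (x (s + k) - \<delta> * cos (2 * pi * s)) - y (s + k)) * cos (2 * pi * s)) (at s)"
      by (rule shift) (use dx[OF k[OF s]] dither[of s] \<delta> in simp)
    show "((\<lambda>s. y (s + k)) has_real_derivative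
        \<gamma> * (h (x (s + k) - \<delta> * cos (2 * pi * s)) - y (s + k))) (at s)"
      by (rule shift) (use dy[OF k[OF s]] dither[of s] in simp)
    show "\<bar>h (x (s + k) - \<delta> * cos (2 * pi * s)) - y (s + k)\<bar> \<le> rate"
      using q_le[OF less_imp_le[OF k[OF s]]] dither[of s] unfolding q_def by simp
  qed
  have Q: "compensator \<gamma> (- (1/2)) = compensator \<gamma> (1/2)" using compensator_periodic[of \<gamma> "-(1/2)"] by simp
  show "slow (Suc n) \<le> slow n - \<gamma> * (\<rho> / \<delta> / 40 * (h (v + \<rho> / 2) - h v))"
    using main \<delta> unfolding ends Q \<nu>(3) slow_def sample_def v_def coupling_def \<nu>_def by simp
  have "xs \<le> v" unfolding v_def using start xs_less by simp
  then show "0 \<le> h (v + \<rho> / 2) - h v" using h_mono[of v "v + \<rho> / 2"] \<rho> by simp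
qed

text \<open>The coupling to \<open>y\<close> cannot hide a large increase of \<open>x\<close>: \<open>y\<close> follows \<open>h x\<close> up to \<open>lag\<close>, and
  \<open>h x\<close> changes at most \<open>L\<close> times as much as \<open>x\<close>, so the coupling accounts for at most half of it.\<close>

lemma sample_le:
  assumes "slow n \<le> slow m"
  shows "sample n \<le> sample m + \<gamma> * rate"
proof (cases "sample n \<le> sample m")
  case True then show ?thesis using gain_expanded by linarith
next
  case False
  let ?yn = "y (real n + 1/4)" and ?ym = "y (real m + 1/4)"
  let ?d = "sample n - sample m"
  have "?ym - ?yn \<le> L * ?d + 2 * lag"
    using lag_le[of "real n + 1/4"] lag_le[of "real m + 1/4"] lip[of "sample m" "sample n"] False
    unfolding sample_def by simp
  then have "coupling * (?ym - ?yn) \<le> coupling * (L * ?d + 2 * lag)" using coupling_bounds by (intro mult_left_mono) auto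
  also have "\<dots> \<le> \<gamma> / 36 * (L * ?d + 2 * lag)"
    using coupling_bounds False L_nonneg bounds_nonneg by (intro mult_right_mono) auto
  also have "\<dots> = (\<gamma> * L / 36) * ?d + \<gamma> * lag / 18" by (simp add: field_simps)
  finally have "coupling * (?ym - ?yn) \<le> (\<gamma> * L / 36) * ?d + \<gamma> * lag / 18" .
  moreover have "(\<gamma> * L / 36) * ?d \<le> (1/2) * ?d"
  proof (rule mult_right_mono)
    show "\<gamma> * L / 36 \<le> 1/2" using small_gain(6) \<rho> by linarith
  qed (use False in simp)
  moreover have "?d \<le> coupling * (?ym - ?yn)" using assms unfolding slow_def by (simp add: algebra_simps)
  moreover have "d \<le> l / 9" if "c \<le> k + l / 18" "k \<le> (1/2) * d" "d \<le> c" for d c k l :: real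
    using that by linarith
  ultimately have "?d \<le> \<gamma> * lag / 9" by blast
  also have "\<dots> \<le> \<gamma> * rate"
    using \<gamma> bounds_nonneg mult_left_mono[of "lag / 9" rate \<gamma>] unfolding rate_bound_def by auto
  finally show ?thesis by simp
qed

text \<open>A sample below \<open>e + \<rho>\<close> can overshoot by one step only; above that level the slow variable does not
  increase. Hence every slow value is dominated by the slow value of a sample that is no larger than the
  first sample or such an overshoot.\<close>

lemma sample_trapped:
  assumes "m \<le> n"
  shows "sample n \<le> max (sample m) (e + \<rho> + \<gamma> * rate) + \<gamma> * rate"
proof -
  define B where "B = max (sample m) (e + \<rho> + \<gamma> * rate)"
  \<comment> \<open>The witness is the sample after the last one below the barrier, or else the first one.\<close>
  have "\<exists>k. sample k \<le> B \<and> slow n \<le> slow k" using assms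
  proof (induction n rule: dec_induct)
    case base then show ?case by (intro exI[of _ m]) (auto simp: B_def)
  next
    case (step n)
    then obtain k where k: "sample k \<le> B" "slow n \<le> slow k" by blast
    show ?case
    proof (cases "e + \<rho> \<le> sample n")
      case True
      have "0 \<le> \<gamma> * (\<rho> / \<delta> / 40 * (h (sample n + \<delta> - \<rho> + \<rho> / 2) - h (sample n + \<delta> - \<rho>)))"
        using slow_drift(2)[OF True] \<gamma> \<rho> \<delta> by simp
      then have "slow (Suc n) \<le> slow n" using slow_drift(1)[OF True] by linarith
      then show ?thesis using k by (meson order_trans)
    next
      case False
      have "\<bar>sample (Suc n) - sample n\<bar> \<le> \<gamma> * rate"
        unfolding sample_def by (rule x_step) auto
      then show ?thesis using False by (intro exI[of _ "Suc n"]) (auto simp: B_def)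
    qed
  qed
  then obtain k where "sample k \<le> B" "slow n \<le> slow k" by blast
  then show ?thesis using sample_le[of n k] unfolding B_def by linarith
qed

lemma trapped:
  assumes "real m + 1/4 \<le> t"
  shows "x t \<le> max (sample m) (e + \<rho>) + 3 * (\<gamma> * rate)"
proof -
  define n where "n = nat \<lfloor>t - 1/4\<rfloor>"
  have n: "real n + 1/4 \<le> t" "t \<le> real n + 1/4 + 1" "m \<le> n"
    using assms unfolding n_def by (linarith, linarith, simp add: le_nat_floor le_nat_iff le_floor_iff)
  have "x t \<le> sample n + \<gamma> * rate"
    using x_step[of "real n + 1/4" t] n unfolding sample_def by auto
  then show ?thesis using sample_trapped[OF n(3)] gain_expanded by linarith
qed

lemma upper_bound:
  assumes "0 \<le> t" shows "x t \<le> max (x 0) (e + \<rho>) + 4 * (\<gamma> * rate)"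
proof (cases "1/4 \<le> t")
  case True
  have "sample 0 \<le> x 0 + \<gamma> * rate" using x_step[of 0 "1/4"] unfolding sample_def by simp
  then show ?thesis using trapped[of 0 t] True gain_expanded by auto
next
  case False
  then show ?thesis using x_step[of 0 t] assms gain_expanded by (auto simp: max_def)
qed

text \<open>While the samples stay above \<open>e + \<rho>\<close>, each period lowers the slow variable by
  at least \<open>\<gamma> \<rho> \<kappa> / (40 \<delta>)\<close>, whereas the total decrease available is bounded independently of \<open>\<gamma>\<close>. So
  the number of such periods is \<open>O(1 / \<gamma>)\<close>.\<close>

lemma eventual_upper_bound:
  assumes \<kappa>: "0 < \<kappa>" "\<And>n. e + \<rho> \<le> sample n \<Longrightarrow> \<kappa> \<le> h (sample n + \<delta> - \<rho> + \<rho> / 2) - h (sample n + \<delta> - \<rho>)"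
    and B: "x 0 - e \<le> B" "0 \<le> B"
    and t: "(40 * \<delta> * (2 * B + 2 * lag + 4) / (\<rho> * \<kappa>) + 3) / \<gamma> \<le> t"
  shows "x t \<le> e + 2 * \<rho>"
proof -
  define T where "T = 40 * \<delta> * (2 * B + 2 * lag + 4) / (\<rho> * \<kappa>) / \<gamma>"
  have T0: "0 \<le> T" unfolding T_def using \<delta> \<rho> \<kappa> \<gamma> B bounds_nonneg
    by (intro divide_nonneg_nonneg mult_nonneg_nonneg add_nonneg_nonneg) auto
  define N where "N = nat \<lceil>T\<rceil> + 1"
  have N: "T < real N" "real N \<le> T + 2" unfolding N_def using T0 by linarith+
  have "\<exists>j\<le>N. sample j < e + \<rho>"
  proof (rule ccontr)
    assume "\<not> ?thesis"
    then have above: "e + \<rho> \<le> sample j" if "j \<le> N" for j using that by force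
    define g where "g = \<gamma> * (\<rho> / \<delta> / 40 * \<kappa>)"
    have g: "0 < g" unfolding g_def using \<gamma> \<rho> \<delta> \<kappa> by simp
    have dec: "slow j \<le> slow 0 - real j * g" if "j \<le> N" for j using that
    proof (induction j)
      case (Suc j)
      have "g \<le> \<gamma> * (\<rho> / \<delta> / 40 * (h (sample j + \<delta> - \<rho> + \<rho> / 2) - h (sample j + \<delta> - \<rho>)))"
        unfolding g_def using \<kappa>(2)[OF above] Suc.prems \<gamma> \<rho> \<delta> by (intro mult_left_mono) auto
      then have "slow (Suc j) \<le> slow j - g" using slow_drift(1)[OF above, of j] Suc.prems by simp
      then show ?case using Suc by (simp add: algebra_simps)
    qed simp
    have "slow N \<le> slow 0" proof -
      have "0 \<le> real N * g" using g by simp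
      then show ?thesis using dec[of N] by linarith
    qed
    then have up: "sample N \<le> sample 0 + \<gamma> * rate" by (rule sample_le)
    have s0: "sample 0 - e \<le> B + 1"
      using x_step[of 0 "1/4"] B small_gain(1) \<rho> unfolding sample_def by simp
    have down: "sample 0 - sample N \<le> B + 1" using s0 above[of N] \<rho> by simp
    let ?y0 = "y (real 0 + 1/4)" and ?yN = "y (real N + 1/4)"
    have "\<bar>sample 0 - sample N\<bar> \<le> B + 1" using up down small_gain(1) \<rho> B by simp
    then have "\<bar>h (sample 0) - h (sample N)\<bar> \<le> L * (B + 1)"
      using lip[of "sample 0" "sample N"] L_nonneg mult_left_mono[of _ "B + 1" L] order_trans by blast
    then have "?y0 - ?yN \<le> L * (B + 1) + 2 * lag"
      using lag_le[of "real 0 + 1/4"] lag_le[of "real N + 1/4"] unfolding sample_def by auto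
    then have "coupling * (?y0 - ?yN) \<le> coupling * (L * (B + 1) + 2 * lag)"
      using coupling_bounds by (intro mult_left_mono) auto
    also have "\<dots> \<le> \<gamma> * (L * (B + 1) + 2 * lag)"
      using coupling_bounds \<gamma> B L_nonneg bounds_nonneg by (intro mult_right_mono) auto
    also have "\<dots> = (\<gamma> * L) * (B + 1) + \<gamma> * (2 * lag)" by (simp add: algebra_simps)
    also have "\<dots> \<le> 1 * (B + 1) + 1 * (2 * lag)"
      using small_gain(5,6,7,9) \<rho> B bounds_nonneg by (intro add_mono mult_right_mono) auto
    finally have "slow 0 - slow N \<le> 2 * B + 2 * lag + 2" using down unfolding slow_def by (simp add: algebra_simps)
    then have "real N * g < 2 * B + 2 * lag + 4" using dec[of N] by simp
    then have "real N < (2 * B + 2 * lag + 4) / g" using g by (simp add: field_simps)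
    also have "\<dots> = T" unfolding T_def g_def using \<gamma> \<rho> \<delta> \<kappa> by (simp add: field_simps)
    finally show False using N by simp
  qed
  then obtain j where j: "j \<le> N" "sample j < e + \<rho>" by blast
  have "real j + 1/4 \<le> T + 3" using j(1) N by linarith
  also have "\<dots> \<le> (40 * \<delta> * (2 * B + 2 * lag + 4) / (\<rho> * \<kappa>) + 3) / \<gamma>"
    unfolding T_def add_divide_distrib using \<gamma> small_gain(7) by (simp add: field_simps)
  finally have "x t \<le> max (sample j) (e + \<rho>) + 3 * (\<gamma> * rate)" using t by (intro trapped) simp
  then show ?thesis using j small_gain(1) \<rho> by (simp add: max_def)
qed

text \<open>The dither changes sign after half a period. So \<open>- x\<close>, shifted by \<open>1/2\<close>, solves the system of the
  reflected cost, and lower bounds on \<open>x\<close> are upper bounds for that system.\<close>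

lemma reflected:
  "balanced_system (\<lambda>v. h (- v)) (\<lambda>v. - dh (- v)) (- xs) L \<delta> \<gamma> \<rho>
     (\<lambda>t. - x (t + 1/2)) (\<lambda>t. y (t + 1/2)) (- e) (\<lambda>v. \<Phi> (- v))"
proof
  have neg: "(uminus has_real_derivative - 1) (at v)" for v :: real by (auto intro!: derivative_eq_intros)
  have shift: "((\<lambda>s. f (s + 1/2)) has_real_derivative D) (at s)" if "(f has_real_derivative D) (at (s + 1/2))" for f D and s :: real
    using that DERIV_shift by blast
  have half: "sin (2 * pi * (t + 1/2)) = - sin (2 * pi * t)" for t by (simp add: distrib_left)
  show "((\<lambda>v. h (- v)) has_real_derivative - dh (- v)) (at v)" for v
    using DERIV_chain2[OF deriv neg] by simp
  show "continuous_on UNIV (\<lambda>v. - dh (- v))"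
    by (intro continuous_intros continuous_on_compose2[OF dh_cont]) auto
  show "\<bar>- dh (- v)\<bar> \<le> L" for v using dh_bound by simp
  show "- dh (- v) \<le> 0" if "v \<le> - xs" for v using dh_right[of "- v"] that by simp
  show "0 \<le> - dh (- v)" if "- xs \<le> v" for v using dh_left[of "- v"] that by simp
  show "0 < \<delta>" "0 < \<gamma>" "0 < \<rho>" "\<rho> \<le> 1/8" "\<rho> \<le> \<delta> / 8" using \<delta> \<gamma> \<rho> by auto
  show "\<gamma> * (1 + L) * (\<delta> + rate_bound L \<delta>) \<le> \<rho> / 40" by (rule gain)
  show "continuous_on {0..} (\<lambda>t. - x (t + 1/2))" "continuous_on {0..} (\<lambda>t. y (t + 1/2))"
    by (intro continuous_intros continuous_on_compose2[OF x_cont] continuous_on_compose2[OF y_cont]; auto)+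
  show "\<bar>y (t + 1/2) - h (- (- x (t + 1/2)))\<bar> \<le> lag" if "0 \<le> t" for t using lag_le[of "t + 1/2"] that by simp
  show "((\<lambda>t. - x (t + 1/2)) has_real_derivative
     - \<gamma> * (h (- (- x (t + 1/2) + \<delta> * sin (2 * pi * t))) - y (t + 1/2)) * sin (2 * pi * t)) (at t)" if "0 < t" for t
    using DERIV_minus[OF shift[OF dx[of "t + 1/2"]]] that half[of t] by simp
  show "((\<lambda>t. y (t + 1/2)) has_real_derivative
     \<gamma> * (h (- (- x (t + 1/2) + \<delta> * sin (2 * pi * t))) - y (t + 1/2))) (at t)" if "0 < t" for t
    using shift[OF dy[of "t + 1/2"]] that half[of t] by simp
  show "- e - \<delta> < - xs" "- xs < - e + \<delta>" using xs_less xs_greater by auto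
  show "continuous_on {- e - \<delta>..- e + \<delta>} (\<lambda>v. \<Phi> (- v))"
    by (intro continuous_on_compose2[OF \<Phi>_cont] continuous_intros) auto
  show "((\<lambda>v. \<Phi> (- v)) has_real_derivative - dh (- v) * sqrt (1 - ((v - - e) / \<delta>)\<^sup>2)) (at v)"
    if "- e - \<delta> < v" "v < - e + \<delta>" for v
  proof -
    have "e - \<delta> < - v" "- v < e + \<delta>" using that by auto
    from DERIV_chain2[OF \<Phi>_deriv[OF this] neg]
    have "((\<lambda>v. \<Phi> (- v)) has_real_derivative - dh (- v) * sqrt (1 - ((- v - e) / \<delta>)\<^sup>2)) (at v)" by simp
    moreover have "((- v - e) / \<delta>)\<^sup>2 = ((v - - e) / \<delta>)\<^sup>2"
    proof -
      have "(- v - e) / \<delta> = - ((v - - e) / \<delta>)" by (simp add: divide_inverse algebra_simps)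
      then show ?thesis by (simp only: power2_minus)
    qed
    ultimately show ?thesis by simp
  qed
  have "- (- e - \<delta>) = e + \<delta>" "- (- e + \<delta>) = e - \<delta>" by auto
  then show "\<Phi> (- (- e - \<delta>)) = \<Phi> (- (- e + \<delta>))" using \<Phi>_balance by (simp only:)
qed

lemma confined:
  assumes t: "0 \<le> t"
  shows "min (x 0) (e - \<rho>) - \<rho> \<le> x t" "x t \<le> max (x 0) (e + \<rho>) + \<rho>"
proof -
  interpret R: balanced_system "\<lambda>v. h (- v)" "\<lambda>v. - dh (- v)" "- xs" L \<delta> \<gamma> \<rho>
     "\<lambda>t. - x (t + 1/2)" "\<lambda>t. y (t + 1/2)" "- e" "\<lambda>v. \<Phi> (- v)" by (rule reflected)
  show "x t \<le> max (x 0) (e + \<rho>) + \<rho>" using upper_bound[OF t] small_gain(1) \<rho> by simp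
  have half: "\<bar>x s - x 0\<bar> \<le> \<gamma> * rate" if "0 \<le> s" "s \<le> 1/2" for s using x_step[of 0 s] that by simp
  show "min (x 0) (e - \<rho>) - \<rho> \<le> x t"
  proof (cases "t \<le> 1/2")
    case True
    have "x 0 - \<rho> \<le> x t" using half[OF t True] small_gain(1) \<rho> by linarith
    then show ?thesis using min.cobounded1[of "x 0" "e - \<rho>"] by linarith
  next
    case False
    have "- x t \<le> max (- x (1/2)) (- e + \<rho>) + 4 * (\<gamma> * rate)"
      using R.upper_bound[of "t - 1/2"] False by simp
    then show ?thesis using half[of "1/2"] small_gain(1) \<rho> by (auto simp: min_def max_def split: if_splits)
  qed
qed

lemma converges:
  assumes \<kappa>: "0 < \<kappa>"
    and above: "\<And>t. 0 \<le> t \<Longrightarrow> e + \<rho> \<le> x t \<Longrightarrow> \<kappa> \<le> h (x t + \<delta> - \<rho> + \<rho> / 2) - h (x t + \<delta> - \<rho>)"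
    and below: "\<And>t. 0 \<le> t \<Longrightarrow> x t \<le> e - \<rho> \<Longrightarrow> \<kappa> \<le> h (x t - \<delta> + \<rho> - \<rho> / 2) - h (x t - \<delta> + \<rho>)"
    and B: "\<bar>x 0 - e\<bar> \<le> B"
    and t: "(40 * \<delta> * (2 * (B + 1) + 2 * lag + 4) / (\<rho> * \<kappa>) + 4) / \<gamma> \<le> t"
  shows "\<bar>x t - e\<bar> \<le> 2 * \<rho>"
proof -
  interpret R: balanced_system "\<lambda>v. h (- v)" "\<lambda>v. - dh (- v)" "- xs" L \<delta> \<gamma> \<rho>
     "\<lambda>t. - x (t + 1/2)" "\<lambda>t. y (t + 1/2)" "- e" "\<lambda>v. \<Phi> (- v)" by (rule reflected)
  let ?T = "40 * \<delta> * (2 * (B + 1) + 2 * lag + 4) / (\<rho> * \<kappa>)"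
  have T: "(?T + 3) / \<gamma> + 1/2 \<le> (?T + 4) / \<gamma>"
  proof -
    have "(?T + 4) / \<gamma> = (?T + 3) / \<gamma> + 1 / \<gamma>" by (simp add: add_divide_distrib)
    moreover have "1 \<le> 1 / \<gamma>" using \<gamma> small_gain(7) by simp
    ultimately show ?thesis by linarith
  qed
  have "x t \<le> e + 2 * \<rho>"
  proof (rule eventual_upper_bound[OF \<kappa>, of "B + 1"])
    show "\<kappa> \<le> h (sample n + \<delta> - \<rho> + \<rho> / 2) - h (sample n + \<delta> - \<rho>)" if "e + \<rho> \<le> sample n" for n
      using above[of "real n + 1/4"] that unfolding sample_def by simp
    show "(?T + 3) / \<gamma> \<le> t" using T t by linarith
  qed (use B in auto)
  moreover have "- x ((t - 1/2) + 1/2) \<le> - e + 2 * \<rho>"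
  proof (rule R.eventual_upper_bound[OF \<kappa>, of "B + 1"])
    show "\<kappa> \<le> h (- (R.sample n + \<delta> - \<rho> + \<rho> / 2)) - h (- (R.sample n + \<delta> - \<rho>))"
      if "- e + \<rho> \<le> R.sample n" for n
      using below[of "real n + 1/4 + 1/2"] that unfolding R.sample_def by (simp add: algebra_simps)
    have "\<bar>x (1/2) - x 0\<bar> \<le> 1" using x_step[of 0 "1/2"] small_gain(1) \<rho> by simp
    then show "- x (0 + 1/2) - - e \<le> B + 1" using B by simp
    show "(?T + 3) / \<gamma> \<le> t - 1/2" using T t by linarith
  qed (use B in auto)
  ultimately show ?thesis by (simp add: abs_le_iff)
qed

end

section \<open>Convergence of the filter state\<close>

context es_system
begin

text \<open>The filter input is \<open>h (e + \<delta> u)\<close> up to \<open>2 L \<rho>\<close>. Subtracting \<open>\<gamma>\<close> times a primitive of its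
  oscillating part from \<open>y - m\<close> leaves a filter with an input of size \<open>2 L \<rho> + 2 \<gamma> L \<delta>\<close>.\<close>

lemma filter_converges:
  assumes a: "0 \<le> a" and near: "\<And>t. a \<le> t \<Longrightarrow> \<bar>x t - e\<bar> \<le> 2 * \<rho>"
    and mean: "m = integral {0..1} (\<lambda>t. h (e + \<delta> * sin (2 * pi * t)))" and t: "a \<le> t"
  shows "\<bar>y t - m\<bar> \<le> 2 * L * \<rho> + 4 * (\<gamma> * L * \<delta>) + exp (- \<gamma> * (t - a)) * (\<bar>y a - m\<bar> + 2 * (\<gamma> * L * \<delta>))"
proof -
  define f where "f t = h (e + \<delta> * sin (2 * pi * t)) - m" for t
  have int: "(\<lambda>t. h (e + \<delta> * sin (2 * pi * t))) integrable_on {0..1}"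
    by (intro integrable_continuous_interval h_cont_dither)
  have m_near: "\<bar>m - h e\<bar> \<le> L * \<delta>"
    using mean_near[OF \<delta>, of e] unfolding mean a0_def by simp
  have "continuous_on UNIV f" unfolding f_def by (intro continuous_intros h_cont_dither)
  moreover have "f (t + 1) = f t" for t unfolding f_def by (simp add: distrib_left sin_add)
  moreover have "integral {0..1} f = 0" unfolding f_def using int mean by (subst integral_diff) auto
  moreover have "\<bar>f t\<bar> \<le> 2 * (L * \<delta>)" for t unfolding f_def using dither_near[OF \<delta>, of e "2 * pi * t"] m_near by linarith
  ultimately obtain F where F: "\<And>t. 0 < t \<Longrightarrow> (F has_real_derivative f t) (at t)"
      "\<And>t. 0 \<le> t \<Longrightarrow> \<bar>F t\<bar> \<le> 2 * (L * \<delta>)" "continuous_on {0..} F"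
    using periodic_primitive[of f "2 * (L * \<delta>)"] by blast
  define Y where "Y t = y t - m - \<gamma> * F t" for t
  define W where "W = 2 * L * \<rho> + 2 * (\<gamma> * L * \<delta>)"
  have "\<bar>Y t\<bar> \<le> W + exp (- \<gamma> * (t - a)) * (\<bar>Y a\<bar> - W)"
  proof (rule linear_filter_bound[OF t _ \<gamma>, where w = "\<lambda>t. h (x t + \<delta> * sin (2 * pi * t)) - h (e + \<delta> * sin (2 * pi * t)) - \<gamma> * F t"])
    show "continuous_on {a..t} Y"
      unfolding Y_def using a by (intro continuous_intros cont_on continuous_on_subset[OF F(3)]) auto
    fix s assume s: "a < s" "s < t"
    then have s0: "0 < s" using a by simp
    have "(Y has_real_derivative \<gamma> * (h (x s + \<delta> * sin (2 * pi * s)) - y s) - \<gamma> * f s) (at s)"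
      unfolding Y_def[abs_def] by (rule derivative_eq_intros dy[OF s0] F(1)[OF s0] refl | simp)+
    then show "(Y has_real_derivative \<gamma> * (h (x s + \<delta> * sin (2 * pi * s)) - h (e + \<delta> * sin (2 * pi * s))
        - \<gamma> * F s - Y s)) (at s)"
      unfolding f_def Y_def by (simp add: algebra_simps)
    have "\<bar>h (x s + \<delta> * sin (2 * pi * s)) - h (e + \<delta> * sin (2 * pi * s))\<bar> \<le> L * \<bar>x s - e\<bar>"
      using lip[of "x s + \<delta> * sin (2 * pi * s)" "e + \<delta> * sin (2 * pi * s)"] by simp
    also have "\<dots> \<le> L * (2 * \<rho>)" using near[of s] s L_nonneg by (intro mult_left_mono) auto
    finally have 1: "\<bar>h (x s + \<delta> * sin (2 * pi * s)) - h (e + \<delta> * sin (2 * pi * s))\<bar> \<le> 2 * L * \<rho>" by simp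
    have "\<bar>\<gamma> * F s\<bar> \<le> \<gamma> * (2 * (L * \<delta>))" unfolding abs_mult using F(2)[of s] s0 \<gamma> by simp
    with 1 show "\<bar>h (x s + \<delta> * sin (2 * pi * s)) - h (e + \<delta> * sin (2 * pi * s)) - \<gamma> * F s\<bar> \<le> W"
      unfolding W_def by simp
  qed
  moreover have gF: "\<bar>\<gamma> * F s\<bar> \<le> 2 * (\<gamma> * L * \<delta>)" if "a \<le> s" for s
    unfolding abs_mult using mult_left_mono[OF F(2)[of s], of \<gamma>] that a \<gamma> by simp
  moreover have "\<bar>Y a\<bar> - W \<le> \<bar>y a - m\<bar> + 2 * (\<gamma> * L * \<delta>)"
  proof -
    have "0 \<le> W" unfolding W_def using L_nonneg \<rho> gain_expanded by simp
    then show ?thesis using gF[of a] unfolding Y_def by simp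
  qed
  then have "exp (- \<gamma> * (t - a)) * (\<bar>Y a\<bar> - W) \<le> exp (- \<gamma> * (t - a)) * (\<bar>y a - m\<bar> + 2 * (\<gamma> * L * \<delta>))"
    by (intro mult_left_mono) auto
  moreover have "\<bar>y t - m\<bar> \<le> \<bar>Y t\<bar> + \<bar>\<gamma> * F t\<bar>" unfolding Y_def by simp
  ultimately show ?thesis using gF[OF t] unfolding W_def by linarith
qed

end

section \<open>Existence and uniqueness of trajectories\<close>

lemma at_within_extend:
  fixes t :: real assumes "0 \<le> t"
  shows "at t within {0..t + 1} = at t within {0..}"
  using assms by (intro at_within_nhd[of _ "{t - 1<..<t + 1}"]) auto

text \<open>The weight \<open>exp (- k s)\<close> keeps the Picard operator bounded, and contracting for large \<open>k\<close>, on the whole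
  half line at once, without continuation from short intervals.\<close>

lemma weighted_integral_bound:
  fixes g :: "real \<Rightarrow> 'a::banach"
  assumes "continuous_on {0..s} g" "0 \<le> s" "0 < k" "0 \<le> c"
    and bound: "\<And>r. 0 \<le> r \<Longrightarrow> r \<le> s \<Longrightarrow> norm (g r) \<le> c * exp (k * r)"
  shows "exp (- k * s) * norm (integral {0..s} g) \<le> c / k"
proof -
  have I: "((\<lambda>r. c * exp (k * r)) has_integral (c / k * exp (k * s) - c / k * exp (k * 0))) {0..s}"
    using assms(2,3) by (intro fundamental_theorem_of_calculus)
      (auto intro!: derivative_eq_intros simp: has_real_derivative_iff_has_vector_derivative[symmetric])
  have "norm (integral {0..s} g) \<le> integral {0..s} (\<lambda>r. c * exp (k * r))"
    using bound by (intro integral_norm_bound_integral integrable_continuous_interval assms(1)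
      has_integral_integrable[OF I]) auto
  also have "\<dots> \<le> c / k * exp (k * s)" unfolding integral_unique[OF I] using assms(3,4) by simp
  finally have "exp (- k * s) * norm (integral {0..s} g) \<le> exp (- k * s) * (c / k * exp (k * s))"
    by (intro mult_left_mono) auto
  also have "\<dots> = c / k * exp (- k * s + k * s)" unfolding exp_add by simp
  finally show ?thesis by simp
qed

text \<open>Picard iteration for \<open>w t = exp (- k t) z t\<close> in the space of bounded continuous functions. These
  live on the whole line; negative times are collapsed to \<open>0\<close> by \<open>max 0 t\<close>.\<close>

lemma global_lipschitz_solution:
  fixes f :: "real \<Rightarrow> 'a::banach \<Rightarrow> 'a"
  assumes cont: "continuous_on UNIV (\<lambda>(t, z). f t z)"
    and lip: "\<And>t a b. norm (f t a - f t b) \<le> K * norm (a - b)"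
    and f0: "\<And>t. norm (f t 0) \<le> M"
  obtains z where "z 0 = z0" "\<And>t. 0 \<le> t \<Longrightarrow> (z has_vector_derivative f t (z t)) (at t within {0..})"
proof -
  \<comment> \<open>On a trivial space \<open>K\<close> could be negative.\<close>
  define K' where "K' = max K 0"
  have lip': "norm (f t a - f t b) \<le> K' * norm (a - b)" for t a b
    using lip[of t a b] mult_right_mono[of K K' "norm (a - b)"] unfolding K'_def by auto
  have K': "0 \<le> K'" unfolding K'_def by simp
  have M: "0 \<le> M" using f0[of 0] norm_ge_zero order_trans by blast
  define k where "k = K' + 1"
  have k: "0 < k" unfolding k_def using K' by simp
  define g where "g w r = f r (exp (k * r) *\<^sub>R apply_bcontfun w r)" for w :: "real \<Rightarrow>\<^sub>C 'a" and r
  have g_cont: "continuous_on S (g w)" for S w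
  proof -
    have "continuous_on S (\<lambda>r. (r, exp (k * r) *\<^sub>R apply_bcontfun w r))" by (intro continuous_intros) auto
    then have "continuous_on S (\<lambda>r. (\<lambda>(t, z). f t z) (r, exp (k * r) *\<^sub>R apply_bcontfun w r))"
      by (rule continuous_on_compose2[OF cont]) auto
    then show ?thesis unfolding g_def by simp
  qed
  have G_deriv: "((\<lambda>s. integral {0..s} (g w)) has_vector_derivative g w t) (at t within {0..})" if "0 \<le> t" for w t
    using integral_has_vector_derivative[OF g_cont, of t 0 "t + 1" w] that by (simp add: at_within_extend)
  have G_cont: "continuous_on {0..} (\<lambda>s. integral {0..s} (g w))" for w
    unfolding continuous_on_eq_continuous_within
    using G_deriv has_vector_derivative_continuous by blast
  define \<Psi> where "\<Psi> w t = exp (- k * max 0 t) *\<^sub>R (z0 + integral {0..max 0 t} (g w))" for w t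
  have \<Psi>: "\<Psi> w \<in> bcontfun" for w
  proof (rule bcontfun_normI)
    have "continuous_on UNIV (\<lambda>t. integral {0..max 0 t} (g w))"
      by (rule continuous_on_compose2[OF G_cont]) (auto intro!: continuous_intros)
    then show "continuous_on UNIV (\<Psi> w)" unfolding \<Psi>_def by (intro continuous_intros)
    fix t :: real
    define s where "s = max 0 t"
    have s: "0 \<le> s" unfolding s_def by simp
    have "norm (g w r) \<le> (M + K' * norm w) * exp (k * r)" if "0 \<le> r" for r
    proof -
      have "norm (g w r) \<le> norm (f r 0) + norm (g w r - f r 0)" by (metis norm_triangle_sub)
      also have "\<dots> \<le> M + K' * (exp (k * r) * norm (apply_bcontfun w r))"
        using lip'[of r "exp (k * r) *\<^sub>R apply_bcontfun w r" 0] f0[of r] unfolding g_def by simp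
      also have "\<dots> \<le> M * exp (k * r) + K' * (exp (k * r) * norm w)"
        using M K' that k norm_bounded[of w r] mult_left_mono[of 1 "exp (k * r)" M]
        by (intro add_mono mult_left_mono) auto
      finally show ?thesis by (simp add: algebra_simps)
    qed
    then have "exp (- k * s) * norm (integral {0..s} (g w)) \<le> (M + K' * norm w) / k"
      using s k M K' by (intro weighted_integral_bound g_cont) auto
    moreover have "exp (- k * s) * norm z0 \<le> 1 * norm z0" using s k by (intro mult_right_mono) auto
    moreover have "norm (\<Psi> w t) \<le> exp (- k * s) * (norm z0 + norm (integral {0..s} (g w)))"
      unfolding \<Psi>_def s_def[symmetric] by (simp add: norm_triangle_ineq)
    ultimately show "norm (\<Psi> w t) \<le> norm z0 + (M + K' * norm w) / k" by (simp add: algebra_simps)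
  qed
  have \<Psi>_contract: "dist (Bcontfun (\<Psi> v)) (Bcontfun (\<Psi> w)) \<le> K' / k * dist v w" for v w
  proof (rule dist_bound)
    fix t :: real
    define s where "s = max 0 t"
    have s: "0 \<le> s" unfolding s_def by simp
    have "norm (g v r - g w r) \<le> (K' * dist v w) * exp (k * r)" for r
    proof -
      have "norm (g v r - g w r) \<le> K' * (exp (k * r) * dist (apply_bcontfun v r) (apply_bcontfun w r))"
        using lip'[of r "exp (k * r) *\<^sub>R apply_bcontfun v r" "exp (k * r) *\<^sub>R apply_bcontfun w r"]
        unfolding g_def by (simp add: scaleR_diff_right[symmetric] dist_norm)
      also have "\<dots> \<le> K' * (exp (k * r) * dist v w)"
        using K' dist_bounded[of v r w] by (intro mult_left_mono) auto
      finally show ?thesis by (simp add: mult_ac)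
    qed
    then have "exp (- k * s) * norm (integral {0..s} (\<lambda>r. g v r - g w r)) \<le> (K' * dist v w) / k"
      using s k K' by (intro weighted_integral_bound continuous_intros g_cont) auto
    moreover have "integral {0..s} (\<lambda>r. g v r - g w r) = integral {0..s} (g v) - integral {0..s} (g w)"
      by (intro integral_diff integrable_continuous_interval g_cont)
    moreover have "dist (\<Psi> v t) (\<Psi> w t) = exp (- k * s) * norm (integral {0..s} (g v) - integral {0..s} (g w))"
      unfolding \<Psi>_def s_def[symmetric] by (simp add: dist_norm scaleR_diff_right[symmetric])
    ultimately show "dist (apply_bcontfun (Bcontfun (\<Psi> v)) t) (apply_bcontfun (Bcontfun (\<Psi> w)) t) \<le> K' / k * dist v w"
      using \<Psi> by (simp add: Bcontfun_inverse)
  qed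
  have "K' / k < 1" "0 \<le> K' / k" unfolding k_def using K' by auto
  then obtain w where w: "Bcontfun (\<Psi> w) = w"
    using banach_fix_type[of "K' / k" "\<lambda>w. Bcontfun (\<Psi> w)"] \<Psi>_contract by blast
  then have w': "apply_bcontfun w t = \<Psi> w t" for t using \<Psi>[of w] by (metis Bcontfun_inverse)
  define z where "z t = z0 + integral {0..t} (g w)" for t
  have z: "exp (k * t) *\<^sub>R apply_bcontfun w t = z t" if "0 \<le> t" for t
    using that unfolding w' \<Psi>_def z_def by (simp add: exp_add[symmetric])
  show thesis
  proof (rule that[of z])
    show "z 0 = z0" unfolding z_def by simp
    fix t :: real assume t: "0 \<le> t"
    have "(z has_vector_derivative 0 + g w t) (at t within {0..})"
      unfolding z_def[abs_def] by (intro has_vector_derivative_add has_vector_derivative_const G_deriv t)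
    then show "(z has_vector_derivative f t (z t)) (at t within {0..})"
      unfolding g_def using z[OF t] by simp
  qed
qed

context unimodal_cost
begin

lemma es_trajectory_exists: 
  assumes \<gamma>: "0 \<le> \<gamma>"
  obtains x y where "es_trajectory h \<delta> \<gamma> x0 y0 x y"
proof -
  define F where "F t z = (- \<gamma> * (h (fst z + \<delta> * dither t) - snd z) * dither t,
      \<gamma> * (h (fst z + \<delta> * dither t) - snd z))" for t and z :: "real \<times> real"
  have u: "\<bar>dither t\<bar> \<le> 1" for t unfolding dither_def by simp
  have h_cont': "continuous_on UNIV h" by (rule h_cont)
  have bound: "norm (- \<gamma> * a * dither t, \<gamma> * a) \<le> 2 * \<gamma> * \<bar>a\<bar>" for a t
  proof -
    have "norm (- \<gamma> * a * dither t, \<gamma> * a) \<le> \<bar>- \<gamma> * a * dither t\<bar> + \<bar>\<gamma> * a\<bar>"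
      using norm_Pair_le[of "- \<gamma> * a * dither t" "\<gamma> * a"] by simp
    also have "\<bar>- \<gamma> * a * dither t\<bar> \<le> \<bar>\<gamma> * a\<bar> * 1"
      unfolding abs_mult using u \<gamma> by (intro mult_mono) auto
    finally show ?thesis using \<gamma> by (simp add: abs_mult)
  qed
  obtain z where z: "z 0 = (x0, y0)" "\<And>t. 0 \<le> t \<Longrightarrow> (z has_vector_derivative F t (z t)) (at t within {0..})"
  proof (rule global_lipschitz_solution[of F "2 * \<gamma> * (L + 1)" "2 * \<gamma> * (\<bar>h 0\<bar> + L * \<bar>\<delta>\<bar>)" "(x0, y0)"])
    have "continuous_on UNIV (\<lambda>p::real \<times> real \<times> real. h (fst (snd p) + \<delta> * dither (fst p)))"
      unfolding dither_def by (intro continuous_on_compose2[OF h_cont'] continuous_intros) auto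
    then have "continuous_on UNIV (\<lambda>p::real \<times> real \<times> real. F (fst p) (snd p))"
      unfolding F_def dither_def by (intro continuous_intros)
    then show "continuous_on UNIV (\<lambda>(t, z). F t z)" by (simp add: case_prod_unfold)
    fix t :: real
    show "norm (F t a - F t b) \<le> 2 * \<gamma> * (L + 1) * norm (a - b)" for a b
    proof -
      let ?d = "(h (fst a + \<delta> * dither t) - snd a) - (h (fst b + \<delta> * dither t) - snd b)"
      have "F t a - F t b = (- \<gamma> * ?d * dither t, \<gamma> * ?d)" unfolding F_def by (simp add: algebra_simps)
      then have 1: "norm (F t a - F t b) \<le> 2 * \<gamma> * \<bar>?d\<bar>" using bound by metis
      have "\<bar>?d\<bar> \<le> L * \<bar>fst a - fst b\<bar> + \<bar>snd a - snd b\<bar>"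
        using lip[of "fst a + \<delta> * dither t" "fst b + \<delta> * dither t"] by simp
      also have "\<dots> \<le> L * norm (a - b) + norm (a - b)"
      proof -
        have ab: "(fst (a - b), snd (a - b)) = a - b" by (rule prod.collapse)
        have "\<bar>fst a - fst b\<bar> \<le> norm (a - b)" "\<bar>snd a - snd b\<bar> \<le> norm (a - b)"
          using norm_fst_le[of "fst (a - b)" "snd (a - b)"] norm_snd_le[of "snd (a - b)" "fst (a - b)"]
          unfolding ab by simp_all
        then show ?thesis using L_nonneg by (intro add_mono mult_left_mono) auto
      qed
      finally have "2 * \<gamma> * \<bar>?d\<bar> \<le> 2 * \<gamma> * (L * norm (a - b) + norm (a - b))"
        using \<gamma> by (intro mult_left_mono) auto
      with 1 show ?thesis by (simp add: algebra_simps)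
    qed
    show "norm (F t 0) \<le> 2 * \<gamma> * (\<bar>h 0\<bar> + L * \<bar>\<delta>\<bar>)"
    proof -
      have "norm (F t 0) \<le> 2 * \<gamma> * \<bar>h (\<delta> * dither t)\<bar>" unfolding F_def using bound[of "h (\<delta> * dither t)" t] by simp
      moreover have "L * \<bar>\<delta> * dither t\<bar> \<le> L * (\<bar>\<delta>\<bar> * 1)"
        unfolding abs_mult using u L_nonneg by (intro mult_left_mono) auto
      then have "\<bar>h (\<delta> * dither t)\<bar> \<le> \<bar>h 0\<bar> + L * \<bar>\<delta>\<bar>" using lip[of "\<delta> * dither t" 0] by simp
      then have "2 * \<gamma> * \<bar>h (\<delta> * dither t)\<bar> \<le> 2 * \<gamma> * (\<bar>h 0\<bar> + L * \<bar>\<delta>\<bar>)"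
        using \<gamma> by (intro mult_left_mono) auto
      ultimately show ?thesis by linarith
    qed
  qed blast
  show thesis
  proof (rule that[of "\<lambda>t. fst (z t)" "\<lambda>t. snd (z t)"])
    show "es_trajectory h \<delta> \<gamma> x0 y0 (\<lambda>t. fst (z t)) (\<lambda>t. snd (z t))"
      unfolding es_trajectory_def
    proof (intro conjI allI impI)
      fix t :: real assume t: "0 \<le> t"
      show "((\<lambda>t. fst (z t)) has_real_derivative
          - \<gamma> * (h (fst (z t) + \<delta> * dither t) - snd (z t)) * dither t) (at t within {0..})"
        using bounded_linear.has_vector_derivative[OF bounded_linear_fst z(2)[OF t]]
        unfolding F_def has_real_derivative_iff_has_vector_derivative by simp
      show "((\<lambda>t. snd (z t)) has_real_derivative
          \<gamma> * (h (fst (z t) + \<delta> * dither t) - snd (z t))) (at t within {0..})"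
        using bounded_linear.has_vector_derivative[OF bounded_linear_snd z(2)[OF t]]
        unfolding F_def has_real_derivative_iff_has_vector_derivative by simp
    qed (use z in auto)
  qed
qed

end

lemma es_trajectory_cont:
  assumes "es_trajectory h \<delta> \<gamma> x0 y0 x y"
  shows "continuous_on {0..} x" "continuous_on {0..} y"
  using assms unfolding es_trajectory_def continuous_on_eq_continuous_within
  by (auto intro: DERIV_continuous)

lemma es_trajectory_deriv:
  assumes "es_trajectory h \<delta> \<gamma> x0 y0 x y" "0 < t"
  shows "(x has_real_derivative - \<gamma> * (h (x t + \<delta> * dither t) - y t) * dither t) (at t)"
    "(y has_real_derivative \<gamma> * (h (x t + \<delta> * dither t) - y t)) (at t)"
proof -
  have "at t within {0..} = at t" using assms(2) by (intro at_within_interior) auto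
  moreover have "(x has_real_derivative - \<gamma> * (h (x t + \<delta> * dither t) - y t) * dither t) (at t within {0..})"
    "(y has_real_derivative \<gamma> * (h (x t + \<delta> * dither t) - y t)) (at t within {0..})"
    using assms unfolding es_trajectory_def by simp_all
  ultimately show "(x has_real_derivative - \<gamma> * (h (x t + \<delta> * dither t) - y t) * dither t) (at t)"
    "(y has_real_derivative \<gamma> * (h (x t + \<delta> * dither t) - y t)) (at t)"
    by simp_all
qed

text \<open>Both trajectories are bounded on \<open>[0, T]\<close>, so a local Lipschitz constant suffices; the squared distance
  then satisfies a Gronwall inequality.\<close>

lemma es_trajectory_unique:
  assumes deriv: "\<And>v. (h has_real_derivative dh v) (at v)" and dh_cont: "continuous_on UNIV dh"
    and \<gamma>: "0 \<le> \<gamma>"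
    and 1: "es_trajectory h \<delta> \<gamma> x0 y0 x1 y1" and 2: "es_trajectory h \<delta> \<gamma> x0 y0 x2 y2"
    and T: "0 \<le> T"
  shows "x1 T = x2 T" "y1 T = y2 T"
proof -
  have cont: "continuous_on {0..T} x1" "continuous_on {0..T} x2" "continuous_on {0..T} y1" "continuous_on {0..T} y2"
    by (rule continuous_on_subset[OF es_trajectory_cont(1)[OF 1]] continuous_on_subset[OF es_trajectory_cont(1)[OF 2]]
          continuous_on_subset[OF es_trajectory_cont(2)[OF 1]] continuous_on_subset[OF es_trajectory_cont(2)[OF 2]]; simp)+
  have "bounded (x1 ` {0..T} \<union> x2 ` {0..T})"
    using cont by (simp add: compact_imp_bounded compact_continuous_image)
  then obtain R where R: "\<And>t. t \<in> {0..T} \<Longrightarrow> \<bar>x1 t\<bar> \<le> R \<and> \<bar>x2 t\<bar> \<le> R" unfolding bounded_real by blast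
  define S where "S = {- (R + \<bar>\<delta>\<bar>)..R + \<bar>\<delta>\<bar>}"
  have "bounded (dh ` S)"
    unfolding S_def by (intro compact_imp_bounded compact_continuous_image continuous_on_subset[OF dh_cont]) auto
  then obtain K where K: "\<And>v. v \<in> S \<Longrightarrow> \<bar>dh v\<bar> \<le> K" unfolding bounded_real by blast
  have h_cont: "continuous_on U h" for U
    using deriv by (meson DERIV_isCont continuous_at_imp_continuous_on)
  have lip: "\<bar>h a - h b\<bar> \<le> K * \<bar>a - b\<bar>" if "a \<in> S" "b \<in> S" for a b
  proof -
    have "\<bar>h v - h w\<bar> \<le> K * (v - w)" if "w \<le> v" "v \<in> S" "w \<in> S" for v w
      using that by (intro increment_bound h_cont) (use deriv K in \<open>force simp: S_def\<close>)+
    from this[of a b] this[of b a] that show ?thesis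
      by (cases "a \<le> b") (auto simp: abs_minus_commute)
  qed
  define D where "D t = (x1 t - x2 t)\<^sup>2 + (y1 t - y2 t)\<^sup>2" for t
  define c where "c = 4 * \<gamma> * (K + 1)"
  have "(\<lambda>t. - (exp (- c * t) * D t)) 0 \<le> (\<lambda>t. - (exp (- c * t) * D t)) T"
  proof (rule DERIV_nonneg_imp_increasing_open[OF T])
    fix t assume t: "0 < t" "t < T"
    let ?u = "dither t" and ?dx = "x1 t - x2 t" and ?dy = "y1 t - y2 t"
    let ?q = "(h (x1 t + \<delta> * dither t) - y1 t) - (h (x2 t + \<delta> * dither t) - y2 t)"
    have u: "\<bar>?u\<bar> \<le> 1" unfolding dither_def by simp
    have "\<bar>\<delta> * ?u\<bar> \<le> \<bar>\<delta>\<bar> * 1" unfolding abs_mult using u by (intro mult_left_mono) auto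
    then have "x1 t + \<delta> * ?u \<in> S" "x2 t + \<delta> * ?u \<in> S" using R[of t] t unfolding S_def by (auto simp: abs_le_iff)
    then have q: "\<bar>?q\<bar> \<le> K * \<bar>?dx\<bar> + \<bar>?dy\<bar>" using lip[of "x1 t + \<delta> * ?u" "x2 t + \<delta> * ?u"] by simp
    have K0: "0 \<le> K" using K[of 0] R[of t] t unfolding S_def by force
    let ?D' = "2 * ?dx * (- \<gamma> * ?q * ?u) + 2 * ?dy * (\<gamma> * ?q)"
    have D': "(D has_real_derivative ?D') (at t)"
      unfolding D_def[abs_def]
      by (rule derivative_eq_intros es_trajectory_deriv[OF 1 t(1)] es_trajectory_deriv[OF 2 t(1)] refl
          | simp add: algebra_simps)+
    have "?D' = 2 * \<gamma> * (?q * (?dy - ?dx * ?u))" by (simp add: algebra_simps)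
    also have "\<dots> \<le> 2 * \<gamma> * (((K + 1) * (\<bar>?dx\<bar> + \<bar>?dy\<bar>)) * (\<bar>?dx\<bar> + \<bar>?dy\<bar>))"
    proof -
      have "\<bar>?dx * ?u\<bar> \<le> \<bar>?dx\<bar> * 1" unfolding abs_mult using u by (intro mult_left_mono) auto
      then have "\<bar>?dy - ?dx * ?u\<bar> \<le> \<bar>?dx\<bar> + \<bar>?dy\<bar>"
        using abs_triangle_ineq4[of ?dy "?dx * ?u"] by simp
      moreover have "K * \<bar>?dx\<bar> + \<bar>?dy\<bar> \<le> (K + 1) * (\<bar>?dx\<bar> + \<bar>?dy\<bar>)"
        using K0 by (simp add: algebra_simps)
      then have "\<bar>?q\<bar> \<le> (K + 1) * (\<bar>?dx\<bar> + \<bar>?dy\<bar>)" using q by linarith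
      ultimately have "\<bar>?q * (?dy - ?dx * ?u)\<bar> \<le> ((K + 1) * (\<bar>?dx\<bar> + \<bar>?dy\<bar>)) * (\<bar>?dx\<bar> + \<bar>?dy\<bar>)"
        unfolding abs_mult[of ?q] using K0 by (intro mult_mono) auto
      then show ?thesis using \<gamma> by (intro mult_left_mono) auto
    qed
    also have "\<dots> \<le> c * D t"
    proof -
      have "(\<bar>?dx\<bar> + \<bar>?dy\<bar>) * (\<bar>?dx\<bar> + \<bar>?dy\<bar>) \<le> 2 * D t"
        unfolding D_def using sum_squares_bound[of "\<bar>?dx\<bar>" "\<bar>?dy\<bar>"]
        by (simp add: power2_eq_square algebra_simps)
      then have "2 * \<gamma> * (K + 1) * ((\<bar>?dx\<bar> + \<bar>?dy\<bar>) * (\<bar>?dx\<bar> + \<bar>?dy\<bar>)) \<le> 2 * \<gamma> * (K + 1) * (2 * D t)"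
        using \<gamma> K0 by (intro mult_left_mono) auto
      moreover have "2 * \<gamma> * (((K + 1) * s) * s) = 2 * \<gamma> * (K + 1) * (s * s)" for s by algebra
      moreover have "2 * \<gamma> * (K + 1) * (2 * D t) = c * D t" unfolding c_def by algebra
      ultimately show ?thesis by simp
    qed
    finally have "0 \<le> exp (- c * t) * (c * D t - ?D')" by simp
    moreover have "((\<lambda>t. - (exp (- c * t) * D t)) has_real_derivative exp (- c * t) * (c * D t - ?D')) (at t)"
      by (rule derivative_eq_intros D' refl | simp add: algebra_simps)+
    ultimately show "\<exists>y. ((\<lambda>t. - (exp (- c * t) * D t)) has_real_derivative y) (at t) \<and> 0 \<le> y" by blast
  next
    show "continuous_on {0..T} (\<lambda>t. - (exp (- c * t) * D t))"
      unfolding D_def by (intro continuous_intros cont)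
  qed
  moreover have "D 0 = 0" using 1 2 unfolding D_def es_trajectory_def by simp
  ultimately have "exp (- c * T) * D T \<le> 0" by simp
  then have "D T \<le> 0" by (simp add: mult_le_0_iff)
  then show "x1 T = x2 T" "y1 T = y2 T"
    unfolding D_def by (simp_all add: sum_power2_le_zero_iff)
qed

section \<open>Consequences of the standing assumptions\<close>

text \<open>A point between \<open>xs\<close> and \<open>z\<close> is a convex combination of the two, and \<open>h xs < h z\<close>.\<close>

lemma quasi_convex_monotone:
  assumes min: "\<And>x. x \<noteq> xs \<Longrightarrow> h xs < h x" and qc: "strictly_quasi_convex h"
  shows "xs \<le> a \<Longrightarrow> a < b \<Longrightarrow> h a < h b" "a < b \<Longrightarrow> b \<le> xs \<Longrightarrow> h b < h a"
proof -
  have segment: "h (l * xs + (1 - l) * z) < h z" if "z \<noteq> xs" "0 < l" "l \<le> 1" for l z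
  proof (cases "l = 1")
    case False
    then show ?thesis using qc min[OF that(1)] that unfolding strictly_quasi_convex_def by simp
  qed (use min that in simp)
  show "h a < h b" if "xs \<le> a" "a < b"
  proof -
    have "(b - a) / (b - xs) * xs + (1 - (b - a) / (b - xs)) * b = a" using that by (simp add: divide_simps) algebra
    then show ?thesis using segment[of b "(b - a) / (b - xs)"] that by simp
  qed
  show "h b < h a" if "a < b" "b \<le> xs"
  proof -
    have "(b - a) / (xs - a) * xs + (1 - (b - a) / (xs - a)) * a = b" using that by (simp add: divide_simps) algebra
    then show ?thesis using segment[of a "(b - a) / (xs - a)"] that by simp
  qed
qed

lemma cost_derivative:
  assumes A1: "assumption_A1 h xs" and A2: "assumption_A2 h xs"
  shows "\<And>v. (h has_real_derivative deriv h v) (at v)" "continuous_on UNIV (deriv h)"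
    "\<And>v. v \<le> xs \<Longrightarrow> deriv h v \<le> 0" "\<And>v. xs \<le> v \<Longrightarrow> 0 \<le> deriv h v"
proof -
  have "(deriv ^^ 0) h differentiable_on UNIV" "(deriv ^^ 1) h differentiable_on UNIV"
    using A1 unfolding assumption_A1_def smooth_fun_def by blast+
  then have diff: "h differentiable_on UNIV" "deriv h differentiable_on UNIV" by auto
  show D: "(h has_real_derivative deriv h v) (at v)" for v
    using diff(1) by (simp add: differentiable_on_def DERIV_deriv_iff_real_differentiable)
  show "continuous_on UNIV (deriv h)" using diff(2) by (rule differentiable_imp_continuous_on)
  have min: "\<And>x. x \<noteq> xs \<Longrightarrow> h xs < h x" and qc: "strictly_quasi_convex h"
    using A1 A2 unfolding assumption_A1_def assumption_A2_def by auto
  note mono = quasi_convex_monotone[OF min qc]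
  show "deriv h v \<le> 0" if "v \<le> xs" for v
  proof (rule ccontr)
    assume "\<not> deriv h v \<le> 0"
    then obtain \<epsilon> where "0 < \<epsilon>" "\<And>s. 0 < s \<Longrightarrow> s < \<epsilon> \<Longrightarrow> h (v - s) < h v"
      using DERIV_pos_inc_left[OF D[of v]] by auto
    then have "h (v - \<epsilon> / 2) < h v" by simp
    moreover have "h v < h (v - \<epsilon> / 2)" using \<open>0 < \<epsilon>\<close> that by (intro mono(2)) auto
    ultimately show False by simp
  qed
  show "0 \<le> deriv h v" if "xs \<le> v" for v
  proof (rule ccontr)
    assume "\<not> 0 \<le> deriv h v"
    then obtain \<epsilon> where "0 < \<epsilon>" "\<And>s. 0 < s \<Longrightarrow> s < \<epsilon> \<Longrightarrow> h (v + s) < h v"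
      using DERIV_neg_dec_right[OF D[of v]] by auto
    then have "h (v + \<epsilon> / 2) < h v" by simp
    moreover have "h v < h (v + \<epsilon> / 2)" using \<open>0 < \<epsilon>\<close> that by (intro mono(1)) auto
    ultimately show False by simp
  qed
qed

text \<open>Only difference quotients inside the interval are controlled; they still determine the derivative at an
  endpoint.\<close>

lemma lipschitz_derivative_bound:
  fixes h :: "real \<Rightarrow> real"
  assumes lip: "L-lipschitz_on {a..b} h" and deriv: "(h has_real_derivative D) (at v)" and v: "v \<in> {a..b}" "a < b"
  shows "\<bar>D\<bar> \<le> L"
proof -
  have "((\<lambda>y. (h y - h v) / (y - v)) \<longlongrightarrow> D) (at v within {a..b})"
    using DERIV_subset[OF deriv, of "{a..b}"] by (simp add: has_field_derivative_iff)
  then have "((\<lambda>y. \<bar>(h y - h v) / (y - v)\<bar>) \<longlongrightarrow> \<bar>D\<bar>) (at v within {a..b})" by (rule tendsto_rabs)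
  moreover have "\<bar>(h y - h v) / (y - v)\<bar> \<le> L" if "y \<in> {a..b}" "y \<noteq> v" for y
    using lipschitz_onD[OF lip that(1) v(1)] that(2) by (simp add: dist_real_def divide_simps)
  then have "\<forall>\<^sub>F y in at v within {a..b}. \<bar>(h y - h v) / (y - v)\<bar> \<le> L"
    by (auto simp: eventually_at_filter)
  moreover have "at v within {a..b} \<noteq> bot"
    using connected_imp_perfect[of "{a..b}" v] v by (auto simp: trivial_limit_within)
  ultimately show ?thesis by (rule tendsto_upperbound)
qed

text \<open>A constant solution converges to the compact graph only if it already lies in it.\<close>

lemma attractor_equilibrium:
  assumes A: "attractor_data h xs \<delta> A \<tau>" and e: "b1 h \<delta> e = 0"
  shows "(e, a0 h \<delta> e / 2) \<in> graph_on \<tau> A"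
proof -
  let ?z = "(e, a0 h \<delta> e / 2)"
  have A': "compact A" "A \<noteq> {}" "continuous_on UNIV \<tau>"
    "globally_asymptotically_stable (avg_field h \<delta> 1) (graph_on \<tau> A)"
    using A unfolding attractor_data_def by auto
  have "solution (avg_field h \<delta> 1) (\<lambda>_. ?z)"
    unfolding solution_def avg_field_def avg_x_field_def using e by (auto simp: zero_prod_def[symmetric])
  then have "((\<lambda>t::real. infdist ?z (graph_on \<tau> A)) \<longlongrightarrow> 0) at_top"
    using A'(4) unfolding globally_asymptotically_stable_def by blast
  then have 0: "infdist ?z (graph_on \<tau> A) = 0"
    by (rule tendsto_unique[OF trivial_limit_at_top_linorder tendsto_const])
  have graph: "graph_on \<tau> A = (\<lambda>x. (x, \<tau> x)) ` A" unfolding graph_on_def by auto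
  have "compact (graph_on \<tau> A)"
    unfolding graph by (intro compact_continuous_image continuous_intros continuous_on_subset[OF A'(3)] A'(1)) auto
  then have "closed (graph_on \<tau> A)" by (rule compact_imp_closed)
  then show ?thesis using 0 A'(2) graph by (simp add: in_closed_iff_infdist_zero)
qed

text \<open>At time \<open>0\<close> the estimate reads \<open>s \<le> \<beta> s 0\<close> for every distance \<open>s\<close> from \<open>A\<close> of an initial value, and
  every distance occurs, to the right of the maximum of \<open>A\<close>. So the inverse of \<open>\<beta> s 0\<close> lies below the identity.\<close>

lemma KL_inverse_bound:
  assumes A: "attractor_data h xs \<delta> A \<tau>" and KL: "KL_estimate h \<delta> A \<beta>" and s: "0 < s"
  defines "r \<equiv> KL_inverse0 \<beta> s"
  shows "0 < r" "r \<le> s" "\<beta> r 0 = s"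
proof -
  have K: "class_Kinf (\<lambda>s. \<beta> s 0)" using KL unfolding KL_estimate_def by simp
  then have mono: "strict_mono_on {0..} (\<lambda>s. \<beta> s 0)" and zero: "\<beta> 0 0 = 0"
    and cont: "continuous_on {0..} (\<lambda>s. \<beta> s 0)" unfolding class_Kinf_def by auto
  obtain M where M: "0 \<le> M" "s < \<beta> M 0" using K unfolding class_Kinf_def by blast
  obtain r' where r': "0 \<le> r'" "r' \<le> M" "\<beta> r' 0 = s"
    using IVT'[of "\<lambda>s. \<beta> s 0" 0 s M] zero s M continuous_on_subset[OF cont, of "{0..M}"] by auto
  have inj: "inj_on (\<lambda>s. \<beta> s 0) {0..}" by (rule strict_mono_on_imp_inj_on[OF mono])
  have "KL_inverse0 \<beta> s = r'"
    unfolding KL_inverse0_def using the_inv_into_f_eq[OF inj r'(3)] r' by simp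
  then have r: "r = r'" unfolding r_def .
  show "\<beta> r 0 = s" using r r' by simp
  show "0 < r" using r r' zero s by (cases "r' = 0") auto
  have A': "compact A" "A \<noteq> {}" "globally_asymptotically_stable (avg_x_field h \<delta> 1) A"
    using A unfolding attractor_data_def by auto
  obtain m where m: "m \<in> A" "\<And>a. a \<in> A \<Longrightarrow> a \<le> m" using compact_attains_sup[OF A'(1,2)] by blast
  have dist: "infdist (m + r) A = r"
  proof (rule antisym)
    show "infdist (m + r) A \<le> r" using infdist_le[OF m(1), of "m + r"] \<open>0 < r\<close> by (simp add: dist_real_def)
    have "r \<le> dist (m + r) a" if "a \<in> A" for a using m(2)[OF that] \<open>0 < r\<close> by (simp add: dist_real_def)
    then show "r \<le> infdist (m + r) A" using A'(2) by (simp add: infdist_def cINF_greatest)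
  qed
  obtain x where "solution (avg_x_field h \<delta> 1) x" "x 0 = m + r"
    using A'(3) unfolding globally_asymptotically_stable_def by blast
  then have "infdist (m + r) A \<le> \<beta> (infdist (m + r) A) (1 * 0)"
    using KL unfolding KL_estimate_def by (metis order_refl zero_less_one)
  then show "r \<le> s" using dist \<open>\<beta> r 0 = s\<close> by simp
qed

section \<open>The admissible gain and the settling time\<close>

text \<open>The factor \<open>1 / (1 + L)\<close> limits the variation of \<open>h\<close> over one capture radius to \<open>d / 8\<close>, so that
  \<open>y\<close>, too, ends up within \<open>d / 2\<close> of its target.\<close>

definition capture_radius :: "real \<Rightarrow> real \<Rightarrow> real \<Rightarrow> real" where
  "capture_radius L \<delta> d = min 1 (min d \<delta>) / (8 * (1 + L))"

definition gain_bound :: "real \<Rightarrow> real \<Rightarrow> real \<Rightarrow> real" where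
  "gain_bound L \<delta> d = capture_radius L \<delta> d / (40 * (1 + L) * (\<delta> + rate_bound L \<delta>))"

lemma capture_radius_bounds:
  assumes "0 < L" "0 < \<delta>" "0 < d"
  shows "0 < capture_radius L \<delta> d" "capture_radius L \<delta> d \<le> 1/8" "capture_radius L \<delta> d \<le> \<delta> / 8"
    "capture_radius L \<delta> d \<le> d / 8"
    "L * capture_radius L \<delta> d \<le> d / 8"
proof -
  let ?m = "min 1 (min d \<delta>)" and ?r = "capture_radius L \<delta> d"
  have m: "0 < ?m" "?m \<le> 1" "?m \<le> d" "?m \<le> \<delta>" using assms by auto
  show r: "0 < ?r" unfolding capture_radius_def using m assms by simp
  have eq: "(1 + L) * ?r = ?m / 8" unfolding capture_radius_def using assms by (simp add: field_simps)
  have split: "(1 + L) * ?r = ?r + L * ?r" by (simp add: algebra_simps)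
  have L: "0 < L * ?r" using r assms by simp
  show "?r \<le> 1/8" "?r \<le> \<delta> / 8" "?r \<le> d / 8" "L * ?r \<le> d / 8"
    using eq split L r m by linarith+
qed

lemma rate_bound_mono: "0 \<le> L\<^sub>0 \<Longrightarrow> L\<^sub>0 \<le> L \<Longrightarrow> 0 < \<delta> \<Longrightarrow> rate_bound L\<^sub>0 \<delta> \<le> rate_bound L \<delta>"
  unfolding rate_bound_def lag_bound_def by (intro mult_left_mono add_mono mult_mono) auto

lemma rate_bound_ge: "0 \<le> L \<Longrightarrow> 0 < \<delta> \<Longrightarrow> 4 \<le> rate_bound L \<delta>"
  unfolding rate_bound_def lag_bound_def by simp

lemma gain_bound_eq:
  assumes "0 < L" "0 < \<delta>"
  shows "gain_bound L \<delta> d * (1 + L) * (\<delta> + rate_bound L \<delta>) = capture_radius L \<delta> d / 40"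
proof -
  have "(1 + L) * (\<delta> + rate_bound L \<delta>) \<noteq> 0" using assms rate_bound_ge[of L \<delta>] by simp
  moreover have "c / (40 * X) * X = c / 40" if "X \<noteq> 0" for c X :: real using that by simp
  ultimately show ?thesis unfolding gain_bound_def mult.assoc by blast
qed

lemma gain_bound_pos: "0 < L \<Longrightarrow> 0 < \<delta> \<Longrightarrow> 0 < d \<Longrightarrow> 0 < gain_bound L \<delta> d"
  using capture_radius_bounds(1)[of L \<delta> d] rate_bound_ge[of L \<delta>] unfolding gain_bound_def
  by (intro divide_pos_pos mult_pos_pos) auto

lemma gain_bound_le_1:
  assumes "0 < L" "0 < \<delta>" "0 < d" shows "gain_bound L \<delta> d \<le> 1"
proof -
  have "gain_bound L \<delta> d * 1 \<le> gain_bound L \<delta> d * ((1 + L) * (\<delta> + rate_bound L \<delta>))"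
  proof (rule mult_left_mono)
    have "1 * 1 \<le> (1 + L) * (\<delta> + rate_bound L \<delta>)"
      using assms rate_bound_ge[of L \<delta>] by (intro mult_mono) auto
    then show "1 \<le> (1 + L) * (\<delta> + rate_bound L \<delta>)" by simp
  qed (use gain_bound_pos[OF assms] in simp)
  also have "\<dots> = capture_radius L \<delta> d / 40" using gain_bound_eq[OF assms(1,2), of d] by (simp add: mult.assoc)
  finally show ?thesis using capture_radius_bounds(2)[OF assms] by simp
qed

text \<open>A gain that is admissible for a large Lipschitz constant is admissible for every smaller one.\<close>

lemma gain_bound_antimono:
  assumes "0 < L\<^sub>0" "L\<^sub>0 \<le> L" "0 < \<delta>" "0 < d"
  shows "gain_bound L \<delta> d \<le> gain_bound L\<^sub>0 \<delta> d"
  unfolding gain_bound_def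
proof (rule frac_le)
  show "0 \<le> capture_radius L\<^sub>0 \<delta> d" using capture_radius_bounds(1)[of L\<^sub>0 \<delta> d] assms by simp
  show "capture_radius L \<delta> d \<le> capture_radius L\<^sub>0 \<delta> d"
    unfolding capture_radius_def using assms by (intro divide_left_mono mult_left_mono mult_pos_pos) auto
  show "0 < 40 * (1 + L\<^sub>0) * (\<delta> + rate_bound L\<^sub>0 \<delta>)"
    using assms rate_bound_ge[of L\<^sub>0 \<delta>] by (intro mult_pos_pos) auto
  show "40 * (1 + L\<^sub>0) * (\<delta> + rate_bound L\<^sub>0 \<delta>) \<le> 40 * (1 + L) * (\<delta> + rate_bound L \<delta>)"
    using assms rate_bound_mono[of L\<^sub>0 L \<delta>] rate_bound_ge[of L\<^sub>0 \<delta>] by (intro mult_mono add_mono) auto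
qed

definition settles_by :: "(real \<Rightarrow> real) \<Rightarrow> real \<Rightarrow> real \<Rightarrow> real \<Rightarrow> real \<Rightarrow> real \<Rightarrow> real \<Rightarrow> real \<Rightarrow> bool" where
  "settles_by h \<delta> \<gamma> x0 y0 e d s \<longleftrightarrow>
     (\<exists>x y. es_trajectory h \<delta> \<gamma> x0 y0 x y) \<and>
     (\<forall>x y. es_trajectory h \<delta> \<gamma> x0 y0 x y \<longrightarrow>
        bounded ((\<lambda>t. (x t, y t)) ` {0..}) \<and>
        (\<forall>t\<ge>s. \<bar>x t - e\<bar> \<le> d / 2 \<and> \<bar>y t - a0 h \<delta> e / 2\<bar> \<le> d / 2))"

text \<open>The increment \<open>\<alpha> (\<rho> / 2)\<close> of \<open>h\<close> yields a lower bound for the speed on both sides of \<open>e\<close>, uniformly in the gain. The time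
  \<open>T\<close> consists of the time to capture \<open>x\<close> and the time for the filter to forget its
  initial error, both in units of \<open>1 / \<gamma>\<close>.\<close>

lemma practical_convergence:
  fixes h dh :: "real \<Rightarrow> real"
  assumes deriv: "\<And>v. (h has_real_derivative dh v) (at v)" and dh_cont: "continuous_on UNIV dh"
    and left: "\<And>v. v \<le> xs \<Longrightarrow> dh v \<le> 0" and right: "\<And>v. xs \<le> v \<Longrightarrow> 0 \<le> dh v"
    and \<alpha>: "\<And>s. 0 < s \<Longrightarrow> 0 < \<alpha> s"
      "\<And>x1 x2. 0 \<le> (x1 - xs) * (x2 - xs) \<Longrightarrow> \<alpha> \<bar>x2 - x1\<bar> \<le> \<bar>h x2 - h x1\<bar>"
    and pos: "0 < L" "0 < \<delta>" "0 < d" and r: "d + 2 * \<delta> < r"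
    and bound: "\<And>v. \<bar>v - xs\<bar> \<le> r \<Longrightarrow> \<bar>dh v\<bar> \<le> L"
    and e: "b1 h \<delta> e = 0" "e - \<delta> < xs" "xs < e + \<delta>"
  obtains T where "0 < T"
    "\<And>\<gamma> x0 y0. 0 < \<gamma> \<Longrightarrow> \<gamma> \<le> gain_bound L \<delta> d \<Longrightarrow> \<bar>x0 - xs\<bar> \<le> r - d - 2 * \<delta> \<Longrightarrow> \<bar>y0 - a0 h \<delta> x0 / 2\<bar> \<le> 1 \<Longrightarrow>
      settles_by h \<delta> \<gamma> x0 y0 e d (T / \<gamma>)"
proof -
  have r0: "0 < r" using r pos by linarith
  obtain g dg where cost: "unimodal_cost g dg xs L"
    and gh: "\<And>v. xs - r \<le> v \<Longrightarrow> v \<le> xs + r \<Longrightarrow> g v = h v"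
    using unimodal_extension[OF deriv dh_cont left right r0 bound] by blast
  interpret G: unimodal_cost g dg xs L by (rule cost)
  have gh_probe: "g (v + \<delta> * sin \<theta>) = h (v + \<delta> * sin \<theta>)" if "\<bar>v - xs\<bar> \<le> r - \<delta>" for v \<theta>
    using probe_le[OF pos(2), of \<theta>] that by (intro gh) linarith+
  have a0_eq: "a0 g \<delta> v = a0 h \<delta> v" and b1_eq: "b1 g \<delta> v = b1 h \<delta> v" if "\<bar>v - xs\<bar> \<le> r - \<delta>" for v
    unfolding a0_def b1_def using gh_probe[OF that] by simp_all
  have e_in: "\<bar>e - xs\<bar> \<le> r - \<delta>" using e r pos by linarith
  have "b1 g \<delta> e = 0" using b1_eq[OF e_in] e by simp
  then obtain \<Phi> where "balanced_cost g dg xs L \<delta> e \<Phi>"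
    using G.balanced_cost_exists[OF pos(2) _ e(2,3)] by blast
  then interpret B: balanced_cost g dg xs L \<delta> e \<Phi> .
  define \<rho> where "\<rho> = capture_radius L \<delta> d"
  have \<rho>: "0 < \<rho>" "\<rho> \<le> 1/8" "\<rho> \<le> \<delta> / 8" "\<rho> \<le> d / 8" "L * \<rho> \<le> d / 8"
    unfolding \<rho>_def using capture_radius_bounds[OF pos] by auto
  define \<kappa> where "\<kappa> = \<alpha> (\<rho> / 2)"
  have \<kappa>: "0 < \<kappa>" unfolding \<kappa>_def using \<alpha>(1) \<rho> by simp
  define lag where "lag = lag_bound L \<delta>"
  have L\<delta>: "0 < L * \<delta>" using pos by simp
  have lag0: "0 \<le> lag" unfolding lag_def lag_bound_def using pos by simp
  define T1 where "T1 = 40 * \<delta> * (2 * (r + 1) + 2 * lag + 4) / (\<rho> * \<kappa>) + 4"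
  define Y where "Y = lag + 2 * (L * \<rho>) + L * \<delta> + 1"
  have Y: "0 < Y" unfolding Y_def using lag0 \<rho> L\<delta> pos by (intro add_nonneg_pos add_nonneg_nonneg) auto
  have T1: "0 < T1" unfolding T1_def using pos \<rho> \<kappa> lag0 r0 by (intro add_nonneg_pos divide_nonneg_pos mult_nonneg_nonneg) auto
  have main: "es_trajectory h \<delta> \<gamma> x0 y0 x y \<and> bounded ((\<lambda>t. (x t, y t)) ` {0..}) \<and>
      (\<forall>t. (T1 + 8 * Y / d) / \<gamma> \<le> t \<longrightarrow> \<bar>x t - e\<bar> \<le> d / 2 \<and> \<bar>y t - a0 h \<delta> e / 2\<bar> \<le> d / 2)"
    if \<gamma>: "0 < \<gamma>" "\<gamma> \<le> gain_bound L \<delta> d" and x0: "\<bar>x0 - xs\<bar> \<le> r - d - 2 * \<delta>"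
      and y0: "\<bar>y0 - a0 h \<delta> x0 / 2\<bar> \<le> 1" and traj: "es_trajectory g \<delta> \<gamma> x0 y0 x y" for \<gamma> x0 y0 x y
  proof -
    have init: "x 0 = x0" "y 0 = y0" using traj unfolding es_trajectory_def by auto
    interpret E: es_system g dg xs L \<delta> \<gamma> \<rho> x y
    proof
      have "\<gamma> * ((1 + L) * (\<delta> + rate_bound L \<delta>)) \<le> gain_bound L \<delta> d * ((1 + L) * (\<delta> + rate_bound L \<delta>))"
        using \<gamma> pos rate_bound_ge[of L \<delta>] by (intro mult_right_mono mult_nonneg_nonneg) auto
      then show "\<gamma> * (1 + L) * (\<delta> + rate_bound L \<delta>) \<le> \<rho> / 40"
        using gain_bound_eq[OF pos(1,2), of d] unfolding \<rho>_def mult.assoc by linarith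
      show "continuous_on {0..} x" "continuous_on {0..} y" using es_trajectory_cont[OF traj] by auto
      show "(x has_real_derivative - \<gamma> * (g (x t + \<delta> * sin (2 * pi * t)) - y t) * sin (2 * pi * t)) (at t)"
        "(y has_real_derivative \<gamma> * (g (x t + \<delta> * sin (2 * pi * t)) - y t)) (at t)" if "0 < t" for t
        using es_trajectory_deriv[OF traj that] unfolding dither_def by auto
    qed (use pos \<rho> \<gamma> in auto)
    have x0_in: "\<bar>x0 - xs\<bar> \<le> r - \<delta>" using x0 pos by linarith
    have "\<bar>y 0 - g (x 0)\<bar> \<le> 1 + L * \<delta>"
      using G.mean_near[OF pos(2), of x0] y0 a0_eq[OF x0_in] unfolding init by linarith
    then interpret S: settled_system g dg xs L \<delta> \<gamma> \<rho> x y
      by unfold_locales (rule E.lag_bounded)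
    interpret balanced_system g dg xs L \<delta> \<gamma> \<rho> x y e \<Phi> ..
    have x_in: "\<bar>x t - xs\<bar> \<le> r - \<delta>" if "0 \<le> t" for t
    proof -
      have "max (x 0) (e + \<rho>) + \<rho> \<le> xs + (r - \<delta>)" "xs - (r - \<delta>) \<le> min (x 0) (e - \<rho>) - \<rho>"
        using x0 e r pos \<rho> unfolding init by (auto simp: max_def min_def abs_le_iff)
      then show ?thesis using confined[OF that] by (simp add: abs_le_iff)
    qed
    \<comment> \<open>The probe never leaves the window, where \<open>g\<close> and \<open>h\<close> agree.\<close>
    have traj_h: "es_trajectory h \<delta> \<gamma> x0 y0 x y"
      using traj gh_probe[OF x_in] unfolding es_trajectory_def dither_def by simp
    have bdd: "bounded ((\<lambda>t. (x t, y t)) ` {0..})"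
    proof (rule bounded_subset)
      show "bounded ({xs - r..xs + r} \<times> {- (\<bar>g xs\<bar> + L * r + lag)..\<bar>g xs\<bar> + L * r + lag})"
        by (intro bounded_Times) auto
      have "\<bar>y t\<bar> \<le> \<bar>g xs\<bar> + L * r + lag" if "0 \<le> t" for t
      proof -
        have "L * \<bar>x t - xs\<bar> \<le> L * r" using x_in[OF that] pos by (intro mult_left_mono) auto
        then show ?thesis using G.lip[of "x t" xs] S.lag_le[OF that] unfolding lag_def by linarith
      qed
      then show "(\<lambda>t. (x t, y t)) ` {0..} \<subseteq> {xs - r..xs + r} \<times> {- (\<bar>g xs\<bar> + L * r + lag)..\<bar>g xs\<bar> + L * r + lag}"
        using x_in pos by (force simp: abs_le_iff)
    qed
    have near: "\<bar>x t - e\<bar> \<le> 2 * \<rho>" if "T1 / \<gamma> \<le> t" for t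
    proof (rule converges[OF \<kappa>])
      show "\<kappa> \<le> g (x t + \<delta> - \<rho> + \<rho> / 2) - g (x t + \<delta> - \<rho>)" if "0 \<le> t" "e + \<rho> \<le> x t" for t
      proof -
        let ?v = "x t + \<delta> - \<rho>"
        have v: "xs \<le> ?v" "?v + \<rho> / 2 \<le> xs + r" using that e \<rho> x_in[of t] by (auto simp: abs_le_iff)
        have "\<alpha> \<bar>(?v + \<rho> / 2) - ?v\<bar> \<le> \<bar>h (?v + \<rho> / 2) - h ?v\<bar>"
          using v \<rho> by (intro \<alpha>(2) mult_nonneg_nonneg) auto
        moreover have "g (?v + \<rho> / 2) = h (?v + \<rho> / 2)" "g ?v = h ?v" using v \<rho> r0 by (auto intro!: gh)
        moreover have "g ?v \<le> g (?v + \<rho> / 2)" using v \<rho> by (intro G.h_mono) auto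
        ultimately show ?thesis unfolding \<kappa>_def using \<rho> by simp
      qed
      show "\<kappa> \<le> g (x t - \<delta> + \<rho> - \<rho> / 2) - g (x t - \<delta> + \<rho>)" if "0 \<le> t" "x t \<le> e - \<rho>" for t
      proof -
        let ?v = "x t - \<delta> + \<rho>"
        have v: "?v \<le> xs" "xs - r \<le> ?v - \<rho> / 2" using that e \<rho> x_in[of t] by (auto simp: abs_le_iff)
        have "\<alpha> \<bar>(?v - \<rho> / 2) - ?v\<bar> \<le> \<bar>h (?v - \<rho> / 2) - h ?v\<bar>"
          using v \<rho> by (intro \<alpha>(2) mult_nonpos_nonpos) auto
        moreover have "g (?v - \<rho> / 2) = h (?v - \<rho> / 2)" "g ?v = h ?v" using v \<rho> r0 by (auto intro!: gh)
        moreover have "g ?v \<le> g (?v - \<rho> / 2)" using v \<rho> by (intro G.h_antimono) auto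
        ultimately show ?thesis unfolding \<kappa>_def using \<rho> by simp
      qed
      show "\<bar>x 0 - e\<bar> \<le> r" using x0 e r pos unfolding init by linarith
      show "(40 * \<delta> * (2 * (r + 1) + 2 * lag_bound L \<delta> + 4) / (\<rho> * \<kappa>) + 4) / \<gamma> \<le> t"
        using that unfolding T1_def lag_def .
    qed
    let ?a = "T1 / \<gamma>" and ?m = "a0 g \<delta> e / 2"
    have a: "0 \<le> ?a" using T1 \<gamma> by simp
    have y_near: "\<bar>y t - ?m\<bar> \<le> d / 2" if t: "(T1 + 8 * Y / d) / \<gamma> \<le> t" for t
    proof -
      have split: "(T1 + 8 * Y / d) / \<gamma> = ?a + 8 * Y / d / \<gamma>" by (simp add: add_divide_distrib)
      have "0 \<le> 8 * Y / d / \<gamma>" using Y pos \<gamma> by simp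
      then have ta: "?a \<le> t" using t split by linarith
      have mean: "?m = integral {0..1} (\<lambda>t. g (e + \<delta> * sin (2 * pi * t)))" unfolding a0_def by simp
      have gL: "0 \<le> \<gamma> * L * \<delta>" "\<gamma> * L * \<delta> \<le> \<rho> / 40" using E.gain_expanded by linarith+
      have "\<bar>y ?a - ?m\<bar> + 2 * (\<gamma> * L * \<delta>) \<le> Y"
      proof -
        have "L * \<bar>x ?a - e\<bar> \<le> L * (2 * \<rho>)" using near[of ?a] pos by (intro mult_left_mono) auto
        then have "\<bar>g (x ?a) - g e\<bar> \<le> 2 * (L * \<rho>)" using G.lip[of "x ?a" e] by simp
        then show ?thesis
          using S.lag_le[OF a] G.mean_near[OF pos(2), of e] gL \<rho> unfolding Y_def lag_def by linarith
      qed
      then have "exp (- \<gamma> * (t - ?a)) * (\<bar>y ?a - ?m\<bar> + 2 * (\<gamma> * L * \<delta>)) \<le> exp (- \<gamma> * (t - ?a)) * Y"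
        by (intro mult_left_mono) auto
      also have "\<dots> \<le> exp (- (8 * Y / d)) * Y"
      proof -
        have "8 * Y / d / \<gamma> \<le> t - ?a" using t split by linarith
        then have "8 * Y / d \<le> (t - ?a) * \<gamma>" using pos_divide_le_eq[OF \<gamma>(1)] by blast
        then have "8 * Y / d \<le> \<gamma> * (t - ?a)" by (simp only: mult.commute)
        then show ?thesis using Y by (intro mult_right_mono) auto
      qed
      also have "\<dots> \<le> d / 8"
      proof -
        have "8 * Y / d \<le> exp (8 * Y / d)" using exp_ge_add_one_self[of "8 * Y / d"] by linarith
        then have "Y \<le> exp (8 * Y / d) * (d / 8)" using pos by (simp add: field_simps)
        then have "exp (- (8 * Y / d)) * Y \<le> exp (- (8 * Y / d)) * (exp (8 * Y / d) * (d / 8))"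
          by (intro mult_left_mono) auto
        then show ?thesis by (simp add: mult.assoc[symmetric] exp_add[symmetric])
      qed
      finally have decay: "exp (- \<gamma> * (t - ?a)) * (\<bar>y ?a - ?m\<bar> + 2 * (\<gamma> * L * \<delta>)) \<le> d / 8" .
      have "\<bar>y t - ?m\<bar> \<le> 2 * L * \<rho> + 4 * (\<gamma> * L * \<delta>)
          + exp (- \<gamma> * (t - ?a)) * (\<bar>y ?a - ?m\<bar> + 2 * (\<gamma> * L * \<delta>))"
        using near by (intro E.filter_converges[OF a _ mean ta]) auto
      moreover have "2 * L * \<rho> = 2 * (L * \<rho>)" by simp
      ultimately show ?thesis using decay gL \<rho> by linarith
    qed
    have "\<bar>x t - e\<bar> \<le> d / 2 \<and> \<bar>y t - a0 h \<delta> e / 2\<bar> \<le> d / 2" if t: "(T1 + 8 * Y / d) / \<gamma> \<le> t" for t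
    proof -
      have "T1 / \<gamma> \<le> (T1 + 8 * Y / d) / \<gamma>" using Y pos \<gamma> by (intro divide_right_mono) auto
      then have "\<bar>x t - e\<bar> \<le> 2 * \<rho>" using near t by simp
      then show ?thesis using \<rho>(4) y_near[OF t] a0_eq[OF e_in] pos by simp
    qed
    then show ?thesis using traj_h bdd by blast
  qed
  show thesis
  proof (rule that[of "T1 + 8 * Y / d"])
    show "0 < T1 + 8 * Y / d" using T1 Y pos by (intro add_pos_pos) auto
    fix \<gamma> x0 y0
    assume as: "0 < \<gamma>" "\<gamma> \<le> gain_bound L \<delta> d" "\<bar>x0 - xs\<bar> \<le> r - d - 2 * \<delta>" "\<bar>y0 - a0 h \<delta> x0 / 2\<bar> \<le> 1"
    obtain x y where "es_trajectory g \<delta> \<gamma> x0 y0 x y" using G.es_trajectory_exists as(1) less_imp_le by blast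
    note xy = main[OF as this]
    have same: "x' t = x t" "y' t = y t" if "es_trajectory h \<delta> \<gamma> x0 y0 x' y'" "0 \<le> t" for x' y' t
      using es_trajectory_unique[OF deriv dh_cont _ that(1) _ that(2)] xy as(1) less_imp_le by blast+
    show "settles_by h \<delta> \<gamma> x0 y0 e d ((T1 + 8 * Y / d) / \<gamma>)"
      unfolding settles_by_def
    proof (intro conjI allI impI)
      show "\<exists>x y. es_trajectory h \<delta> \<gamma> x0 y0 x y" using xy by blast
      fix x' y' assume tr: "es_trajectory h \<delta> \<gamma> x0 y0 x' y'"
      have "(\<lambda>t. (x' t, y' t)) ` {0..} = (\<lambda>t. (x t, y t)) ` {0..}"
        using same[OF tr] by (intro image_cong) auto
      then show "bounded ((\<lambda>t. (x' t, y' t)) ` {0..})" using xy by simp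
      fix t assume t: "(T1 + 8 * Y / d) / \<gamma> \<le> t"
      have "0 \<le> (T1 + 8 * Y / d) / \<gamma>" using T1 Y pos as(1) by (intro divide_nonneg_pos add_nonneg_nonneg) auto
      then have "0 \<le> t" using t by linarith
      then show "\<bar>x' t - e\<bar> \<le> d / 2" "\<bar>y' t - a0 h \<delta> e / 2\<bar> \<le> d / 2"
        using same[OF tr] xy t by auto
    qed
  qed
qed

text \<open>The maximum of \<open>\<bar>h'\<bar>\<close> on the window is the smallest Lipschitz constant there. The time obtained
  from it serves all \<open>L\<close>, because a larger \<open>L\<close> only allows smaller gains.\<close>

lemma uniform_settling_time:
  assumes A1: "assumption_A1 h xs" and A2: "assumption_A2 h xs" and \<delta>: "0 < \<delta>" and d: "0 < d"
    and r: "d + 2 * \<delta> < r"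
    and e: "b1 h \<delta> e = 0" "e - \<delta> < xs" "xs < e + \<delta>"
  obtains T where "0 < T"
    "\<And>L \<gamma> x0 y0. 0 < L \<Longrightarrow> L-lipschitz_on {xs - r..xs + r} h \<Longrightarrow> 0 < \<gamma> \<Longrightarrow> \<gamma> \<le> gain_bound L \<delta> d \<Longrightarrow>
      \<bar>x0 - xs\<bar> \<le> r - d - 2 * \<delta> \<Longrightarrow> \<bar>y0 - a0 h \<delta> x0 / 2\<bar> \<le> 1 \<Longrightarrow>
      settles_by h \<delta> \<gamma> x0 y0 e d (T / \<gamma>)"
proof -
  note D = cost_derivative[OF A1 A2]
  let ?I = "{xs - r..xs + r}"
  have r0: "0 < r" using r \<delta> d by linarith
  have "continuous_on ?I (\<lambda>v. \<bar>deriv h v\<bar>)" by (intro continuous_intros continuous_on_subset[OF D(2)]) auto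
  then obtain v0 where v0: "v0 \<in> ?I" "\<And>v. v \<in> ?I \<Longrightarrow> \<bar>deriv h v\<bar> \<le> \<bar>deriv h v0\<bar>"
    using continuous_attains_sup[of ?I "\<lambda>v. \<bar>deriv h v\<bar>"] r0 by auto
  define L0 where "L0 = \<bar>deriv h v0\<bar>"
  have h_cont: "continuous_on S h" for S
    using D(1) by (meson DERIV_isCont continuous_at_imp_continuous_on)
  have "\<bar>h (xs + r) - h xs\<bar> \<le> L0 * (xs + r - xs)"
  proof (rule increment_bound)
    fix t assume "xs < t" "t < xs + r"
    then show "\<exists>D. (h has_real_derivative D) (at t) \<and> \<bar>D\<bar> \<le> L0"
      using D(1)[of t] v0(2)[of t] r0 unfolding L0_def by auto
  qed (use r0 h_cont in auto)
  moreover have "h xs < h (xs + r)" using A1 r0 unfolding assumption_A1_def by force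
  ultimately have L0: "0 < L0" using r0 
    by (cases "deriv h v0 = 0") (auto simp: L0_def)
  obtain \<alpha> where \<alpha>: "class_Kinf \<alpha>"
      "\<And>x1 x2. 0 \<le> (x1 - xs) * (x2 - xs) \<Longrightarrow> \<alpha> \<bar>x2 - x1\<bar> \<le> \<bar>h x2 - h x1\<bar>"
    using A2 unfolding assumption_A2_def by blast
  have \<alpha>_pos: "0 < \<alpha> s" if "0 < s" for s
    using \<alpha>(1) that strict_mono_onD[of "{0..}" \<alpha> 0 s] unfolding class_Kinf_def by auto
  have bound: "\<bar>deriv h v\<bar> \<le> L0" if "\<bar>v - xs\<bar> \<le> r" for v
    using v0(2)[of v] that unfolding L0_def by (auto simp: abs_le_iff)
  obtain T where T: "0 < T"
    "\<And>\<gamma> x0 y0. 0 < \<gamma> \<Longrightarrow> \<gamma> \<le> gain_bound L0 \<delta> d \<Longrightarrow> \<bar>x0 - xs\<bar> \<le> r - d - 2 * \<delta> \<Longrightarrow> \<bar>y0 - a0 h \<delta> x0 / 2\<bar> \<le> 1 \<Longrightarrow>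
      settles_by h \<delta> \<gamma> x0 y0 e d (T / \<gamma>)"
    using practical_convergence[OF D \<alpha>_pos \<alpha>(2) L0 \<delta> d r bound e] by blast
  have "gain_bound L \<delta> d \<le> gain_bound L0 \<delta> d" if "L-lipschitz_on ?I h" for L
    using lipschitz_derivative_bound[OF that D(1) v0(1)] r0 L0 \<delta> d
    by (intro gain_bound_antimono) (auto simp: L0_def)
  then show thesis using T that[of T] order_trans by meson
qed

theorem theorem1:
  shows "\<exists>gstar :: real \<Rightarrow> real \<Rightarrow> real \<Rightarrow> real.
    (\<forall>L \<delta> d. 0 < L \<and> 0 < \<delta> \<and> 0 < d \<longrightarrow> 0 < gstar L \<delta> d) \<and>
    (\<forall>(h :: real \<Rightarrow> real) (xs :: real) (\<delta> :: real) (A :: real set) (\<tau> :: real \<Rightarrow> real)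
        (\<beta> :: real \<Rightarrow> real \<Rightarrow> real).
      assumption_A1 h xs \<and> assumption_A2 h xs \<and> 0 < \<delta> \<and>
      attractor_data h xs \<delta> A \<tau> \<and> KL_estimate h \<delta> A \<beta> \<longrightarrow>
      (\<exists>tbar :: real \<Rightarrow> real \<Rightarrow> real.
        (\<forall>r0 d. 0 < r0 \<and> 0 < d \<longrightarrow> 0 < tbar r0 d) \<and>
        (\<forall>r d L r0.
          0 < r \<and> 0 < d \<and> 0 < r - d - 2 * \<delta> \<and>
          0 < L \<and> L-lipschitz_on {xs - r..xs + r} h \<and>
          r0 = KL_inverse0 \<beta> (r - d - 2 * \<delta>) \<longrightarrow>
          (\<forall>\<gamma> x0 y0.
            0 < \<gamma> \<and> \<gamma> < gstar L \<delta> d \<and>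
            \<bar>x0 - xs\<bar> \<le> r0 \<and> \<bar>y0 - a0 h \<delta> x0 / 2\<bar> \<le> gstar L \<delta> d \<longrightarrow>
            (\<exists>x y. es_trajectory h \<delta> \<gamma> x0 y0 x y) \<and>
            (\<forall>x y. es_trajectory h \<delta> \<gamma> x0 y0 x y \<longrightarrow>
              bounded ((\<lambda>t. (x t, y t)) ` {0..}) \<and>
              (\<forall>t. tbar r0 d / \<gamma> \<le> t \<longrightarrow> infdist (x t, y t) (graph_on \<tau> A) \<le> d))))))"
proof (intro exI[of _ gain_bound] conjI allI impI, goal_cases)
  case (1 L \<delta> d)
  then show ?case using gain_bound_pos by blast
next
  case (2 h xs \<delta> A \<tau> \<beta>)
  then have A1: "assumption_A1 h xs" and A2: "assumption_A2 h xs" and \<delta>: "0 < \<delta>"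
    and A: "attractor_data h xs \<delta> A \<tau>" and KL: "KL_estimate h \<delta> A \<beta>" by auto
  note D = cost_derivative[OF A1 A2]
  have above_min: "h xs < h x" if "x \<noteq> xs" for x using A1 that unfolding assumption_A1_def by simp
  obtain e where e: "b1 h \<delta> e = 0" "e - \<delta> < xs" "xs < e + \<delta>"
    using balance_point[OF D \<delta>] above_min \<delta> by (metis add_cancel_left_right diff_add_cancel less_irrefl)
  have target: "(e, a0 h \<delta> e / 2) \<in> graph_on \<tau> A" by (rule attractor_equilibrium[OF A e(1)])
  define time where "time r0 d T \<longleftrightarrow> 0 < T \<and>
      (\<forall>r L \<gamma> x0 y0. 0 < r - d - 2 * \<delta> \<and> 0 < L \<and> L-lipschitz_on {xs - r..xs + r} h \<and>
        r0 = KL_inverse0 \<beta> (r - d - 2 * \<delta>) \<and> 0 < \<gamma> \<and> \<gamma> < gain_bound L \<delta> d \<and> \<bar>x0 - xs\<bar> \<le> r0 \<and>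
        \<bar>y0 - a0 h \<delta> x0 / 2\<bar> \<le> gain_bound L \<delta> d \<longrightarrow> settles_by h \<delta> \<gamma> x0 y0 e d (T / \<gamma>))" for r0 d T
  have time_exists: "\<exists>T. 0 < d \<longrightarrow> time r0 d T" for r0 d
  proof (cases "0 < d \<and> 0 < \<beta> r0 0")
    case False
    have "\<not> (0 < r - d - 2 * \<delta> \<and> r0 = KL_inverse0 \<beta> (r - d - 2 * \<delta>))" if "0 < d" for r
      using False KL_inverse_bound(3)[OF A KL, of "r - d - 2 * \<delta>"] that by auto
    then show ?thesis unfolding time_def by (intro exI[of _ 1]) auto
  next
    case True
    \<comment> \<open>The radius is determined by \<open>r0\<close> and \<open>d\<close>, so the time may depend on it.\<close>
    define R where "R = \<beta> r0 0 + d + 2 * \<delta>"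
    have d: "0 < d" and R: "d + 2 * \<delta> < R" using True unfolding R_def by auto
    obtain T where T: "0 < T"
      "\<And>L \<gamma> x0 y0. 0 < L \<Longrightarrow> L-lipschitz_on {xs - R..xs + R} h \<Longrightarrow> 0 < \<gamma> \<Longrightarrow> \<gamma> \<le> gain_bound L \<delta> d \<Longrightarrow>
        \<bar>x0 - xs\<bar> \<le> R - d - 2 * \<delta> \<Longrightarrow> \<bar>y0 - a0 h \<delta> x0 / 2\<bar> \<le> 1 \<Longrightarrow> settles_by h \<delta> \<gamma> x0 y0 e d (T / \<gamma>)"
      using uniform_settling_time[OF A1 A2 \<delta> d R e] by blast
    have "settles_by h \<delta> \<gamma> x0 y0 e d (T / \<gamma>)"
      if r: "0 < r - d - 2 * \<delta>" and L: "0 < L" "L-lipschitz_on {xs - r..xs + r} h"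
        and r0: "r0 = KL_inverse0 \<beta> (r - d - 2 * \<delta>)" and \<gamma>: "0 < \<gamma>" "\<gamma> < gain_bound L \<delta> d"
        and x0: "\<bar>x0 - xs\<bar> \<le> r0" and y0: "\<bar>y0 - a0 h \<delta> x0 / 2\<bar> \<le> gain_bound L \<delta> d" for r L \<gamma> x0 y0
    proof -
      have "R = r" "r0 \<le> r - d - 2 * \<delta>"
        using KL_inverse_bound(2,3)[OF A KL r] unfolding r0[symmetric] R_def by auto
      then show ?thesis
        using L \<gamma> x0 y0 gain_bound_le_1[OF L(1) \<delta> d] by (intro T(2)[of L]) auto
    qed
    then show ?thesis using T(1) unfolding time_def by blast
  qed
  define tbar where "tbar r0 d = (SOME T. 0 < d \<longrightarrow> time r0 d T)" for r0 d
  have tbar: "time r0 d (tbar r0 d)" if "0 < d" for r0 d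
    using someI_ex[OF time_exists[of d r0]] that unfolding tbar_def by blast
  have close: "infdist (a, b) (graph_on \<tau> A) \<le> d"
    if "\<bar>a - e\<bar> \<le> d / 2" "\<bar>b - a0 h \<delta> e / 2\<bar> \<le> d / 2" for a b d
  proof -
    have "infdist (a, b) (graph_on \<tau> A) \<le> dist (a, b) (e, a0 h \<delta> e / 2)" by (rule infdist_le[OF target])
    also have "\<dots> \<le> \<bar>a - e\<bar> + \<bar>b - a0 h \<delta> e / 2\<bar>"
      unfolding dist_norm using norm_Pair_le[of "a - e" "b - a0 h \<delta> e / 2"] by simp
    finally show ?thesis using that by linarith
  qed
  show ?case
  proof (intro exI[of _ tbar] conjI[OF _ allI[OF allI[OF allI[OF allI[OF impI[OF allI[OF allI[OF allI[OF impI]]]]]]]]])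
    show "\<forall>r0 d. 0 < r0 \<and> 0 < d \<longrightarrow> 0 < tbar r0 d" using tbar unfolding time_def by blast
    fix r d L r0 \<gamma> x0 y0
    assume 1: "0 < r \<and> 0 < d \<and> 0 < r - d - 2 * \<delta> \<and> 0 < L \<and> L-lipschitz_on {xs - r..xs + r} h \<and>
        r0 = KL_inverse0 \<beta> (r - d - 2 * \<delta>)"
      and 2: "0 < \<gamma> \<and> \<gamma> < gain_bound L \<delta> d \<and> \<bar>x0 - xs\<bar> \<le> r0 \<and> \<bar>y0 - a0 h \<delta> x0 / 2\<bar> \<le> gain_bound L \<delta> d"
    have "settles_by h \<delta> \<gamma> x0 y0 e d (tbar r0 d / \<gamma>)"
      using tbar[of d r0] 1 2 unfolding time_def by blast
    then show "(\<exists>x y. es_trajectory h \<delta> \<gamma> x0 y0 x y) \<and>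
        (\<forall>x y. es_trajectory h \<delta> \<gamma> x0 y0 x y \<longrightarrow> bounded ((\<lambda>t. (x t, y t)) ` {0..}) \<and>
          (\<forall>t. tbar r0 d / \<gamma> \<le> t \<longrightarrow> infdist (x t, y t) (graph_on \<tau> A) \<le> d))"
      unfolding settles_by_def using close by blast
  qed
qed

end
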